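(* Let $K$ be a field, let $A=K[a_1,\ldots,a_n]$ be a finitely generated associative $K$-algebra with generators $a_1,\ldots,a_n$, let $K\langle X\rangle=K\langle X_1,\ldots,X_n\rangle$ be the free $K$-algebra on $X=\{X_1,\ldots,X_n\}$, and let $\mathbb{B}=\{1,\ X_{i_1}\cdots X_{i_s}\mid X_{i_j}\in X,\ s\ge 1\}$ be its standard $K$-basis. The following two statements are equivalent. (i) $A$ is a solvable polynomial algebra (with respect to the generators $a_1,\ldots,a_n$). (ii) Let $\pi_1: K\langle X\rangle\to A$ be the $K$-algebra epimorphism with $\pi_1(X_i)=a_i$, $1\le i\le n$, let $I=\ker\pi_1$, and let $\overline{A}=K\langle X\rangle/I$, so that $A\cong\overline{A}$ via $\pi_1$. Then the following two conditions (a) and (b) are satisfied: (a) with respect to some monomial ordering $\prec_X$ on $\mathbb{B}$, the ideal $I$ has a finite Gröbner basis and the reduced Gröbner basis of $I$ is of the form $$\mathcal{G}=\Big\{\, g_{ji}=X_jX_i-\lambda_{ji}X_iX_j-F_{ji}\ \Big|\ \mathbf{LM}(g_{ji})=X_jX_i,\ 1\le i<j\le n\Big\},\quad F_{ji}=\sum_q\mu^{ji}_q X_1^{\alpha_{1q}}X_2^{\alpha_{2q}}\cdots X_n^{\alpha_{nq}},$$ where $\lambda_{ji}\in K^*$, $\mu_q^{ji}\in K$ and $(\alpha_{1q},\alpha_{2q},\ldots,\alpha_{nq})\in\mathbb{N}^n$; thereby $\mathscr{B}=\{\overline{X}_1^{\alpha_1}\overline{X}_2^{\alpha_2}\cdots\overline{X}_n^{\alpha_n}\mid\alpha_j\in\mathbb{N}\}$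 forms a PBW $K$-basis for $\overline{A}$, where $\overline{X}_i$ denotes the coset of $X_i$ in $\overline{A}$; and (b) there is a (two-sided) monomial ordering $\prec$ on $\mathscr{B}$ such that, for $1\le i<j\le n$, $\mathbf{LM}(\overline{F}_{ji})\prec\overline{X}_i\overline{X}_j$ whenever $\overline{F}_{ji}\ne 0$, where $\overline{F}_{ji}=\sum_q\mu^{ji}_q\overline{X}_1^{\alpha_{1q}}\overline{X}_2^{\alpha_{2q}}\cdots\overline{X}_n^{\alpha_{nq}}$.
   Context: $K$ is a field, $K^*=K\setminus\{0\}$, $\mathbb{N}$ is the set of nonnegative integers. Algebras are associative with unit. PBW basis. An algebra $A=K[a_1,\ldots,a_n]$ generated by $a_1,\ldots,a_n$ has the PBW $K$-basis $\mathcal{B}$ if $\mathcal{B}=\{a^\alpha=a_1^{\alpha_1}\cdots a_n^{\alpha_n}\mid\alpha=(\alpha_1,\ldots,\alpha_n)\in\mathbb{N}^n\}$ is a $K$-basis of $A$ (distinct $\alpha$ giving distinct elements). Given a total ordering $\prec$ on $\mathcal{B}$ and $0\ne f=\sum_{j=1}^m\lambda_ja^{\alpha(j)}$ with $\lambda_j\in K^*$ and $a^{\alpha(1)}\prec\cdots\prec a^{\alpha(m)}$, the leading monomial is $\mathbf{LM}(f)=a^{\alpha(m)}$. The same definition of $\mathbf{LM}$ is used for elements of the free algebra with respect to a total ordering on its basis $\mathbb{B}$. Monomial ordering on a PBW basis. A total ordering $\prec$ on $\mathcal{B}$ is a left monomial ordering if: (1) $\prec$ is a well-ordering; (2) for $a^\gamma,a^\alpha,a^\beta\in\mathcal{B}$,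 if $a^\alpha\prec a^\beta$ and $\mathbf{LM}(a^\gamma a^\alpha),\mathbf{LM}(a^\gamma a^\beta)\notin K$, then $\mathbf{LM}(a^\gamma a^\alpha)\prec\mathbf{LM}(a^\gamma a^\beta)$; (3) for $a^\gamma,a^\alpha,a^\beta\in\mathcal{B}$, if $a^\beta\ne a^\gamma$ and $a^\gamma=\mathbf{LM}(a^\alpha a^\beta)$, then $a^\beta\prec a^\gamma$ (thereby $1\prec a^\gamma$ for all $a^\gamma\neq1$). (Read $\mathbf{LM}(0)$ as $0\in K$.) A right monomial ordering is defined similarly, with multiplication by $a^\gamma$ (in (2)) and by $a^\alpha$ (in (3)) on the right instead of the left. A (two-sided) monomial ordering on $\mathcal{B}$ is one that is both a left and a right monomial ordering. Solvable polynomial algebra. $A=K[a_1,\ldots,a_n]$ is a solvable polynomial algebra if it has the PBW $K$-basis $\mathcal{B}$ and there is a (two-sided) monomial ordering $\prec$ on $\mathcal{B}$ such that for all $a^\alpha,a^\beta\in\mathcal{B}$: $a^\alpha a^\beta=\lambda_{\alpha,\beta}a^{\alpha+\beta}+f_{\alpha,\beta}$ with $\lambda_{\alpha,\beta}\in K^*$, $a^{\alpha+\beta}=a_1^{\alpha_1+\beta_1}\cdots a_n^{\alpha_n+\beta_n}$, and either $f_{\alpha,\beta}=0$ or $f_{\alpha,\beta}\in K\text{-span}\,\mathcal{B}$ with $\mathbf{LM}(f_{\alpha,\beta})\prec a^{\alpha+\beta}$. Free algebra. A monomial ordering $\prec'$ on $\mathbb{B}$ is a well-ordering such that for $W,U,V\in\mathbb{B}$,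 $U\prec'V$ implies $WU\prec'WV$ and $UW\prec'VW$; and moreover, for $W,U,V,S\in\mathbb{B}$ with $W\ne V$, $W=UVS$ implies $V\prec'W$. A Gröbner basis of a two-sided ideal $I$ of $K\langle X\rangle$ with respect to a monomial ordering on $\mathbb{B}$ is a subset $\mathcal{G}\subset I$ such that for every $0\neq f\in I$ there are $g\in\mathcal{G}$, $g\neq0$, and $U,V\in\mathbb{B}$ with $\mathbf{LM}(f)=U\,\mathbf{LM}(g)\,V$. It is reduced if every $g\in\mathcal{G}$ is nonzero with leading coefficient $1$ and no monomial of $\mathbb{B}$ occurring in $g$ with nonzero coefficient is divisible (as a word, i.e. contains as a subword) by $\mathbf{LM}(g')$ for any $g'\in\mathcal{G}$, $g'\neq g$. *)

theory Defs
  imports "HOL-Algebra.Algebra"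
begin

section \<open>Associative algebras\<close>

text \<open>The locale \<open>algebra\<close> of HOL-Algebra is commutative, so the associative unital
  (not necessarily commutative) algebras over a field are introduced here.\<close>

locale assoc_algebra = module K A + K?: field K + A?: ring A
  for K (structure) and A (structure) +
  assumes smult_mult_left:
      "\<lbrakk>c \<in> carrier K; x \<in> carrier A; y \<in> carrier A\<rbrakk>
        \<Longrightarrow> (c \<odot>\<^bsub>A\<^esub> x) \<otimes>\<^bsub>A\<^esub> y = c \<odot>\<^bsub>A\<^esub> (x \<otimes>\<^bsub>A\<^esub> y)"
    and smult_mult_right:
      "\<lbrakk>c \<in> carrier K; x \<in> carrier A; y \<in> carrier A\<rbrakk>
        \<Longrightarrow> x \<otimes>\<^bsub>A\<^esub> (c \<odot>\<^bsub>A\<^esub> y) = c \<odot>\<^bsub>A\<^esub> (x \<otimes>\<^bsub>A\<^esub> y)"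

inductive_set generated_subalgebra ::
    "('k, 'm) ring_scheme \<Rightarrow> ('k, 'a, 's) module_scheme \<Rightarrow> 'a set \<Rightarrow> 'a set"
  for K and A and S where
  one: "\<one>\<^bsub>A\<^esub> \<in> generated_subalgebra K A S"
| incl: "x \<in> S \<Longrightarrow> x \<in> generated_subalgebra K A S"
| add: "\<lbrakk>x \<in> generated_subalgebra K A S; y \<in> generated_subalgebra K A S\<rbrakk>
    \<Longrightarrow> x \<oplus>\<^bsub>A\<^esub> y \<in> generated_subalgebra K A S"
| smult: "\<lbrakk>c \<in> carrier K; x \<in> generated_subalgebra K A S\<rbrakk>
    \<Longrightarrow> c \<odot>\<^bsub>A\<^esub> x \<in> generated_subalgebra K A S"
| mult: "\<lbrakk>x \<in> generated_subalgebra K A S; y \<in> generated_subalgebra K A S\<rbrakk>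
    \<Longrightarrow> x \<otimes>\<^bsub>A\<^esub> y \<in> generated_subalgebra K A S"

definition algebra_hom ::
    "('k, 'm) ring_scheme \<Rightarrow> ('k, 'a, 's) module_scheme \<Rightarrow> ('k, 'b, 't) module_scheme
      \<Rightarrow> ('a \<Rightarrow> 'b) set" where
  "algebra_hom K A B =
    {h \<in> ring_hom A B. \<forall>c\<in>carrier K. \<forall>x\<in>carrier A. h (c \<odot>\<^bsub>A\<^esub> x) = c \<odot>\<^bsub>B\<^esub> h x}"

text \<open>The quotient ring \<open>A Quot I\<close>, with the scalar action \<open>c \<odot> (I + x) = I + c \<odot> x\<close>.\<close>

definition quotient_algebra ::
    "('k, 'a, 's) module_scheme \<Rightarrow> 'a set \<Rightarrow> ('k, 'a set) module" where
  "quotient_algebra A I =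
    \<lparr>carrier = carrier (A Quot I), monoid.mult = monoid.mult (A Quot I), one = \<one>\<^bsub>A Quot I\<^esub>,
     ring.zero = \<zero>\<^bsub>A Quot I\<^esub>, add = ring.add (A Quot I),
     smult = (\<lambda>c S. \<Union>x\<in>S. I +>\<^bsub>A\<^esub> (c \<odot>\<^bsub>A\<^esub> x))\<rparr>"


section \<open>Bases and leading monomials\<close>

definition lin_indep ::
    "('k, 'm) ring_scheme \<Rightarrow> ('k, 'a, 's) module_scheme \<Rightarrow> 'a set \<Rightarrow> bool" where
  "lin_indep K A B \<longleftrightarrow>
    (\<forall>S c. finite S \<and> S \<subseteq> B \<and> c \<in> S \<rightarrow> carrier K \<and> (\<Oplus>\<^bsub>A\<^esub>b\<in>S. c b \<odot>\<^bsub>A\<^esub> b) = \<zero>\<^bsub>A\<^esub>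
      \<longrightarrow> (\<forall>b\<in>S. c b = \<zero>\<^bsub>K\<^esub>))"

definition lin_span ::
    "('k, 'm) ring_scheme \<Rightarrow> ('k, 'a, 's) module_scheme \<Rightarrow> 'a set \<Rightarrow> 'a set" where
  "lin_span K A B =
    {(\<Oplus>\<^bsub>A\<^esub>b\<in>S. c b \<odot>\<^bsub>A\<^esub> b) | S c. finite S \<and> S \<subseteq> B \<and> c \<in> S \<rightarrow> carrier K}"

definition is_basis ::
    "('k, 'm) ring_scheme \<Rightarrow> ('k, 'a, 's) module_scheme \<Rightarrow> 'a set \<Rightarrow> bool" where
  "is_basis K A B \<longleftrightarrow> B \<subseteq> carrier A \<and> lin_indep K A B \<and> lin_span K A B = carrier A"

text \<open>In the following definitions \<open>B\<close> is meant to be a basis of \<open>A\<close> and \<open>r\<close> a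
  (reflexive) total order on \<open>B\<close>; \<open>basis_coeff K A B f b\<close> is the coefficient of \<open>b\<close> in
  the representation of \<open>f\<close> as a linear combination of \<open>B\<close>.\<close>

definition basis_coeff ::
    "('k, 'm) ring_scheme \<Rightarrow> ('k, 'a, 's) module_scheme \<Rightarrow> 'a set \<Rightarrow> 'a \<Rightarrow> 'a \<Rightarrow> 'k" where
  "basis_coeff K A B f =
    (THE c. (\<forall>b\<in>B. c b \<in> carrier K) \<and> (\<forall>b. b \<notin> B \<longrightarrow> c b = \<zero>\<^bsub>K\<^esub>) \<and>
      finite {b. c b \<noteq> \<zero>\<^bsub>K\<^esub>} \<and> f = (\<Oplus>\<^bsub>A\<^esub>b\<in>{b. c b \<noteq> \<zero>\<^bsub>K\<^esub>}. c b \<odot>\<^bsub>A\<^esub> b))"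

definition basis_supp ::
    "('k, 'm) ring_scheme \<Rightarrow> ('k, 'a, 's) module_scheme \<Rightarrow> 'a set \<Rightarrow> 'a \<Rightarrow> 'a set" where
  "basis_supp K A B f = {b \<in> B. basis_coeff K A B f b \<noteq> \<zero>\<^bsub>K\<^esub>}"

definition LM ::
    "('k, 'm) ring_scheme \<Rightarrow> ('k, 'a, 's) module_scheme \<Rightarrow> 'a set \<Rightarrow> 'a rel \<Rightarrow> 'a \<Rightarrow> 'a" where
  "LM K A B r f =
    (if f = \<zero>\<^bsub>A\<^esub> then \<zero>\<^bsub>A\<^esub>
     else (THE b. b \<in> basis_supp K A B f \<and> (\<forall>b'\<in>basis_supp K A B f. (b', b) \<in> r)))"

definition LC ::
    "('k, 'm) ring_scheme \<Rightarrow> ('k, 'a, 's) module_scheme \<Rightarrow> 'a set \<Rightarrow> 'a rel \<Rightarrow> 'a \<Rightarrow> 'k" where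
  "LC K A B r f = basis_coeff K A B f (LM K A B r f)"


section \<open>PBW bases and solvable polynomial algebras\<close>

text \<open>The exponent vectors in $\mathbb{N}^n$ are the functions on \<open>nat\<close> that vanish
  outside \<open>{1..n}\<close>.\<close>

definition exponents :: "nat \<Rightarrow> (nat \<Rightarrow> nat) set" where
  "exponents n = {\<alpha>. \<forall>i. i \<notin> {1..n} \<longrightarrow> \<alpha> i = 0}"

text \<open>\<open>ordered_monomial A n a \<alpha>\<close> is the product of the \<open>a i [^] \<alpha> i\<close> in the order
  \<open>i = 1, \<dots>, n\<close>.\<close>

definition ordered_monomial ::
    "('a, 's) ring_scheme \<Rightarrow> nat \<Rightarrow> (nat \<Rightarrow> 'a) \<Rightarrow> (nat \<Rightarrow> nat) \<Rightarrow> 'a" where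
  "ordered_monomial A n a \<alpha> =
    foldr (\<lambda>i x. (a i [^]\<^bsub>A\<^esub> \<alpha> i) \<otimes>\<^bsub>A\<^esub> x) [1..<Suc n] \<one>\<^bsub>A\<^esub>"

definition ordered_monomials ::
    "('a, 's) ring_scheme \<Rightarrow> nat \<Rightarrow> (nat \<Rightarrow> 'a) \<Rightarrow> 'a set" where
  "ordered_monomials A n a = ordered_monomial A n a ` exponents n"

definition has_pbw_basis ::
    "('k, 'm) ring_scheme \<Rightarrow> ('k, 'a, 's) module_scheme \<Rightarrow> nat \<Rightarrow> (nat \<Rightarrow> 'a) \<Rightarrow> bool" where
  "has_pbw_basis K A n a \<longleftrightarrow>
    inj_on (ordered_monomial A n a) (exponents n) \<and> is_basis K A (ordered_monomials A n a)"

definition scalars ::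
    "('k, 'm) ring_scheme \<Rightarrow> ('k, 'a, 's) module_scheme \<Rightarrow> 'a set" where
  "scalars K A = {c \<odot>\<^bsub>A\<^esub> \<one>\<^bsub>A\<^esub> | c. c \<in> carrier K}"

text \<open>Orders are reflexive relations, as in the library; \<open>r - Id\<close> is the strict part.\<close>

definition left_monomial_ordering ::
    "('k, 'm) ring_scheme \<Rightarrow> ('k, 'a, 's) module_scheme \<Rightarrow> 'a set \<Rightarrow> 'a rel \<Rightarrow> bool" where
  "left_monomial_ordering K A B r \<longleftrightarrow>
    well_order_on B r \<and>
    (\<forall>w\<in>B. \<forall>u\<in>B. \<forall>v\<in>B.
      (u, v) \<in> r - Id \<and>
      LM K A B r (w \<otimes>\<^bsub>A\<^esub> u) \<notin> scalars K A \<and> LM K A B r (w \<otimes>\<^bsub>A\<^esub> v) \<notin> scalars K A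
      \<longrightarrow> (LM K A B r (w \<otimes>\<^bsub>A\<^esub> u), LM K A B r (w \<otimes>\<^bsub>A\<^esub> v)) \<in> r - Id) \<and>
    (\<forall>w\<in>B. \<forall>u\<in>B. \<forall>v\<in>B.
      v \<noteq> w \<and> w = LM K A B r (u \<otimes>\<^bsub>A\<^esub> v) \<longrightarrow> (v, w) \<in> r - Id)"

definition right_monomial_ordering ::
    "('k, 'm) ring_scheme \<Rightarrow> ('k, 'a, 's) module_scheme \<Rightarrow> 'a set \<Rightarrow> 'a rel \<Rightarrow> bool" where
  "right_monomial_ordering K A B r \<longleftrightarrow>
    well_order_on B r \<and>
    (\<forall>w\<in>B. \<forall>u\<in>B. \<forall>v\<in>B.
      (u, v) \<in> r - Id \<and>
      LM K A B r (u \<otimes>\<^bsub>A\<^esub> w) \<notin> scalars K A \<and> LM K A B r (v \<otimes>\<^bsub>A\<^esub> w) \<notin> scalars K A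
      \<longrightarrow> (LM K A B r (u \<otimes>\<^bsub>A\<^esub> w), LM K A B r (v \<otimes>\<^bsub>A\<^esub> w)) \<in> r - Id) \<and>
    (\<forall>w\<in>B. \<forall>u\<in>B. \<forall>v\<in>B.
      v \<noteq> w \<and> w = LM K A B r (v \<otimes>\<^bsub>A\<^esub> u) \<longrightarrow> (v, w) \<in> r - Id)"

definition monomial_ordering ::
    "('k, 'm) ring_scheme \<Rightarrow> ('k, 'a, 's) module_scheme \<Rightarrow> 'a set \<Rightarrow> 'a rel \<Rightarrow> bool" where
  "monomial_ordering K A B r \<longleftrightarrow>
    left_monomial_ordering K A B r \<and> right_monomial_ordering K A B r"

definition solvable_polynomial_algebra ::
    "('k, 'm) ring_scheme \<Rightarrow> ('k, 'a, 's) module_scheme \<Rightarrow> nat \<Rightarrow> (nat \<Rightarrow> 'a) \<Rightarrow> bool" where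
  "solvable_polynomial_algebra K A n a \<longleftrightarrow>
    has_pbw_basis K A n a \<and>
    (\<exists>r. monomial_ordering K A (ordered_monomials A n a) r \<and>
      (\<forall>\<alpha>\<in>exponents n. \<forall>\<beta>\<in>exponents n.
        \<exists>c \<in> carrier K - {\<zero>\<^bsub>K\<^esub>}. \<exists>f \<in> carrier A.
          ordered_monomial A n a \<alpha> \<otimes>\<^bsub>A\<^esub> ordered_monomial A n a \<beta> =
            c \<odot>\<^bsub>A\<^esub> ordered_monomial A n a (\<lambda>i. \<alpha> i + \<beta> i) \<oplus>\<^bsub>A\<^esub> f \<and>
          (f = \<zero>\<^bsub>A\<^esub> \<or>
            (LM K A (ordered_monomials A n a) r f,
             ordered_monomial A n a (\<lambda>i. \<alpha> i + \<beta> i)) \<in> r - Id)))"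

text \<open>A finite linear combination of ordered monomials in \<open>x\<close>, given by its coefficient
  function \<open>m\<close> on exponent vectors.\<close>

definition coeff_functions :: "('k, 'm) ring_scheme \<Rightarrow> nat \<Rightarrow> ((nat \<Rightarrow> nat) \<Rightarrow> 'k) set" where
  "coeff_functions K n =
    {m \<in> exponents n \<rightarrow> carrier K. finite {\<alpha> \<in> exponents n. m \<alpha> \<noteq> \<zero>\<^bsub>K\<^esub>}}"

definition ordered_sum ::
    "('k, 'm) ring_scheme \<Rightarrow> ('k, 'a, 's) module_scheme \<Rightarrow> nat \<Rightarrow> (nat \<Rightarrow> 'a)
      \<Rightarrow> ((nat \<Rightarrow> nat) \<Rightarrow> 'k) \<Rightarrow> 'a" where
  "ordered_sum K A n x m =
    (\<Oplus>\<^bsub>A\<^esub>\<alpha>\<in>{\<alpha> \<in> exponents n. m \<alpha> \<noteq> \<zero>\<^bsub>K\<^esub>}. m \<alpha> \<odot>\<^bsub>A\<^esub> ordered_monomial A n x \<alpha>)"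


section \<open>The free algebra and its Groebner bases\<close>

text \<open>Elements of $K\langle X_1,\dots,X_n\rangle$ are the finitely supported functions from
  words over \<open>{1..n}\<close> to \<open>K\<close>; multiplication is convolution with respect to concatenation.\<close>

definition free_algebra :: "('k, 'm) ring_scheme \<Rightarrow> nat \<Rightarrow> ('k, nat list \<Rightarrow> 'k) module" where
  "free_algebra K n =
    \<lparr>carrier = {f. (\<forall>w. f w \<in> carrier K) \<and> finite {w. f w \<noteq> \<zero>\<^bsub>K\<^esub>} \<and>
        {w. f w \<noteq> \<zero>\<^bsub>K\<^esub>} \<subseteq> lists {1..n}},
     monoid.mult = (\<lambda>f g w. \<Oplus>\<^bsub>K\<^esub>k\<in>{0..length w}. f (take k w) \<otimes>\<^bsub>K\<^esub> g (drop k w)),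
     one = (\<lambda>w. if w = [] then \<one>\<^bsub>K\<^esub> else \<zero>\<^bsub>K\<^esub>),
     ring.zero = (\<lambda>w. \<zero>\<^bsub>K\<^esub>),
     add = (\<lambda>f g w. f w \<oplus>\<^bsub>K\<^esub> g w),
     smult = (\<lambda>c f w. c \<otimes>\<^bsub>K\<^esub> f w)\<rparr>"

definition word_monomial :: "('k, 'm) ring_scheme \<Rightarrow> nat list \<Rightarrow> nat list \<Rightarrow> 'k" where
  "word_monomial K w = (\<lambda>v. if v = w then \<one>\<^bsub>K\<^esub> else \<zero>\<^bsub>K\<^esub>)"

definition free_generator :: "('k, 'm) ring_scheme \<Rightarrow> nat \<Rightarrow> nat list \<Rightarrow> 'k" where
  "free_generator K i = word_monomial K [i]"

definition free_basis :: "('k, 'm) ring_scheme \<Rightarrow> nat \<Rightarrow> (nat list \<Rightarrow> 'k) set" where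
  "free_basis K n = word_monomial K ` lists {1..n}"

abbreviation free_LM ::
    "('k, 'm) ring_scheme \<Rightarrow> nat \<Rightarrow> (nat list \<Rightarrow> 'k) rel \<Rightarrow> (nat list \<Rightarrow> 'k) \<Rightarrow> nat list \<Rightarrow> 'k" where
  "free_LM K n r \<equiv> LM K (free_algebra K n) (free_basis K n) r"

definition free_monomial_ordering ::
    "('k, 'm) ring_scheme \<Rightarrow> nat \<Rightarrow> (nat list \<Rightarrow> 'k) rel \<Rightarrow> bool" where
  "free_monomial_ordering K n r \<longleftrightarrow>
    (let B = free_basis K n; F = free_algebra K n in
      well_order_on B r \<and>
      (\<forall>w\<in>B. \<forall>u\<in>B. \<forall>v\<in>B. (u, v) \<in> r - Id \<longrightarrow>
        (w \<otimes>\<^bsub>F\<^esub> u, w \<otimes>\<^bsub>F\<^esub> v) \<in> r - Id \<and> (u \<otimes>\<^bsub>F\<^esub> w, v \<otimes>\<^bsub>F\<^esub> w) \<in> r - Id) \<and>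
      (\<forall>w\<in>B. \<forall>u\<in>B. \<forall>v\<in>B. \<forall>s\<in>B.
        w \<noteq> v \<and> w = u \<otimes>\<^bsub>F\<^esub> v \<otimes>\<^bsub>F\<^esub> s \<longrightarrow> (v, w) \<in> r - Id))"

definition groebner_basis ::
    "('k, 'm) ring_scheme \<Rightarrow> nat \<Rightarrow> (nat list \<Rightarrow> 'k) rel \<Rightarrow> (nat list \<Rightarrow> 'k) set
      \<Rightarrow> (nat list \<Rightarrow> 'k) set \<Rightarrow> bool" where
  "groebner_basis K n r I G \<longleftrightarrow>
    (let B = free_basis K n; F = free_algebra K n in
      G \<subseteq> I \<and>
      (\<forall>f\<in>I. f \<noteq> \<zero>\<^bsub>F\<^esub> \<longrightarrow>
        (\<exists>g\<in>G. g \<noteq> \<zero>\<^bsub>F\<^esub> \<and>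
          (\<exists>u\<in>B. \<exists>v\<in>B. free_LM K n r f = u \<otimes>\<^bsub>F\<^esub> free_LM K n r g \<otimes>\<^bsub>F\<^esub> v))))"

definition reduced_groebner_basis ::
    "('k, 'm) ring_scheme \<Rightarrow> nat \<Rightarrow> (nat list \<Rightarrow> 'k) rel \<Rightarrow> (nat list \<Rightarrow> 'k) set
      \<Rightarrow> (nat list \<Rightarrow> 'k) set \<Rightarrow> bool" where
  "reduced_groebner_basis K n r I G \<longleftrightarrow>
    groebner_basis K n r I G \<and>
    (let B = free_basis K n; F = free_algebra K n in
      \<forall>g\<in>G. g \<noteq> \<zero>\<^bsub>F\<^esub> \<and> LC K F B r g = \<one>\<^bsub>K\<^esub> \<and>
        (\<forall>w\<in>basis_supp K F B g. \<forall>g'\<in>G. g' \<noteq> g \<longrightarrow>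
          \<not> (\<exists>u\<in>B. \<exists>v\<in>B. w = u \<otimes>\<^bsub>F\<^esub> free_LM K n r g' \<otimes>\<^bsub>F\<^esub> v)))"


section \<open>The two conditions on the presentation\<close>

text \<open>$g_{ji} = X_jX_i - \lambda_{ji}X_iX_j - F_{ji}$, where \<open>l j i\<close> is $\lambda_{ji}$ and
  \<open>m j i\<close> is the coefficient function of $F_{ji}$.\<close>

definition relator ::
    "('k, 'm) ring_scheme \<Rightarrow> nat \<Rightarrow> (nat \<Rightarrow> nat \<Rightarrow> 'k) \<Rightarrow> (nat \<Rightarrow> nat \<Rightarrow> (nat \<Rightarrow> nat) \<Rightarrow> 'k)
      \<Rightarrow> nat \<Rightarrow> nat \<Rightarrow> nat list \<Rightarrow> 'k" where
  "relator K n l m j i =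
    (let F = free_algebra K n; x = free_generator K in
      (x j \<otimes>\<^bsub>F\<^esub> x i \<ominus>\<^bsub>F\<^esub> l j i \<odot>\<^bsub>F\<^esub> (x i \<otimes>\<^bsub>F\<^esub> x j)) \<ominus>\<^bsub>F\<^esub> ordered_sum K F n x (m j i))"

definition condition_a ::
    "('k, 'm) ring_scheme \<Rightarrow> nat \<Rightarrow> (nat list \<Rightarrow> 'k) set \<Rightarrow> (nat list \<Rightarrow> 'k) rel
      \<Rightarrow> (nat \<Rightarrow> nat \<Rightarrow> 'k) \<Rightarrow> (nat \<Rightarrow> nat \<Rightarrow> (nat \<Rightarrow> nat) \<Rightarrow> 'k) \<Rightarrow> bool" where
  "condition_a K n I r l m \<longleftrightarrow>
    free_monomial_ordering K n r \<and>
    (\<forall>i j. 1 \<le> i \<and> i < j \<and> j \<le> n \<longrightarrow>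
      l j i \<in> carrier K - {\<zero>\<^bsub>K\<^esub>} \<and> m j i \<in> coeff_functions K n \<and>
      free_LM K n r (relator K n l m j i) =
        free_generator K j \<otimes>\<^bsub>free_algebra K n\<^esub> free_generator K i) \<and>
    (\<exists>G. finite G \<and> groebner_basis K n r I G) \<and>
    reduced_groebner_basis K n r I
      {relator K n l m j i | i j. 1 \<le> i \<and> i < j \<and> j \<le> n}"

definition coset_generator ::
    "('k, 'm) ring_scheme \<Rightarrow> nat \<Rightarrow> (nat list \<Rightarrow> 'k) set \<Rightarrow> nat \<Rightarrow> (nat list \<Rightarrow> 'k) set" where
  "coset_generator K n I i = I +>\<^bsub>free_algebra K n\<^esub> free_generator K i"

definition condition_b ::
    "('k, 'm) ring_scheme \<Rightarrow> nat \<Rightarrow> (nat list \<Rightarrow> 'k) set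
      \<Rightarrow> (nat \<Rightarrow> nat \<Rightarrow> (nat \<Rightarrow> nat) \<Rightarrow> 'k) \<Rightarrow> bool" where
  "condition_b K n I m \<longleftrightarrow>
    (let Q = quotient_algebra (free_algebra K n) I; x = coset_generator K n I;
         B = ordered_monomials Q n x in
      \<exists>r. monomial_ordering K Q B r \<and>
        (\<forall>i j. 1 \<le> i \<and> i < j \<and> j \<le> n \<and> ordered_sum K Q n x (m j i) \<noteq> \<zero>\<^bsub>Q\<^esub> \<longrightarrow>
          (LM K Q B r (ordered_sum K Q n x (m j i)), x i \<otimes>\<^bsub>Q\<^esub> x j) \<in> r - Id))"

end

theory Submission
  imports Defs "HOL-Library.Multiset"
begin

text \<open>Write \<open>ev w\<close> for the value in \<open>A\<close> of a word \<open>w\<close>; the ordered monomials are the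
  values of the sorted words. Given a solvable algebra, words are compared by their exponents
  first, in the given ordering, and then lexicographically. Every \<open>ev w\<close> has leading monomial
  \<open>ev (sort w)\<close>, and the sorted word is the least one in its exponent class, so that an element
  of \<open>I\<close> whose leading word is sorted would have a nonzero image in \<open>A\<close>. Hence the leading word
  of a nonzero element of \<open>I\<close> has a descent $X_jX_i$ with $i < j$, and the relators form a Groebner basis.

  Conversely, condition (a) makes the sorted words a basis modulo \<open>I\<close>. If \<open>x > y\<close> are letters and
  \<open>s\<close> is a sorted word with letters \<open>\<ge> y\<close>, straightening $a_x a_s$ inductively shows that
  $a_y a_x a_s$ has leading monomial \<open>ev (y # insort x s)\<close>; compatibility of the ordering with right
  multiplication by $a_s$ then gives $a_x a_y a_s$ the same leading monomial, because
  condition (b) says that $a_x a_y$ is led by $a_y a_x$. The clauses of a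
  monomial ordering that exclude scalar leading monomials cause no harm, since 1 is the least
  monomial.\<close>

section \<open>Coefficients with respect to a basis\<close>

text \<open>The exponents have to be compared by the given ordering because the correction term in a
  product of two generators may have arbitrarily large total degree; no degree ordering fixed in
  advance puts X_j X_i in front. Exponents alone cannot separate X_j X_i from X_i X_j, and the
  lexicographic tie-break does exactly that. The resulting relation respects concatenation because
  LM(a^\<alpha> a^\<beta>) = a^(\<alpha>+\<beta>), which turns the ordering of the PBW basis into a
  translation-invariant one on exponents. No overlaps of leading words are resolved anywhere: linear
  independence of the ordered monomials takes the place of the diamond lemma.

  The statements live in three algebras: (a) in the free algebra, (b) in its quotient, solvability
  in \<open>A\<close>. The arguments about leading monomials are carried out in \<open>A\<close>
  through \<open>ev\<close>. Coset arithmetic is confined to the construction of the isomorphism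
  \<open>\<phi>\<close>, along which bases, coefficients, leading monomials and orderings are then
  transported in both directions.\<close>

locale vector_space_basis = module K A + K?: field K
  for K :: "('k, 'm) ring_scheme" (structure) and A :: "('k, 'a, 's) module_scheme" (structure) +
  fixes B :: "'a set"
  assumes basis: "is_basis K A B"
begin

lemma basis_closed [simp]: "b \<in> B \<Longrightarrow> b \<in> carrier A"
  using basis by (auto simp: is_basis_def)

text \<open>Verbatim the predicate under the definite description in \<open>basis_coeff\<close>, so
  that exhibiting a representing function, together with uniqueness, computes coefficients
  (\<open>coeff_eqI\<close>).\<close>

definition represents :: "('a \<Rightarrow> 'k) \<Rightarrow> 'a \<Rightarrow> bool" where
  "represents c f \<longleftrightarrow> (\<forall>b\<in>B. c b \<in> carrier K) \<and> (\<forall>b. b \<notin> B \<longrightarrow> c b = \<zero>\<^bsub>K\<^esub>) \<and>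
      finite {b. c b \<noteq> \<zero>\<^bsub>K\<^esub>} \<and> f = (\<Oplus>\<^bsub>A\<^esub>b\<in>{b. c b \<noteq> \<zero>\<^bsub>K\<^esub>}. c b \<odot>\<^bsub>A\<^esub> b)"

lemma representsD:
  assumes "represents c f"
  shows "c b \<in> carrier K" "b \<notin> B \<Longrightarrow> c b = \<zero>\<^bsub>K\<^esub>" "finite {b. c b \<noteq> \<zero>\<^bsub>K\<^esub>}"
    "{b. c b \<noteq> \<zero>\<^bsub>K\<^esub>} \<subseteq> B"
  using assms R.zero_closed unfolding represents_def by (cases "b \<in> B"; auto)+

text \<open>Two elements have different supports in general; only sums over a common finite index
  set can be added termwise.\<close>

lemma represents_superset:
  assumes "represents c f" "finite T" "{b. c b \<noteq> \<zero>\<^bsub>K\<^esub>} \<subseteq> T" "T \<subseteq> B"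
  shows "f = (\<Oplus>\<^bsub>A\<^esub>b\<in>T. c b \<odot>\<^bsub>A\<^esub> b)"
proof -
  have "f = (\<Oplus>\<^bsub>A\<^esub>b\<in>{b. c b \<noteq> \<zero>\<^bsub>K\<^esub>}. c b \<odot>\<^bsub>A\<^esub> b)"
    using assms(1) by (simp add: represents_def)
  also have "\<dots> = (\<Oplus>\<^bsub>A\<^esub>b\<in>T. c b \<odot>\<^bsub>A\<^esub> b)"
    using assms(2-4) representsD[OF assms(1)]
    by (intro M.add.finprod_mono_neutral_cong_left) auto
  finally show ?thesis .
qed

lemma representsI:
  assumes "finite T" "T \<subseteq> B" "\<And>b. b \<in> T \<Longrightarrow> c b \<in> carrier K" "\<And>b. b \<notin> T \<Longrightarrow> c b = \<zero>\<^bsub>K\<^esub>"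
    "f = (\<Oplus>\<^bsub>A\<^esub>b\<in>T. c b \<odot>\<^bsub>A\<^esub> b)"
  shows "represents c f"
proof -
  have sub: "{b. c b \<noteq> \<zero>\<^bsub>K\<^esub>} \<subseteq> T" using assms(4) by blast
  have "(\<Oplus>\<^bsub>A\<^esub>b\<in>{b. c b \<noteq> \<zero>\<^bsub>K\<^esub>}. c b \<odot>\<^bsub>A\<^esub> b) = (\<Oplus>\<^bsub>A\<^esub>b\<in>T. c b \<odot>\<^bsub>A\<^esub> b)"
    using assms sub by (intro M.add.finprod_mono_neutral_cong_left) auto
  moreover have "c b \<in> carrier K" for b
    using assms(3,4) by (cases "b \<in> T") auto
  ultimately show ?thesis
    unfolding represents_def using assms finite_subset[OF sub] by auto
qed

lemma represents_add:
  assumes "represents c f" "represents d g"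
  shows "represents (\<lambda>b. c b \<oplus>\<^bsub>K\<^esub> d b) (f \<oplus>\<^bsub>A\<^esub> g)"
proof -
  let ?T = "{b. c b \<noteq> \<zero>\<^bsub>K\<^esub>} \<union> {b. d b \<noteq> \<zero>\<^bsub>K\<^esub>}"
  note c = representsD[OF assms(1)] and d = representsD[OF assms(2)]
  have T: "finite ?T" "?T \<subseteq> B" using c d by auto
  have "f \<oplus>\<^bsub>A\<^esub> g = (\<Oplus>\<^bsub>A\<^esub>b\<in>?T. c b \<odot>\<^bsub>A\<^esub> b) \<oplus>\<^bsub>A\<^esub> (\<Oplus>\<^bsub>A\<^esub>b\<in>?T. d b \<odot>\<^bsub>A\<^esub> b)"
    using represents_superset[OF assms(1) T(1) _ T(2)] represents_superset[OF assms(2) T(1) _ T(2)]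
    by simp
  also have "\<dots> = (\<Oplus>\<^bsub>A\<^esub>b\<in>?T. c b \<odot>\<^bsub>A\<^esub> b \<oplus>\<^bsub>A\<^esub> d b \<odot>\<^bsub>A\<^esub> b)"
    using c(1) d(1) T by (intro M.finsum_addf[symmetric]) auto
  also have "\<dots> = (\<Oplus>\<^bsub>A\<^esub>b\<in>?T. (c b \<oplus>\<^bsub>K\<^esub> d b) \<odot>\<^bsub>A\<^esub> b)"
    using c(1) d(1) T by (intro M.finsum_cong') (auto simp: smult_l_distr[symmetric] subset_iff)
  finally show ?thesis
    using T c(1) d(1) by (intro representsI[of ?T]) auto
qed

lemma represents_smult:
  assumes "represents d f" "c \<in> carrier K"
  shows "represents (\<lambda>b. c \<otimes>\<^bsub>K\<^esub> d b) (c \<odot>\<^bsub>A\<^esub> f)"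
proof -
  let ?T = "{b. d b \<noteq> \<zero>\<^bsub>K\<^esub>}"
  note d = representsD[OF assms(1)]
  have f: "f = (\<Oplus>\<^bsub>A\<^esub>b\<in>?T. d b \<odot>\<^bsub>A\<^esub> b)"
    using assms(1) by (simp add: represents_def)
  have "c \<odot>\<^bsub>A\<^esub> f = (\<Oplus>\<^bsub>A\<^esub>b\<in>?T. c \<odot>\<^bsub>A\<^esub> (d b \<odot>\<^bsub>A\<^esub> b))"
    unfolding f using d assms(2) by (intro finsum_smult_ldistr) auto
  also have "\<dots> = (\<Oplus>\<^bsub>A\<^esub>b\<in>?T. (c \<otimes>\<^bsub>K\<^esub> d b) \<odot>\<^bsub>A\<^esub> b)"
    using d assms(2) by (intro M.finsum_cong') (auto simp: smult_assoc1 subset_iff)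
  finally show ?thesis
    using d assms(2) by (intro representsI[of ?T]) auto
qed

lemma represents_basis:
  assumes "b \<in> B" shows "represents (\<lambda>x. if x = b then \<one>\<^bsub>K\<^esub> else \<zero>\<^bsub>K\<^esub>) b"
  using assms by (intro representsI[of "{b}"]) auto

lemma represents_zero_unique:
  assumes "represents c \<zero>\<^bsub>A\<^esub>" shows "c b = \<zero>\<^bsub>K\<^esub>"
proof (rule ccontr)
  assume "c b \<noteq> \<zero>\<^bsub>K\<^esub>"
  moreover have "lin_indep K A B" using basis by (simp add: is_basis_def)
  moreover have "(\<Oplus>\<^bsub>A\<^esub>b\<in>{b. c b \<noteq> \<zero>\<^bsub>K\<^esub>}. c b \<odot>\<^bsub>A\<^esub> b) = \<zero>\<^bsub>A\<^esub>"
    using assms by (simp add: represents_def)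
  ultimately show False
    using representsD[OF assms] unfolding lin_indep_def
    by (metis (mono_tags, lifting) Pi_I mem_Collect_eq)
qed

lemma represents_closed: "represents c f \<Longrightarrow> f \<in> carrier A"
proof -
  assume c: "represents c f"
  then have "(\<lambda>b. c b \<odot>\<^bsub>A\<^esub> b) \<in> {b. c b \<noteq> \<zero>\<^bsub>K\<^esub>} \<rightarrow> carrier A"
    using representsD(1,4)[OF c] by (auto simp: subset_iff)
  with c show ?thesis by (simp add: represents_def)
qed

text \<open>By linearity the difference of \<open>c\<close> and \<open>d\<close> represents zero,
  where linear independence applies. Subtraction is written as addition of a (-1)-multiple, which
  the closure lemmas cover.\<close>

lemma represents_unique:
  assumes "represents c f" "represents d f" shows "c = d"
proof
  fix b
  have "represents (\<lambda>b. c b \<oplus>\<^bsub>K\<^esub> \<ominus>\<^bsub>K\<^esub> \<one>\<^bsub>K\<^esub> \<otimes>\<^bsub>K\<^esub> d b) (f \<oplus>\<^bsub>A\<^esub> (\<ominus>\<^bsub>K\<^esub> \<one>\<^bsub>K\<^esub>) \<odot>\<^bsub>A\<^esub> f)"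
    using assms by (intro represents_add represents_smult) auto
  moreover have "f \<oplus>\<^bsub>A\<^esub> (\<ominus>\<^bsub>K\<^esub> \<one>\<^bsub>K\<^esub>) \<odot>\<^bsub>A\<^esub> f = \<zero>\<^bsub>A\<^esub>"
    using represents_closed[OF assms(1)] by (simp add: smult_l_minus M.r_neg)
  ultimately have "c b \<oplus>\<^bsub>K\<^esub> \<ominus>\<^bsub>K\<^esub> \<one>\<^bsub>K\<^esub> \<otimes>\<^bsub>K\<^esub> d b = \<zero>\<^bsub>K\<^esub>"
    using represents_zero_unique by metis
  then show "c b = d b"
    using representsD(1)[OF assms(1), of b] representsD(1)[OF assms(2), of b]
    by (simp add: R.l_minus R.minus_eq[symmetric])
qed

lemma represents_exists:
  assumes "f \<in> carrier A" obtains c where "represents c f"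
proof -
  have "f \<in> lin_span K A B" using basis assms by (simp add: is_basis_def)
  then obtain S c where S: "finite S" "S \<subseteq> B" "c \<in> S \<rightarrow> carrier K"
    and f: "f = (\<Oplus>\<^bsub>A\<^esub>b\<in>S. c b \<odot>\<^bsub>A\<^esub> b)"
    unfolding lin_span_def by blast
  \<comment> \<open>\<open>lin_span\<close> says nothing about \<open>c\<close> off
    \<open>S\<close>, while \<open>represents\<close> demands zero off \<open>B\<close>; hence the
    cut-off.\<close>
  have "f = (\<Oplus>\<^bsub>A\<^esub>b\<in>S. (if b \<in> S then c b else \<zero>\<^bsub>K\<^esub>) \<odot>\<^bsub>A\<^esub> b)"
    unfolding f using S by (intro M.finsum_cong') (auto simp: Pi_def subset_iff)
  then have "represents (\<lambda>b. if b \<in> S then c b else \<zero>\<^bsub>K\<^esub>) f"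
    using S by (intro representsI[of S]) auto
  then show thesis by (rule that)
qed

abbreviation "coef \<equiv> basis_coeff K A B"

lemma coeff_eqI: "represents c f \<Longrightarrow> coef f = c"
  unfolding basis_coeff_def represents_def[symmetric]
  using represents_unique by blast

lemma represents_coeff: "f \<in> carrier A \<Longrightarrow> represents (coef f) f"
  using represents_exists coeff_eqI by metis

lemma coeff_closed [simp]: "f \<in> carrier A \<Longrightarrow> coef f b \<in> carrier K"
  and coeff_outside: "f \<in> carrier A \<Longrightarrow> b \<notin> B \<Longrightarrow> coef f b = \<zero>\<^bsub>K\<^esub>"
  and coeff_finite: "f \<in> carrier A \<Longrightarrow> finite {b. coef f b \<noteq> \<zero>\<^bsub>K\<^esub>}"
  using representsD[OF represents_coeff] by auto

lemma coeff_sum: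
  "f \<in> carrier A \<Longrightarrow> f = (\<Oplus>\<^bsub>A\<^esub>b\<in>{b. coef f b \<noteq> \<zero>\<^bsub>K\<^esub>}. coef f b \<odot>\<^bsub>A\<^esub> b)"
  using represents_coeff by (simp add: represents_def)

lemma coeff_add:
  "f \<in> carrier A \<Longrightarrow> g \<in> carrier A \<Longrightarrow> coef (f \<oplus>\<^bsub>A\<^esub> g) b = coef f b \<oplus>\<^bsub>K\<^esub> coef g b"
  using coeff_eqI[OF represents_add[OF represents_coeff represents_coeff]] by simp

lemma coeff_smult:
  "c \<in> carrier K \<Longrightarrow> f \<in> carrier A \<Longrightarrow> coef (c \<odot>\<^bsub>A\<^esub> f) b = c \<otimes>\<^bsub>K\<^esub> coef f b"
  using coeff_eqI[OF represents_smult[OF represents_coeff]] by simp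

lemma coeff_basis: "b \<in> B \<Longrightarrow> coef b x = (if x = b then \<one>\<^bsub>K\<^esub> else \<zero>\<^bsub>K\<^esub>)"
  using coeff_eqI[OF represents_basis] by simp

lemma coeff_zero [simp]: "coef \<zero>\<^bsub>A\<^esub> b = \<zero>\<^bsub>K\<^esub>"
  using represents_zero_unique represents_coeff by blast

lemma coeff_nonzero:
  assumes "f \<in> carrier A" "f \<noteq> \<zero>\<^bsub>A\<^esub>" obtains b where "b \<in> B" "coef f b \<noteq> \<zero>\<^bsub>K\<^esub>"
proof -
  have "{b. coef f b \<noteq> \<zero>\<^bsub>K\<^esub>} \<noteq> {}"
    using coeff_sum[OF assms(1)] assms(2) by (metis M.finsum_empty)
  then show thesis using that coeff_outside[OF assms(1)] by blast
qed

lemma basis_nonzero: "b \<in> B \<Longrightarrow> b \<noteq> \<zero>\<^bsub>A\<^esub>"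
  by (metis coeff_basis coeff_zero one_not_zero)

lemma supp_eq: "f \<in> carrier A \<Longrightarrow> basis_supp K A B f = {b. coef f b \<noteq> \<zero>\<^bsub>K\<^esub>}"
  using coeff_outside by (auto simp: basis_supp_def)

text \<open>\<open>f\<close> is the sum over its support, so an additive set swallows it once it
  contains the multiples of the basis elements occurring in it. Linear statements are proved below
  by taking \<open>N\<close> to be the set of elements satisfying them.\<close>

lemma supp_induct:
  assumes "f \<in> carrier A" "N \<subseteq> carrier A" "\<zero>\<^bsub>A\<^esub> \<in> N" "\<And>x y. x \<in> N \<Longrightarrow> y \<in> N \<Longrightarrow> x \<oplus>\<^bsub>A\<^esub> y \<in> N"
    "\<And>c b. c \<in> carrier K \<Longrightarrow> b \<in> B \<Longrightarrow> coef f b \<noteq> \<zero>\<^bsub>K\<^esub> \<Longrightarrow> c \<odot>\<^bsub>A\<^esub> b \<in> N"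
  shows "f \<in> N"
proof -
  have "(\<Oplus>\<^bsub>A\<^esub>b\<in>T. coef f b \<odot>\<^bsub>A\<^esub> b) \<in> N" if "finite T" "T \<subseteq> {b. coef f b \<noteq> \<zero>\<^bsub>K\<^esub>}" for T
    using that
  proof (induction T rule: finite_induct)
    case (insert b T)
    then have "b \<in> B" "T \<subseteq> B" using coeff_outside[OF assms(1)] by auto
    then show ?case using insert assms by (subst M.finsum_insert) auto
  qed (simp add: assms)
  then show ?thesis using coeff_sum[OF assms(1)] coeff_finite[OF assms(1)] by force
qed

end

section \<open>Linear orders on a basis and the subspaces below a monomial\<close>

locale ordered_basis = vector_space_basis K A B
  for K :: "('k, 'm) ring_scheme" (structure) and A :: "('k, 'a, 's) module_scheme" (structure)
    and B :: "'a set" +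
  fixes r :: "'a rel"
  assumes order: "linear_order_on B r"
begin

lemma order_trans: "(x, y) \<in> r \<Longrightarrow> (y, z) \<in> r \<Longrightarrow> (x, z) \<in> r"
  and order_antisym: "(x, y) \<in> r \<Longrightarrow> (y, x) \<in> r \<Longrightarrow> x = y"
  and order_total: "x \<in> B \<Longrightarrow> y \<in> B \<Longrightarrow> (x, y) \<in> r \<or> (y, x) \<in> r"
  and order_field: "(x, y) \<in> r \<Longrightarrow> x \<in> B \<and> y \<in> B"
  and order_refl: "x \<in> B \<Longrightarrow> (x, x) \<in> r"
proof -
  have *: "trans r" "antisym r" "r \<subseteq> B \<times> B" "refl_on B r" "total_on B r"
    using order
    by (auto simp: linear_order_on_def partial_order_on_def preorder_on_def)
  show "(x, y) \<in> r \<Longrightarrow> (y, z) \<in> r \<Longrightarrow> (x, z) \<in> r" using *(1) by (rule transD)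
  show "(x, y) \<in> r \<Longrightarrow> (y, x) \<in> r \<Longrightarrow> x = y" using *(2) by (rule antisymD)
  show "(x, y) \<in> r \<Longrightarrow> x \<in> B \<and> y \<in> B" using *(3) by blast
  show refl: "x \<in> B \<Longrightarrow> (x, x) \<in> r" for x using *(4) by (simp add: refl_on_def)
  show "x \<in> B \<Longrightarrow> y \<in> B \<Longrightarrow> (x, y) \<in> r \<or> (y, x) \<in> r"
    using *(5) refl by (cases "x = y") (auto simp: total_on_def)
qed

abbreviation "LMA \<equiv> LM K A B r"

lemma strict_trans: "(x, y) \<in> r - Id \<Longrightarrow> (y, z) \<in> r - Id \<Longrightarrow> (x, z) \<in> r - Id"
  using order_trans order_antisym by blast

lemma LM_eqI:
  assumes "f \<in> carrier A" "coef f b \<noteq> \<zero>\<^bsub>K\<^esub>" "\<And>x. coef f x \<noteq> \<zero>\<^bsub>K\<^esub> \<Longrightarrow> (x, b) \<in> r"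
  shows "LMA f = b"
proof -
  have "f \<noteq> \<zero>\<^bsub>A\<^esub>" using assms(2) coeff_zero by blast
  then show ?thesis
    unfolding LM_def supp_eq[OF assms(1)] using assms order_antisym
    by (auto intro!: the_equality)
qed

lemma LM_zero [simp]: "LMA \<zero>\<^bsub>A\<^esub> = \<zero>\<^bsub>A\<^esub>"
  by (simp add: LM_def)

lemma finite_max:
  assumes "finite T" "T \<noteq> {}" "T \<subseteq> B" shows "\<exists>b\<in>T. \<forall>x\<in>T. (x, b) \<in> r"
  using assms
proof (induction T rule: finite_ne_induct)
  case (singleton x) then show ?case using order_refl by auto
next
  case (insert x T)
  then obtain b where "b \<in> T" "\<forall>x\<in>T. (x, b) \<in> r" by auto
  then show ?case
    using order_total[of x b] order_trans[of _ b x] order_refl[of x] insert.prems by blast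
qed

lemma LM_props:
  assumes "f \<in> carrier A" "f \<noteq> \<zero>\<^bsub>A\<^esub>"
  shows "coef f (LMA f) \<noteq> \<zero>\<^bsub>K\<^esub>" "coef f x \<noteq> \<zero>\<^bsub>K\<^esub> \<Longrightarrow> (x, LMA f) \<in> r" "LMA f \<in> B"
proof -
  have "{b. coef f b \<noteq> \<zero>\<^bsub>K\<^esub>} \<noteq> {}" "{b. coef f b \<noteq> \<zero>\<^bsub>K\<^esub>} \<subseteq> B"
    using coeff_nonzero[OF assms] coeff_outside[OF assms(1)] by blast+
  then obtain b where b: "coef f b \<noteq> \<zero>\<^bsub>K\<^esub>" "\<And>x. coef f x \<noteq> \<zero>\<^bsub>K\<^esub> \<Longrightarrow> (x, b) \<in> r"
    using finite_max[OF coeff_finite[OF assms(1)]] by blast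
  then have "LMA f = b" using assms(1) by (intro LM_eqI)
  then show "coef f (LMA f) \<noteq> \<zero>\<^bsub>K\<^esub>" "coef f x \<noteq> \<zero>\<^bsub>K\<^esub> \<Longrightarrow> (x, LMA f) \<in> r" "LMA f \<in> B"
    using b coeff_outside[OF assms(1)] by auto
qed

text \<open>Zero belongs to every \<open>below b\<close>; this makes it a subspace and absorbs the
  separate case of a vanishing correction term.\<close>

definition below :: "'a \<Rightarrow> 'a set" where
  "below b = {f \<in> carrier A. \<forall>x. coef f x \<noteq> \<zero>\<^bsub>K\<^esub> \<longrightarrow> (x, b) \<in> r - Id}"

lemma below_carrier: "f \<in> below b \<Longrightarrow> f \<in> carrier A"
  by (simp add: below_def)

lemma below_zero: "\<zero>\<^bsub>A\<^esub> \<in> below b"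
  by (simp add: below_def)

lemma below_add: "f \<in> below b \<Longrightarrow> g \<in> below b \<Longrightarrow> f \<oplus>\<^bsub>A\<^esub> g \<in> below b"
proof -
  assume *: "f \<in> below b" "g \<in> below b"
  then have c: "f \<in> carrier A" "g \<in> carrier A" by (auto simp: below_def)
  have "coef f x \<noteq> \<zero>\<^bsub>K\<^esub> \<or> coef g x \<noteq> \<zero>\<^bsub>K\<^esub>" if "coef (f \<oplus>\<^bsub>A\<^esub> g) x \<noteq> \<zero>\<^bsub>K\<^esub>" for x
    using that by (auto simp: coeff_add[OF c])
  then show ?thesis using * c by (force simp: below_def)
qed

lemma below_smult: "c \<in> carrier K \<Longrightarrow> f \<in> below b \<Longrightarrow> c \<odot>\<^bsub>A\<^esub> f \<in> below b"
proof -
  assume *: "c \<in> carrier K" "f \<in> below b"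
  then have c: "f \<in> carrier A" by (auto simp: below_def)
  have "coef f x \<noteq> \<zero>\<^bsub>K\<^esub>" if "coef (c \<odot>\<^bsub>A\<^esub> f) x \<noteq> \<zero>\<^bsub>K\<^esub>" for x
    using that * by (auto simp: coeff_smult[OF *(1) c])
  then show ?thesis using * c by (force simp: below_def)
qed

lemma below_mono: "f \<in> below b \<Longrightarrow> (b, b') \<in> r \<Longrightarrow> f \<in> below b'"
  unfolding below_def using order_trans order_antisym by blast

lemma below_basis: "(x, b) \<in> r - Id \<Longrightarrow> x \<in> below b"
  using order_field by (auto simp: below_def coeff_basis split: if_splits)

lemma below_iff: "f \<in> below b \<longleftrightarrow> f \<in> carrier A \<and> (f = \<zero>\<^bsub>A\<^esub> \<or> (LMA f, b) \<in> r - Id)"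
proof -
  have "(LMA f, b) \<in> r - Id" if "f \<in> below b" "f \<noteq> \<zero>\<^bsub>A\<^esub>"
    using that LM_props(1) by (auto simp: below_def)
  moreover have "f \<in> below b" if "f \<in> carrier A" "(LMA f, b) \<in> r - Id" "f \<noteq> \<zero>\<^bsub>A\<^esub>"
    using that LM_props(2)[OF that(1,3)] order_trans order_antisym by (auto simp: below_def)
  ultimately show ?thesis using below_zero below_carrier by blast
qed

text \<open>All monomials of \<open>g\<close> are strictly smaller than \<open>b\<close>, so the
  coefficient of \<open>b\<close> in the sum is exactly \<open>c\<close>.\<close>

lemma LM_leading:
  assumes "b \<in> B" "c \<in> carrier K" "c \<noteq> \<zero>\<^bsub>K\<^esub>" "g \<in> below b"
  shows "LMA (c \<odot>\<^bsub>A\<^esub> b \<oplus>\<^bsub>A\<^esub> g) = b"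
proof (rule LM_eqI)
  have g: "g \<in> carrier A" "coef g b = \<zero>\<^bsub>K\<^esub>" using assms(4) by (auto simp: below_def)
  show "c \<odot>\<^bsub>A\<^esub> b \<oplus>\<^bsub>A\<^esub> g \<in> carrier A" using assms g by simp
  show "coef (c \<odot>\<^bsub>A\<^esub> b \<oplus>\<^bsub>A\<^esub> g) b \<noteq> \<zero>\<^bsub>K\<^esub>" using assms g by (simp add: coeff_add coeff_smult coeff_basis)
  fix x assume "coef (c \<odot>\<^bsub>A\<^esub> b \<oplus>\<^bsub>A\<^esub> g) x \<noteq> \<zero>\<^bsub>K\<^esub>"
  then have "x = b \<or> coef g x \<noteq> \<zero>\<^bsub>K\<^esub>" using assms g by (auto simp: coeff_add coeff_smult coeff_basis)
  then show "(x, b) \<in> r" using assms(1,4) order_refl by (auto simp: below_def)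
qed

lemma LM_decompose:
  assumes "f \<in> carrier A" "f \<noteq> \<zero>\<^bsub>A\<^esub>"
  obtains c g where "c \<in> carrier K" "c \<noteq> \<zero>\<^bsub>K\<^esub>" "g \<in> below (LMA f)" "f = c \<odot>\<^bsub>A\<^esub> LMA f \<oplus>\<^bsub>A\<^esub> g"
proof -
  let ?b = "LMA f" let ?c = "coef f ?b"
  let ?g = "f \<ominus>\<^bsub>A\<^esub> ?c \<odot>\<^bsub>A\<^esub> ?b"
  note p = LM_props[OF assms]
  have g: "?g = f \<oplus>\<^bsub>A\<^esub> (\<ominus>\<^bsub>K\<^esub> ?c) \<odot>\<^bsub>A\<^esub> ?b"
    using assms p by (simp add: smult_l_minus M.minus_eq)
  have "coef ?g x = (if x = ?b then \<zero>\<^bsub>K\<^esub> else coef f x)" for x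
    unfolding g using assms p by (auto simp: coeff_add coeff_smult coeff_basis R.r_neg)
  then have "?g \<in> below ?b"
    using p assms by (auto simp: below_def split: if_splits)
  moreover have "f = ?c \<odot>\<^bsub>A\<^esub> ?b \<oplus>\<^bsub>A\<^esub> ?g"
    using assms p by (simp add: M.minus_eq M.a_ac M.r_neg2 M.r_neg)
  ultimately show thesis using that p(1) assms(1) coeff_closed by blast
qed

lemma below_induct:
  assumes "f \<in> below b" "N \<subseteq> carrier A" "\<zero>\<^bsub>A\<^esub> \<in> N" "\<And>x y. x \<in> N \<Longrightarrow> y \<in> N \<Longrightarrow> x \<oplus>\<^bsub>A\<^esub> y \<in> N"
    "\<And>c x. c \<in> carrier K \<Longrightarrow> (x, b) \<in> r - Id \<Longrightarrow> c \<odot>\<^bsub>A\<^esub> x \<in> N"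
  shows "f \<in> N"
  using assms by (intro supp_induct[of f N]) (auto simp: below_def)

end

section \<open>The free algebra\<close>

locale free_algebra_field = K?: field K for K :: "('k, 'm) ring_scheme" (structure) +
  fixes n :: nat
begin

abbreviation "F \<equiv> free_algebra K n"
abbreviation "XW \<equiv> word_monomial K"

text \<open>The product of \<open>free_algebra\<close> as a bare function. Its identities need only
  values in \<open>K\<close>; finite support and the alphabet are dealt with separately in
  \<open>free_mult_closed\<close>.\<close>

definition convolution :: "(nat list \<Rightarrow> 'k) \<Rightarrow> (nat list \<Rightarrow> 'k) \<Rightarrow> nat list \<Rightarrow> 'k" where
  "convolution f g w = (\<Oplus>\<^bsub>K\<^esub>k\<in>{0..length w}. f (take k w) \<otimes>\<^bsub>K\<^esub> g (drop k w))"

lemma free_carrier_iff: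
  "f \<in> carrier F \<longleftrightarrow> (\<forall>w. f w \<in> carrier K) \<and> finite {w. f w \<noteq> \<zero>\<^bsub>K\<^esub>} \<and>
    (\<forall>w. f w \<noteq> \<zero>\<^bsub>K\<^esub> \<longrightarrow> w \<in> lists {1..n})"
  by (auto simp: free_algebra_def)

lemma free_selectors:
  "f \<otimes>\<^bsub>F\<^esub> g = convolution f g" "\<one>\<^bsub>F\<^esub> = XW []" "\<zero>\<^bsub>F\<^esub> = (\<lambda>w. \<zero>\<^bsub>K\<^esub>)"
  "f \<oplus>\<^bsub>F\<^esub> g = (\<lambda>w. f w \<oplus>\<^bsub>K\<^esub> g w)" "c \<odot>\<^bsub>F\<^esub> f = (\<lambda>w. c \<otimes>\<^bsub>K\<^esub> f w)"
  by (auto simp: free_algebra_def word_monomial_def convolution_def fun_eq_iff)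

lemma convolution_Nil [simp]:
  assumes "\<And>w. f w \<in> carrier K" "\<And>w. g w \<in> carrier K"
  shows "convolution f g [] = f [] \<otimes>\<^bsub>K\<^esub> g []"
  using assms by (simp add: convolution_def)

text \<open>The summand with empty left factor is split off and the others are reindexed by
  \<open>Suc\<close>. The recursive call has the left derivative
  \<open>\<lambda>v. f (x # v)\<close> in place of \<open>f\<close>, hence the generalisation over
  \<open>f\<close> in the inductions for linearity and associativity.\<close>

lemma convolution_Cons [simp]:
  assumes "\<And>w. f w \<in> carrier K" "\<And>w. g w \<in> carrier K"
  shows "convolution f g (x # w) =
    f [] \<otimes>\<^bsub>K\<^esub> g (x # w) \<oplus>\<^bsub>K\<^esub> convolution (\<lambda>v. f (x # v)) g w"
proof -
  have set: "{0..length (x # w)} = insert 0 (Suc ` {0..length w})"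
    by (auto simp: atLeast0AtMost atMost_Suc_eq_insert_0)
  moreover have "(\<Oplus>\<^bsub>K\<^esub>k\<in>Suc ` {0..length w}. f (take k (x # w)) \<otimes>\<^bsub>K\<^esub> g (drop k (x # w)))
      = convolution (\<lambda>v. f (x # v)) g w"
    unfolding convolution_def using assms by (subst K.add.finprod_reindex) auto
  ultimately show ?thesis
    unfolding convolution_def[of f] using assms by (subst set, subst K.finsum_insert) auto
qed

lemma convolution_closed [simp]:
  assumes "\<And>w. f w \<in> carrier K" "\<And>w. g w \<in> carrier K"
  shows "convolution f g w \<in> carrier K"
  using assms by (simp add: convolution_def K.finsum_closed Pi_def)

lemma convolution_add_left:
  assumes "\<And>w. f w \<in> carrier K" "\<And>w. f' w \<in> carrier K" "\<And>w. g w \<in> carrier K"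
  shows "convolution (\<lambda>v. f v \<oplus>\<^bsub>K\<^esub> f' v) g w = convolution f g w \<oplus>\<^bsub>K\<^esub> convolution f' g w"
  using assms
proof (induction w arbitrary: f f')
  case Nil then show ?case by (simp add: K.l_distr)
next
  case (Cons x w) then show ?case by (simp add: K.l_distr K.a_ac)
qed

lemma convolution_add_right:
  assumes "\<And>w. f w \<in> carrier K" "\<And>w. g' w \<in> carrier K" "\<And>w. g w \<in> carrier K"
  shows "convolution f (\<lambda>v. g v \<oplus>\<^bsub>K\<^esub> g' v) w = convolution f g w \<oplus>\<^bsub>K\<^esub> convolution f g' w"
  using assms
proof (induction w arbitrary: f)
  case Nil then show ?case by (simp add: K.r_distr)
next
  case (Cons x w) then show ?case by (simp add: K.r_distr K.a_ac)
qed

lemma convolution_scale_left: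
  assumes "c \<in> carrier K" "\<And>w. f w \<in> carrier K" "\<And>w. g w \<in> carrier K"
  shows "convolution (\<lambda>v. c \<otimes>\<^bsub>K\<^esub> f v) g w = c \<otimes>\<^bsub>K\<^esub> convolution f g w"
  using assms
proof (induction w arbitrary: f)
  case Nil then show ?case by (simp add: K.m_assoc)
next
  case (Cons x w) then show ?case by (simp add: K.r_distr K.m_assoc)
qed

lemma convolution_scale_right:
  assumes "c \<in> carrier K" "\<And>w. f w \<in> carrier K" "\<And>w. g w \<in> carrier K"
  shows "convolution f (\<lambda>v. c \<otimes>\<^bsub>K\<^esub> g v) w = c \<otimes>\<^bsub>K\<^esub> convolution f g w"
  using assms
proof (induction w arbitrary: f)
  case Nil then show ?case by (simp add: K.m_lcomm)
next
  case (Cons x w) then show ?case by (simp add: K.r_distr K.m_lcomm)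
qed

lemma convolution_zero_left:
  assumes "\<And>w. g w \<in> carrier K"
  shows "convolution (\<lambda>_. \<zero>\<^bsub>K\<^esub>) g w = \<zero>\<^bsub>K\<^esub>"
  using assms by (induction w) auto

text \<open>The convolution obeys the Leibniz-like rule
  \<open>\<partial>\<^sub>x (f g) = f [] \<cdot> \<partial>\<^sub>x g + (\<partial>\<^sub>x f) g\<close> for \<open>\<partial>\<^sub>x f = (\<lambda>v. f (x # v))\<close>,
  which makes an induction on the word possible.\<close>

lemma convolution_assoc:
  assumes "\<And>w. f w \<in> carrier K" "\<And>w. g w \<in> carrier K" "\<And>w. h w \<in> carrier K"
  shows "convolution (convolution f g) h w = convolution f (convolution g h) w"
  using assms
proof (induction w arbitrary: f)
  case Nil then show ?case by (simp add: K.m_assoc)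
next
  case (Cons x w)
  have "convolution (\<lambda>v. convolution f g (x # v)) h w =
      convolution (\<lambda>v. f [] \<otimes>\<^bsub>K\<^esub> g (x # v) \<oplus>\<^bsub>K\<^esub> convolution (\<lambda>v. f (x # v)) g v) h w"
    using Cons.prems by simp
  also have "\<dots> = f [] \<otimes>\<^bsub>K\<^esub> convolution (\<lambda>v. g (x # v)) h w \<oplus>\<^bsub>K\<^esub>
      convolution (\<lambda>v. f (x # v)) (convolution g h) w"
    using Cons by (simp add: convolution_add_left convolution_scale_left)
  finally show ?case
    using Cons.prems by (simp add: K.r_distr K.m_assoc K.a_assoc)
qed

text \<open>For \<open>free_mult_closed\<close>: it confines the support of a product to the
  concatenations of words from the two supports.\<close>

lemma convolution_nonzero:
  assumes "convolution f g w \<noteq> \<zero>\<^bsub>K\<^esub>" "\<And>w. f w \<in> carrier K" "\<And>w. g w \<in> carrier K"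
  obtains u v where "w = u @ v" "f u \<noteq> \<zero>\<^bsub>K\<^esub>" "g v \<noteq> \<zero>\<^bsub>K\<^esub>"
proof -
  have "\<exists>u v. w = u @ v \<and> f u \<noteq> \<zero>\<^bsub>K\<^esub> \<and> g v \<noteq> \<zero>\<^bsub>K\<^esub>"
    using assms
  proof (induction w arbitrary: f)
    case Nil then show ?case by auto
  next
    case (Cons x w)
    show ?case
    proof (cases "convolution (\<lambda>v. f (x # v)) g w = \<zero>\<^bsub>K\<^esub>")
      case True
      then have "f [] \<noteq> \<zero>\<^bsub>K\<^esub>" "g (x # w) \<noteq> \<zero>\<^bsub>K\<^esub>" using Cons.prems by auto
      then show ?thesis by (metis append_Nil)
    next
      case False
      with Cons.IH[OF this] Cons.prems show ?thesis by (metis append_Cons)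
    qed
  qed
  then show thesis using that by blast
qed

lemma word_closed_field [simp]: "XW u w \<in> carrier K"
  by (simp add: word_monomial_def)

lemma convolution_one_left:
  assumes "\<And>w. g w \<in> carrier K" shows "convolution (XW []) g w = g w"
  using assms by (cases w) (auto simp: word_monomial_def convolution_zero_left)

lemma convolution_one_right:
  assumes "\<And>w. f w \<in> carrier K" shows "convolution f (XW []) w = f w"
  using assms by (induction w arbitrary: f) (auto simp: word_monomial_def)

text \<open>The left derivative of \<open>XW (x # u)\<close> by a letter \<open>y\<close> is
  \<open>XW u\<close> if \<open>y = x\<close> and zero otherwise, so the recursion strips
  \<open>u\<close> letter by letter.\<close>

lemma word_mult: "XW u \<otimes>\<^bsub>F\<^esub> XW v = XW (u @ v)"
proof -
  have "convolution (XW u) (XW v) w = XW (u @ v) w" for w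
  proof (induction u arbitrary: w)
    case Nil then show ?case by (simp add: convolution_one_left)
  next
    case (Cons x u)
    show ?case
    proof (cases w)
      case Nil then show ?thesis by (simp add: word_monomial_def)
    next
      case (Cons y w')
      have "(\<lambda>v. XW (x # u) (y # v)) = (if x = y then XW u else (\<lambda>_. \<zero>\<^bsub>K\<^esub>))"
        by (auto simp: word_monomial_def fun_eq_iff)
      moreover have "XW (x # u) [] = \<zero>\<^bsub>K\<^esub>" by (simp add: word_monomial_def)
      moreover have "XW ((x # u) @ v) (y # w') = (if x = y then XW (u @ v) w' else \<zero>\<^bsub>K\<^esub>)"
        by (auto simp: word_monomial_def)
      ultimately show ?thesis
        using Cons.IH[of w'] Cons by (simp add: convolution_zero_left)
    qed
  qed
  then show ?thesis by (simp add: free_selectors fun_eq_iff)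
qed

lemma word_inj: "XW u = XW v \<longleftrightarrow> u = v"
  by (metis one_not_zero word_monomial_def)

lemma word_closed [simp]: "w \<in> lists {1..n} \<Longrightarrow> XW w \<in> carrier F"
  by (auto simp: free_carrier_iff word_monomial_def)

lemma free_mult_closed:
  assumes "f \<in> carrier F" "g \<in> carrier F" shows "convolution f g \<in> carrier F"
proof -
  have c: "f w \<in> carrier K" "g w \<in> carrier K" for w
    using assms by (auto simp: free_carrier_iff)
  let ?S = "(\<lambda>(u, v). u @ v) ` ({w. f w \<noteq> \<zero>\<^bsub>K\<^esub>} \<times> {w. g w \<noteq> \<zero>\<^bsub>K\<^esub>})"
  have "w \<in> ?S" if nz: "convolution f g w \<noteq> \<zero>\<^bsub>K\<^esub>" for w
  proof -
    obtain u v where "w = u @ v" "f u \<noteq> \<zero>\<^bsub>K\<^esub>" "g v \<noteq> \<zero>\<^bsub>K\<^esub>"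
      using convolution_nonzero[OF nz c] by metis
    then show ?thesis by (intro image_eqI[of _ _ "(u, v)"]) auto
  qed
  then have "{w. convolution f g w \<noteq> \<zero>\<^bsub>K\<^esub>} \<subseteq> ?S" by blast
  moreover have "finite ?S" "?S \<subseteq> lists {1..n}"
    using assms unfolding free_carrier_iff by (blast, fastforce)
  ultimately have "finite {w. convolution f g w \<noteq> \<zero>\<^bsub>K\<^esub>}" "{w. convolution f g w \<noteq> \<zero>\<^bsub>K\<^esub>} \<subseteq> lists {1..n}"
    by (meson finite_subset subset_trans)+
  then show ?thesis
    using c by (auto simp: free_carrier_iff)
qed

lemma free_abelian_group: "abelian_group F"
proof (rule abelian_groupI)
  fix x y z assume x: "x \<in> carrier F" and y: "y \<in> carrier F" and z: "z \<in> carrier F"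
  note c = x[unfolded free_carrier_iff] y[unfolded free_carrier_iff] z[unfolded free_carrier_iff]
  have "{w. x w \<oplus>\<^bsub>K\<^esub> y w \<noteq> \<zero>\<^bsub>K\<^esub>} \<subseteq> {w. x w \<noteq> \<zero>\<^bsub>K\<^esub>} \<union> {w. y w \<noteq> \<zero>\<^bsub>K\<^esub>}"
    by auto
  then have "finite {w. x w \<oplus>\<^bsub>K\<^esub> y w \<noteq> \<zero>\<^bsub>K\<^esub>}"
    by (rule finite_subset) (use c in simp)
  then show "x \<oplus>\<^bsub>F\<^esub> y \<in> carrier F"
    using c unfolding free_carrier_iff free_selectors by (metis K.l_zero K.a_closed K.zero_closed)
  show "x \<oplus>\<^bsub>F\<^esub> y \<oplus>\<^bsub>F\<^esub> z = x \<oplus>\<^bsub>F\<^esub> (y \<oplus>\<^bsub>F\<^esub> z)"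
    using c by (auto simp: free_selectors K.a_assoc)
  show "x \<oplus>\<^bsub>F\<^esub> y = y \<oplus>\<^bsub>F\<^esub> x"
    using c by (auto simp: free_selectors K.a_comm)
  show "\<zero>\<^bsub>F\<^esub> \<oplus>\<^bsub>F\<^esub> x = x"
    using c by (auto simp: free_selectors)
  have "{w. \<ominus>\<^bsub>K\<^esub> x w \<noteq> \<zero>\<^bsub>K\<^esub>} \<subseteq> {w. x w \<noteq> \<zero>\<^bsub>K\<^esub>}"
    by auto
  then have "finite {w. \<ominus>\<^bsub>K\<^esub> x w \<noteq> \<zero>\<^bsub>K\<^esub>}"
    by (rule finite_subset) (use c in simp)
  then have "(\<lambda>w. \<ominus>\<^bsub>K\<^esub> x w) \<in> carrier F"
    using c unfolding free_carrier_iff by (metis K.a_inv_closed K.minus_zero)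
  moreover have "(\<lambda>w. \<ominus>\<^bsub>K\<^esub> x w) \<oplus>\<^bsub>F\<^esub> x = \<zero>\<^bsub>F\<^esub>"
    using c by (auto simp: free_selectors K.l_neg)
  ultimately show "\<exists>y\<in>carrier F. y \<oplus>\<^bsub>F\<^esub> x = \<zero>\<^bsub>F\<^esub>" by blast
qed (auto simp: free_carrier_iff free_selectors)

lemma free_smult_closed:
  assumes "c \<in> carrier K" "f \<in> carrier F" shows "c \<odot>\<^bsub>F\<^esub> f \<in> carrier F"
proof -
  have "{w. c \<otimes>\<^bsub>K\<^esub> f w \<noteq> \<zero>\<^bsub>K\<^esub>} \<subseteq> {w. f w \<noteq> \<zero>\<^bsub>K\<^esub>}"
    using assms by auto
  then have "finite {w. c \<otimes>\<^bsub>K\<^esub> f w \<noteq> \<zero>\<^bsub>K\<^esub>}"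
    by (rule finite_subset) (use assms in \<open>simp add: free_carrier_iff\<close>)
  then show ?thesis
    using assms unfolding free_carrier_iff free_selectors by (metis K.r_null K.m_closed)
qed

lemma free_assoc_algebra: "assoc_algebra K F"
proof -
  have c: "f w \<in> carrier K" if "f \<in> carrier F" for f w
    using that by (simp add: free_carrier_iff)
  have "module K F"
  proof (rule moduleI)
    show "cring K" by (rule K.cring_axioms)
  qed (auto simp: free_abelian_group free_smult_closed,
      auto simp: free_selectors fun_eq_iff c K.l_distr K.r_distr K.m_assoc)
  moreover have "ring F"
  proof (rule ringI[OF free_abelian_group])
    show "monoid F"
    proof (rule monoidI)
      fix x y z assume "x \<in> carrier F" "y \<in> carrier F" "z \<in> carrier F"
      then show "x \<otimes>\<^bsub>F\<^esub> y \<otimes>\<^bsub>F\<^esub> z = x \<otimes>\<^bsub>F\<^esub> (y \<otimes>\<^bsub>F\<^esub> z)"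
        by (simp add: free_selectors fun_eq_iff convolution_assoc c)
    qed (auto simp: free_selectors free_mult_closed fun_eq_iff convolution_one_left
        convolution_one_right c)
  qed (auto simp: free_selectors fun_eq_iff convolution_add_left convolution_add_right c)
  moreover have "field K" ..
  ultimately show ?thesis
    by (intro assoc_algebra.intro assoc_algebra_axioms.intro)
      (auto simp: free_selectors fun_eq_iff convolution_scale_left convolution_scale_right c)
qed

sublocale F?: assoc_algebra K F
  by (rule free_assoc_algebra)

lemma free_finsum_apply:
  assumes "finite S" "g \<in> S \<rightarrow> carrier F"
  shows "(\<Oplus>\<^bsub>F\<^esub>b\<in>S. g b) w = (\<Oplus>\<^bsub>K\<^esub>b\<in>S. g b w)"
  using assms
proof (induction S rule: finite_induct)
  case empty then show ?case by (simp add: free_selectors)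
next
  case (insert x S)
  then have "g x \<in> carrier F" "g \<in> S \<rightarrow> carrier F" by auto
  then have "(\<lambda>b. g b w) \<in> S \<rightarrow> carrier K" "g x w \<in> carrier K"
    by (auto simp: free_carrier_iff Pi_def)
  with insert \<open>g x \<in> carrier F\<close> \<open>g \<in> S \<rightarrow> carrier F\<close> show ?case
    by (simp add: F.M.finsum_insert K.finsum_insert free_selectors(4))
qed

text \<open>At the word \<open>w\<close> every basis element except \<open>XW w\<close> vanishes, so
  evaluation picks out a single coefficient. Independence and spanning of the words are both read
  off from this.\<close>

lemma free_combination_apply:
  assumes "finite S" "S \<subseteq> free_basis K n" "c \<in> S \<rightarrow> carrier K"
  shows "(\<Oplus>\<^bsub>F\<^esub>b\<in>S. c b \<odot>\<^bsub>F\<^esub> b) w = (if XW w \<in> S then c (XW w) else \<zero>\<^bsub>K\<^esub>)"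
proof -
  have S: "b \<in> carrier F" "c b \<in> carrier K" "b w = (if b = XW w then \<one>\<^bsub>K\<^esub> else \<zero>\<^bsub>K\<^esub>)" if b: "b \<in> S" for b
  proof -
    obtain u where u: "u \<in> lists {1..n}" "b = XW u" using b assms(2) by (auto simp: free_basis_def)
    show "b \<in> carrier F" unfolding u(2) using u(1) by (rule word_closed)
    show "c b \<in> carrier K" using b assms(3) by blast
    show "b w = (if b = XW w then \<one>\<^bsub>K\<^esub> else \<zero>\<^bsub>K\<^esub>)"
      unfolding u(2) word_inj by (auto simp: word_monomial_def)
  qed
  have "(\<Oplus>\<^bsub>F\<^esub>b\<in>S. c b \<odot>\<^bsub>F\<^esub> b) w = (\<Oplus>\<^bsub>K\<^esub>b\<in>S. c b \<otimes>\<^bsub>K\<^esub> b w)"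
  proof -
    have "(\<lambda>b. c b \<odot>\<^bsub>F\<^esub> b) \<in> S \<rightarrow> carrier F" using S free_smult_closed by blast
    from free_finsum_apply[OF assms(1) this, of w] show ?thesis by (simp only: free_selectors(5))
  qed
  also have "\<dots> = (\<Oplus>\<^bsub>K\<^esub>b\<in>S. if b = XW w then c b else \<zero>\<^bsub>K\<^esub>)"
  proof (rule K.finsum_cong')
    show "c b \<otimes>\<^bsub>K\<^esub> b w = (if b = XW w then c b else \<zero>\<^bsub>K\<^esub>)" if "b \<in> S" for b
      unfolding S(3)[OF that] using S(2)[OF that] by (cases "b = XW w") auto
  qed (use S(2) in auto)
  also have "\<dots> = (if XW w \<in> S then c (XW w) else \<zero>\<^bsub>K\<^esub>)"
  proof (cases "XW w \<in> S")
    case True then show ?thesis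
      using K.add.finprod_singleton_swap[of "XW w" S c] assms by simp
  next
    case False
    then have "(\<Oplus>\<^bsub>K\<^esub>b\<in>S. if b = XW w then c b else \<zero>\<^bsub>K\<^esub>) = (\<Oplus>\<^bsub>K\<^esub>b\<in>S. \<zero>\<^bsub>K\<^esub>)"
      by (intro K.finsum_cong') auto
    with False show ?thesis by simp
  qed
  finally show ?thesis .
qed

lemma free_is_basis: "is_basis K F (free_basis K n)"
proof -
  let ?B = "free_basis K n"
  have B: "?B \<subseteq> carrier F" unfolding free_basis_def using word_closed by blast
  have "lin_indep K F ?B"
    unfolding lin_indep_def
  proof (intro allI impI ballI)
    fix S c b
    assume S: "finite S \<and> S \<subseteq> ?B \<and> c \<in> S \<rightarrow> carrier K \<and> (\<Oplus>\<^bsub>F\<^esub>b\<in>S. c b \<odot>\<^bsub>F\<^esub> b) = \<zero>\<^bsub>F\<^esub>" and b: "b \<in> S"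
    then obtain w where w: "b = XW w" by (auto simp: free_basis_def)
    have "(\<Oplus>\<^bsub>F\<^esub>b\<in>S. c b \<odot>\<^bsub>F\<^esub> b) w = \<zero>\<^bsub>K\<^esub>" using S by (simp add: free_selectors)
    then show "c b = \<zero>\<^bsub>K\<^esub>" using free_combination_apply[of S c w] S b w by simp
  qed
  moreover have span: "f \<in> lin_span K F ?B" if f: "f \<in> carrier F" for f
  proof -
    \<comment> \<open>\<open>f\<close> is indexed by words, the coefficient function of
      \<open>lin_span\<close> by basis elements; the inverse of \<open>XW\<close>
      translates.\<close>
    let ?S = "XW ` {w. f w \<noteq> \<zero>\<^bsub>K\<^esub>}" let ?c = "\<lambda>b. f (the_inv XW b)"
    have inv: "the_inv XW (XW w) = w" for w by (rule the_inv_f_f) (auto simp: inj_on_def word_inj)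
    have S: "finite ?S" "?S \<subseteq> ?B" "?c \<in> ?S \<rightarrow> carrier K"
      using f by (auto simp: free_carrier_iff free_basis_def)
    have "f = (\<Oplus>\<^bsub>F\<^esub>b\<in>?S. ?c b \<odot>\<^bsub>F\<^esub> b)"
      by (rule ext, subst free_combination_apply[OF S]) (auto simp: inv word_inj image_iff)
    then show ?thesis
      unfolding lin_span_def by (intro CollectI exI[of _ ?S] exI[of _ ?c] conjI S)
  qed
  have "lin_span K F ?B \<subseteq> carrier F"
  proof
    fix f assume "f \<in> lin_span K F ?B"
    then obtain S c where S: "S \<subseteq> ?B" "c \<in> S \<rightarrow> carrier K" "f = (\<Oplus>\<^bsub>F\<^esub>b\<in>S. c b \<odot>\<^bsub>F\<^esub> b)"
      unfolding lin_span_def by blast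
    show "f \<in> carrier F"
      unfolding S(3) using S(1,2) B by (intro F.M.finsum_closed Pi_I free_smult_closed) blast+
  qed
  then have "lin_span K F ?B = carrier F" using span by blast
  ultimately show ?thesis unfolding is_basis_def using B by iprover
qed

sublocale FB: vector_space_basis K F "free_basis K n"
  by unfold_locales (rule free_is_basis)

text \<open>Identifies the abstract coefficient with the value of \<open>f\<close>, so that the
  supports entering \<open>LM\<close> can be inspected word by word.\<close>

lemma free_coeff:
  assumes "f \<in> carrier F" "w \<in> lists {1..n}"
  shows "basis_coeff K F (free_basis K n) f (XW w) = f w"
proof -
  let ?c = "basis_coeff K F (free_basis K n) f"
  have "f w = (\<Oplus>\<^bsub>F\<^esub>b\<in>{b. ?c b \<noteq> \<zero>\<^bsub>K\<^esub>}. ?c b \<odot>\<^bsub>F\<^esub> b) w"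
    using FB.coeff_sum[OF assms(1)] by simp
  also have "\<dots> = ?c (XW w)"
    using FB.representsD[OF FB.represents_coeff[OF assms(1)]]
    by (subst free_combination_apply) auto
  finally show ?thesis by simp
qed

end

lemma lin_indepD:
  assumes "lin_indep K A B" "finite S" "S \<subseteq> B" "c \<in> S \<rightarrow> carrier K"
    "(\<Oplus>\<^bsub>A\<^esub>b\<in>S. c b \<odot>\<^bsub>A\<^esub> b) = \<zero>\<^bsub>A\<^esub>" "b \<in> S"
  shows "c b = \<zero>\<^bsub>K\<^esub>"
  using assms(1)[unfolded lin_indep_def, rule_format, of S c b] assms(2-) by simp

lemma lin_indep_subset:
  assumes "lin_indep K A B" "C \<subseteq> B" shows "lin_indep K A C"
  unfolding lin_indep_def
proof (intro allI impI ballI)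
  fix S c b
  assume "finite S \<and> S \<subseteq> C \<and> c \<in> S \<rightarrow> carrier K \<and> (\<Oplus>\<^bsub>A\<^esub>b\<in>S. c b \<odot>\<^bsub>A\<^esub> b) = \<zero>\<^bsub>A\<^esub>" "b \<in> S"
  then show "c b = \<zero>\<^bsub>K\<^esub>"
    using assms(2) by (intro lin_indepD[OF assms(1), of S c b]) auto
qed

lemma lin_spanI:
  assumes "finite S" "S \<subseteq> B" "c \<in> S \<rightarrow> carrier K"
  shows "(\<Oplus>\<^bsub>A\<^esub>b\<in>S. c b \<odot>\<^bsub>A\<^esub> b) \<in> lin_span K A B"
  unfolding lin_span_def by (intro CollectI exI[of _ S] exI[of _ c] conjI refl assms)

section \<open>Sorted words and exponent vectors\<close>

text \<open>With \<open>count_list\<close> as its inverse this identifies exponent vectors with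
  sorted words; adding exponents becomes adding multisets of letters.\<close>

definition word_of :: "nat \<Rightarrow> (nat \<Rightarrow> nat) \<Rightarrow> nat list" where
  "word_of n \<alpha> = concat (map (\<lambda>i. replicate (\<alpha> i) i) [1..<Suc n])"

lemma word_of_0 [simp]: "word_of 0 \<alpha> = []"
  and word_of_Suc: "word_of (Suc n) \<alpha> = word_of n \<alpha> @ replicate (\<alpha> (Suc n)) (Suc n)"
  by (auto simp: word_of_def)

lemma word_of_lists: "word_of n \<alpha> \<in> lists {1..n}"
  by (auto simp: word_of_def)

lemma set_word_of: "x \<in> set (word_of n \<alpha>) \<Longrightarrow> x \<le> n"
  using word_of_lists[of n \<alpha>] by auto

lemma sorted_word_of: "sorted (word_of n \<alpha>)"
proof (induction n)
  case (Suc n) then show ?case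
    using set_word_of[of _ n \<alpha>] by (force simp: word_of_Suc sorted_append)
qed simp

lemma count_list_replicate_eq: "count_list (replicate k x) y = (if x = y then k else 0)"
  by (induction k) auto

lemma count_word_of: "count_list (word_of n \<alpha>) i = (if i \<in> {1..n} then \<alpha> i else 0)"
  by (induction n) (auto simp: word_of_Suc count_list_append count_list_replicate_eq)

lemma count_list_word_of: "\<alpha> \<in> exponents n \<Longrightarrow> count_list (word_of n \<alpha>) = \<alpha>"
  by (auto simp: fun_eq_iff count_word_of exponents_def)

lemma count_list_exponents: "w \<in> lists {1..n} \<Longrightarrow> count_list w \<in> exponents n"
  unfolding exponents_def by (auto simp: count_list_0_iff)

lemma count_list_mset: "count_list u = count_list w \<longleftrightarrow> mset u = mset w"
  by (metis count_mset ext multiset_eqI)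

lemma word_of_count_list:
  assumes "sorted w" "w \<in> lists {1..n}" shows "word_of n (count_list w) = w"
proof -
  have "mset (word_of n (count_list w)) = mset w"
    using count_list_word_of count_list_exponents[OF assms(2)] count_list_mset by blast
  then show ?thesis
    using assms(1) sorted_word_of properties_for_sort sorted_sort_id by metis
qed

lemma unsorted_descent:
  fixes w :: "nat list"
  assumes "\<not> sorted w" obtains u i j v where "w = u @ [j, i] @ v" "i < j"
proof -
  have "\<exists>u i j v. w = u @ [j, i] @ v \<and> i < j"
    using assms
  proof (induction w rule: induct_list012)
    case (3 x y zs)
    show ?case
    proof (cases "x \<le> y")
      case True
      with 3(3) have "\<not> sorted (y # zs)" by (simp only: sorted2 simp_thms)
      then obtain u i j v where "y # zs = u @ [j, i] @ v" "i < j" using 3(2) by blast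
      then have "x # y # zs = (x # u) @ [j, i] @ v" by simp
      with \<open>i < j\<close> show ?thesis by blast
    next
      case False
      then have "x # y # zs = [] @ [x, y] @ zs" "y < x" by auto
      then show ?thesis by blast
    qed
  qed auto
  then show thesis using that by blast
qed

text \<open>Words with the same letters have equal length, so \<open>lenlex\<close> compares them
  lexicographically. A sorted word starts with its least letter, and if the heads agree, the tails
  again have the same letters.\<close>

lemma sorted_lenlex_least:
  fixes u w :: "nat list"
  assumes "sorted w" "mset u = mset w" shows "(u, w) \<notin> lenlex less_than"
  using assms
proof (induction w arbitrary: u)
  case (Cons x w)
  then obtain y u' where u: "u = y # u'" by (cases u) auto
  with Cons.prems have "y \<in> set (x # w)"
    by (metis list.set_intros(1) mset_eq_setD)
  with Cons.prems have "x \<le> y" by auto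
  moreover have "(u', w) \<notin> lenlex less_than" if "x = y"
    using Cons u that by auto
  moreover have "length u' = length w"
    using mset_eq_length[OF Cons.prems(2)] u by simp
  ultimately show ?case using u by (auto simp: Cons_lenlex_iff)
qed auto

lemma (in free_algebra_field) free_pow: "XW u [^]\<^bsub>F\<^esub> (k::nat) = XW (concat (replicate k u))"
proof (induction k)
  case (Suc k)
  have "concat (replicate k u) @ u = u @ concat (replicate k u)"
    by (induction k) auto
  with Suc show ?case by (simp add: F.A.nat_pow_Suc word_mult)
qed (simp add: free_selectors)

lemma (in free_algebra_field) free_ordered_monomial:
  "ordered_monomial F n (free_generator K) \<alpha> = XW (word_of n \<alpha>)"
proof -
  have "concat (replicate k [i]) = replicate k i" for k and i :: nat
    by (induction k) auto
  \<comment> \<open>The induction runs over an arbitrary list of indices in place of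
    \<open>[1..<Suc n]\<close>.\<close>
  then have "foldr (\<lambda>i x. (free_generator K i [^]\<^bsub>F\<^esub> \<alpha> i) \<otimes>\<^bsub>F\<^esub> x) is \<one>\<^bsub>F\<^esub>
      = XW (concat (map (\<lambda>i. replicate (\<alpha> i) i) is))" for "is"
    by (induction "is") (auto simp: free_selectors(2) free_generator_def free_pow word_mult)
  then show ?thesis by (simp add: ordered_monomial_def word_of_def)
qed

section \<open>Homomorphisms and isomorphisms of algebras\<close>

locale algebra_homomorphism = A: assoc_algebra K A + B: assoc_algebra K B
  for K :: "('k, 'm) ring_scheme" (structure) and A :: "('k, 'a, 's) module_scheme" (structure)
    and B :: "('k, 'b, 't) module_scheme" (structure) +
  fixes h :: "'a \<Rightarrow> 'b"
  assumes hom: "h \<in> algebra_hom K A B"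
begin

lemma hom_closed [simp, intro]: "x \<in> carrier A \<Longrightarrow> h x \<in> carrier B"
  and hom_mult [simp]: "x \<in> carrier A \<Longrightarrow> y \<in> carrier A \<Longrightarrow> h (x \<otimes>\<^bsub>A\<^esub> y) = h x \<otimes>\<^bsub>B\<^esub> h y"
  and hom_add [simp]: "x \<in> carrier A \<Longrightarrow> y \<in> carrier A \<Longrightarrow> h (x \<oplus>\<^bsub>A\<^esub> y) = h x \<oplus>\<^bsub>B\<^esub> h y"
  and hom_smult [simp]: "c \<in> carrier K \<Longrightarrow> x \<in> carrier A \<Longrightarrow> h (c \<odot>\<^bsub>A\<^esub> x) = c \<odot>\<^bsub>B\<^esub> h x"
  and hom_one [simp]: "h \<one>\<^bsub>A\<^esub> = \<one>\<^bsub>B\<^esub>"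
  using hom by (auto simp: algebra_hom_def ring_hom_def)

lemma hom_zero [simp]: "h \<zero>\<^bsub>A\<^esub> = \<zero>\<^bsub>B\<^esub>"
  using hom_smult[of "\<zero>\<^bsub>K\<^esub>" "\<zero>\<^bsub>A\<^esub>"] by simp

lemma hom_minus [simp]:
  assumes "x \<in> carrier A" shows "h (\<ominus>\<^bsub>A\<^esub> x) = \<ominus>\<^bsub>B\<^esub> h x"
  using assms hom_smult[of "\<ominus>\<^bsub>K\<^esub> \<one>\<^bsub>K\<^esub>" x] by (simp add: A.smult_l_minus B.smult_l_minus)

lemma hom_diff [simp]:
  "x \<in> carrier A \<Longrightarrow> y \<in> carrier A \<Longrightarrow> h (x \<ominus>\<^bsub>A\<^esub> y) = h x \<ominus>\<^bsub>B\<^esub> h y"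
  by (simp add: A.M.minus_eq B.M.minus_eq)

lemma hom_finsum:
  "f \<in> S \<rightarrow> carrier A \<Longrightarrow> h (\<Oplus>\<^bsub>A\<^esub>x\<in>S. f x) = (\<Oplus>\<^bsub>B\<^esub>x\<in>S. h (f x))"
proof (induction S rule: infinite_finite_induct)
  case (insert x S)
  then have "f x \<in> carrier A" "f \<in> S \<rightarrow> carrier A" "(\<lambda>x. h (f x)) \<in> S \<rightarrow> carrier B" by auto
  with insert show ?case by (simp add: A.M.finsum_insert B.M.finsum_insert)
qed auto

lemma hom_pow [simp]: "x \<in> carrier A \<Longrightarrow> h (x [^]\<^bsub>A\<^esub> (k::nat)) = h x [^]\<^bsub>B\<^esub> k"
  by (induction k) (auto simp: A.A.nat_pow_Suc B.A.nat_pow_Suc)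

lemma hom_ordered_monomial:
  assumes "x ` {1..n} \<subseteq> carrier A" "\<And>i. i \<in> {1..n} \<Longrightarrow> h (x i) = y i"
  shows "ordered_monomial A n x \<alpha> \<in> carrier A"
    "h (ordered_monomial A n x \<alpha>) = ordered_monomial B n y \<alpha>"
proof -
  have "foldr (\<lambda>i z. (x i [^]\<^bsub>A\<^esub> \<alpha> i) \<otimes>\<^bsub>A\<^esub> z) is \<one>\<^bsub>A\<^esub> \<in> carrier A \<and>
      h (foldr (\<lambda>i z. (x i [^]\<^bsub>A\<^esub> \<alpha> i) \<otimes>\<^bsub>A\<^esub> z) is \<one>\<^bsub>A\<^esub>) =
      foldr (\<lambda>i z. (y i [^]\<^bsub>B\<^esub> \<alpha> i) \<otimes>\<^bsub>B\<^esub> z) is \<one>\<^bsub>B\<^esub>" if "set is \<subseteq> {1..n}" for "is"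
    using that
  proof (induction "is")
    case (Cons i "is")
    then have "x i \<in> carrier A" "h (x i) = y i" using assms by auto
    with Cons show ?case by auto
  qed simp
  moreover have "set [1..<Suc n] \<subseteq> {1..n}" by auto
  ultimately show "ordered_monomial A n x \<alpha> \<in> carrier A"
    "h (ordered_monomial A n x \<alpha>) = ordered_monomial B n y \<alpha>"
    unfolding ordered_monomial_def by blast+
qed

lemma hom_ordered_monomials:
  assumes "x ` {1..n} \<subseteq> carrier A" "\<And>i. i \<in> {1..n} \<Longrightarrow> h (x i) = y i"
  shows "h ` ordered_monomials A n x = ordered_monomials B n y"
  using hom_ordered_monomial(2)[OF assms] by (auto simp: ordered_monomials_def image_image)

lemma hom_ordered_sum:
  assumes "x ` {1..n} \<subseteq> carrier A" "\<And>i. i \<in> {1..n} \<Longrightarrow> h (x i) = y i" "m \<in> coeff_functions K n"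
  shows "ordered_sum K A n x m \<in> carrier A" "h (ordered_sum K A n x m) = ordered_sum K B n y m"
proof -
  let ?S = "{\<alpha> \<in> exponents n. m \<alpha> \<noteq> \<zero>\<^bsub>K\<^esub>}"
  have S: "m \<alpha> \<in> carrier K" if "\<alpha> \<in> ?S" for \<alpha>
    using assms(3) that by (auto simp: coeff_functions_def)
  then have *: "(\<lambda>\<alpha>. m \<alpha> \<odot>\<^bsub>A\<^esub> ordered_monomial A n x \<alpha>) \<in> ?S \<rightarrow> carrier A"
    using hom_ordered_monomial(1)[OF assms(1,2)] by blast
  then show "ordered_sum K A n x m \<in> carrier A"
    unfolding ordered_sum_def by (rule A.M.finsum_closed)
  show "h (ordered_sum K A n x m) = ordered_sum K B n y m"
    unfolding ordered_sum_def hom_finsum[OF *]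
  proof (rule B.M.finsum_cong')
    show "h (m \<alpha> \<odot>\<^bsub>A\<^esub> ordered_monomial A n x \<alpha>) = m \<alpha> \<odot>\<^bsub>B\<^esub> ordered_monomial B n y \<alpha>"
      if "\<alpha> \<in> ?S" for \<alpha>
      using S[OF that] hom_ordered_monomial[OF assms(1,2)] by simp
    show "(\<lambda>\<alpha>. m \<alpha> \<odot>\<^bsub>B\<^esub> ordered_monomial B n y \<alpha>) \<in> ?S \<rightarrow> carrier B"
      using S hom_ordered_monomial[OF assms(1,2)] by (metis (no_types, lifting) Pi_I B.smult_closed hom_closed)
  qed simp
qed

text \<open>Coefficients are indexed by the vectors themselves, so \<open>h\<close> must be
  injective on the index set; otherwise distinct summands could merge.\<close>

lemma hom_combination:
  assumes "T \<subseteq> carrier A" "inj_on h T" "c \<in> h ` T \<rightarrow> carrier K"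
  shows "(\<Oplus>\<^bsub>B\<^esub>b\<in>h ` T. c b \<odot>\<^bsub>B\<^esub> b) = h (\<Oplus>\<^bsub>A\<^esub>a\<in>T. c (h a) \<odot>\<^bsub>A\<^esub> a)"
proof -
  have T: "a \<in> carrier A" "c (h a) \<in> carrier K" if "a \<in> T" for a using assms that by auto
  have "(\<Oplus>\<^bsub>B\<^esub>b\<in>h ` T. c b \<odot>\<^bsub>B\<^esub> b) = (\<Oplus>\<^bsub>B\<^esub>a\<in>T. c (h a) \<odot>\<^bsub>B\<^esub> h a)"
    using T assms(2) by (intro B.M.add.finprod_reindex) auto
  also have "\<dots> = (\<Oplus>\<^bsub>B\<^esub>a\<in>T. h (c (h a) \<odot>\<^bsub>A\<^esub> a))"
    using T by (intro B.M.finsum_cong') auto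
  also have "\<dots> = h (\<Oplus>\<^bsub>A\<^esub>a\<in>T. c (h a) \<odot>\<^bsub>A\<^esub> a)"
    using T by (intro hom_finsum[symmetric]) auto
  finally show ?thesis .
qed

lemma hom_lin_span:
  assumes "S \<subseteq> carrier A" "inj_on h S"
  shows "lin_span K B (h ` S) = h ` lin_span K A S"
proof (intro equalityI subsetI)
  fix y assume "y \<in> lin_span K B (h ` S)"
  then obtain T c where T: "finite T" "T \<subseteq> h ` S" "c \<in> T \<rightarrow> carrier K" and y: "y = (\<Oplus>\<^bsub>B\<^esub>b\<in>T. c b \<odot>\<^bsub>B\<^esub> b)"
    unfolding lin_span_def by blast
  obtain U where U: "U \<subseteq> S" "inj_on h U" "T = h ` U"
    using T(2) by (auto simp: subset_image_inj)
  have "y = h (\<Oplus>\<^bsub>A\<^esub>a\<in>U. c (h a) \<odot>\<^bsub>A\<^esub> a)"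
    unfolding y U(3) using assms U T(3) by (intro hom_combination) auto
  moreover have "finite U" using T(1) U finite_imageD by blast
  then have "(\<Oplus>\<^bsub>A\<^esub>a\<in>U. c (h a) \<odot>\<^bsub>A\<^esub> a) \<in> lin_span K A S"
    using U T(3) by (intro lin_spanI) auto
  ultimately show "y \<in> h ` lin_span K A S" by blast
next
  fix y assume "y \<in> h ` lin_span K A S"
  then obtain T c where T: "finite T" "T \<subseteq> S" "c \<in> T \<rightarrow> carrier K" and y: "y = h (\<Oplus>\<^bsub>A\<^esub>b\<in>T. c b \<odot>\<^bsub>A\<^esub> b)"
    unfolding lin_span_def by blast
  \<comment> \<open>Coefficients on the image are read through the preimage in \<open>T\<close>,
    which is unique by injectivity.\<close>
  let ?d = "\<lambda>b. c (inv_into T h b)"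
  have inj: "inj_on h T" using assms T inj_on_subset by blast
  have d: "?d \<in> h ` T \<rightarrow> carrier K" using T(3) by (auto intro: inv_into_into)
  have "(\<Oplus>\<^bsub>A\<^esub>b\<in>T. c b \<odot>\<^bsub>A\<^esub> b) = (\<Oplus>\<^bsub>A\<^esub>b\<in>T. ?d (h b) \<odot>\<^bsub>A\<^esub> b)"
  proof (rule A.M.finsum_cong'[OF refl])
    show "(\<lambda>b. ?d (h b) \<odot>\<^bsub>A\<^esub> b) \<in> T \<rightarrow> carrier A"
      using d T(2) assms(1) by (intro Pi_I A.smult_closed) blast+
  qed (simp add: inv_into_f_f[OF inj])
  then have y': "y = (\<Oplus>\<^bsub>B\<^esub>b\<in>h ` T. ?d b \<odot>\<^bsub>B\<^esub> b)"
    unfolding y using T assms(1) hom_combination[OF _ inj d] by simp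
  then show "y \<in> lin_span K B (h ` S)"
    unfolding y' using T d by (intro lin_spanI image_mono) auto
qed

text \<open>A trivial kernel is demanded only on the span of \<open>S\<close>: the map in view is
  \<open>\<pi>\<close>, whose kernel \<open>I\<close> may be large but meets the span of the sorted
  words trivially.\<close>

lemma hom_lin_indep:
  assumes "S \<subseteq> carrier A" "lin_indep K A S" "\<And>x. x \<in> lin_span K A S \<Longrightarrow> h x = \<zero>\<^bsub>B\<^esub> \<Longrightarrow> x = \<zero>\<^bsub>A\<^esub>"
  shows "inj_on h S" "lin_indep K B (h ` S)"
proof -
  show "inj_on h S"
  proof (rule inj_onI, rule ccontr)
    fix x y assume xy: "x \<in> S" "y \<in> S" "h x = h y" "x \<noteq> y"
    then have c: "x \<in> carrier A" "y \<in> carrier A" using assms by auto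
    let ?c = "\<lambda>z. if z = x then \<one>\<^bsub>K\<^esub> else \<ominus>\<^bsub>K\<^esub> \<one>\<^bsub>K\<^esub>"
    have s: "(\<Oplus>\<^bsub>A\<^esub>z\<in>{x, y}. ?c z \<odot>\<^bsub>A\<^esub> z) = x \<ominus>\<^bsub>A\<^esub> y"
      using c xy by (subst A.M.finsum_insert) (auto simp: A.smult_l_minus A.M.minus_eq)
    have "x \<ominus>\<^bsub>A\<^esub> y \<in> lin_span K A S"
      unfolding s[symmetric] using xy by (intro lin_spanI) auto
    moreover have "h (x \<ominus>\<^bsub>A\<^esub> y) = \<zero>\<^bsub>B\<^esub>" using c xy by (simp add: B.M.r_neg B.M.minus_eq)
    ultimately have "x \<ominus>\<^bsub>A\<^esub> y = \<zero>\<^bsub>A\<^esub>" by (rule assms(3))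
    then have "?c x = \<zero>\<^bsub>K\<^esub>"
      using s xy(1,2) by (intro lin_indepD[OF assms(2), of "{x, y}" ?c]) auto
    then show False by simp
  qed
  show "lin_indep K B (h ` S)"
    unfolding lin_indep_def
  proof (intro allI impI ballI)
    fix T c b
    assume T: "finite T \<and> T \<subseteq> h ` S \<and> c \<in> T \<rightarrow> carrier K \<and> (\<Oplus>\<^bsub>B\<^esub>b\<in>T. c b \<odot>\<^bsub>B\<^esub> b) = \<zero>\<^bsub>B\<^esub>" and b: "b \<in> T"
    obtain U where U: "U \<subseteq> S" "inj_on h U" "T = h ` U"
      using T by (auto simp: subset_image_inj)
    have fin: "finite U" using T U finite_imageD by blast
    have "h (\<Oplus>\<^bsub>A\<^esub>a\<in>U. c (h a) \<odot>\<^bsub>A\<^esub> a) = \<zero>\<^bsub>B\<^esub>"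
      using T hom_combination[of U c] U assms(1) by auto
    moreover have "(\<Oplus>\<^bsub>A\<^esub>a\<in>U. c (h a) \<odot>\<^bsub>A\<^esub> a) \<in> lin_span K A S"
      using U T fin by (intro lin_spanI) auto
    ultimately have "(\<Oplus>\<^bsub>A\<^esub>a\<in>U. c (h a) \<odot>\<^bsub>A\<^esub> a) = \<zero>\<^bsub>A\<^esub>" using assms(3) by blast
    then have "c (h a) = \<zero>\<^bsub>K\<^esub>" if "a \<in> U" for a
      using U T fin that by (intro lin_indepD[OF assms(2), of U "\<lambda>a. c (h a)"]) auto
    then show "c b = \<zero>\<^bsub>K\<^esub>" using b U by auto
  qed
qed

end

lemma well_order_on_linear: "well_order_on B r \<Longrightarrow> linear_order_on B r"
  by (simp add: well_order_on_def)

lemma assoc_algebra_vector_space_basis: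
  "assoc_algebra K A \<Longrightarrow> is_basis K A B \<Longrightarrow> vector_space_basis K A B"
  by (simp add: assoc_algebra_def vector_space_basis_def vector_space_basis_axioms_def)

lemma assoc_algebra_ordered_basis:
  "assoc_algebra K A \<Longrightarrow> is_basis K A B \<Longrightarrow> linear_order_on B r \<Longrightarrow> ordered_basis K A B r"
  by (simp add: assoc_algebra_vector_space_basis ordered_basis_def ordered_basis_axioms_def)

text \<open>An injective map compatible with the operations reflects every equational axiom from
  \<open>A\<close>. For the quotient algebra this replaces a verification of the axioms on
  cosets.\<close>

lemma assoc_algebra_pullback:
  fixes K :: "('k, 'm) ring_scheme" and A :: "('k, 'a, 's) module_scheme"
    and Q :: "('k, 'b, 't) module_scheme"
  assumes alg: "assoc_algebra K A"
    and bij: "bij_betw h (carrier Q) (carrier A)"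
    and closed: "\<one>\<^bsub>Q\<^esub> \<in> carrier Q" "\<zero>\<^bsub>Q\<^esub> \<in> carrier Q"
      "\<And>x y. x \<in> carrier Q \<Longrightarrow> y \<in> carrier Q \<Longrightarrow> x \<oplus>\<^bsub>Q\<^esub> y \<in> carrier Q"
      "\<And>x y. x \<in> carrier Q \<Longrightarrow> y \<in> carrier Q \<Longrightarrow> x \<otimes>\<^bsub>Q\<^esub> y \<in> carrier Q"
      "\<And>c x. c \<in> carrier K \<Longrightarrow> x \<in> carrier Q \<Longrightarrow> c \<odot>\<^bsub>Q\<^esub> x \<in> carrier Q"
    and hom: "h \<one>\<^bsub>Q\<^esub> = \<one>\<^bsub>A\<^esub>" "h \<zero>\<^bsub>Q\<^esub> = \<zero>\<^bsub>A\<^esub>"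
      "\<And>x y. x \<in> carrier Q \<Longrightarrow> y \<in> carrier Q \<Longrightarrow> h (x \<oplus>\<^bsub>Q\<^esub> y) = h x \<oplus>\<^bsub>A\<^esub> h y"
      "\<And>x y. x \<in> carrier Q \<Longrightarrow> y \<in> carrier Q \<Longrightarrow> h (x \<otimes>\<^bsub>Q\<^esub> y) = h x \<otimes>\<^bsub>A\<^esub> h y"
      "\<And>c x. c \<in> carrier K \<Longrightarrow> x \<in> carrier Q \<Longrightarrow> h (c \<odot>\<^bsub>Q\<^esub> x) = c \<odot>\<^bsub>A\<^esub> h x"
  shows "assoc_algebra K Q" "h \<in> algebra_hom K Q A"
proof -
  interpret A: assoc_algebra K A by (rule alg)
  have hc [simp]: "x \<in> carrier Q \<Longrightarrow> h x \<in> carrier A" for x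
    using bij by (auto simp: bij_betw_def)
  have eq: "x = y" if "h x = h y" "x \<in> carrier Q" "y \<in> carrier Q" for x y
    using that bij by (auto simp: bij_betw_def inj_on_def)
  note [simp] = closed hom
  have ab: "abelian_group Q"
  proof (rule abelian_groupI)
    fix x assume x: "x \<in> carrier Q"
    \<comment> \<open>Additive inverses are the one axiom that asserts existence; surjectivity of
      \<open>h\<close> supplies them.\<close>
    then obtain y where "y \<in> carrier Q" "h y = \<ominus>\<^bsub>A\<^esub> h x"
      using bij unfolding bij_betw_def by (metis A.M.a_inv_closed hc imageE)
    then show "\<exists>y\<in>carrier Q. y \<oplus>\<^bsub>Q\<^esub> x = \<zero>\<^bsub>Q\<^esub>"
      using x by (intro bexI[of _ y] eq) (auto simp: A.M.l_neg)
  qed (auto intro!: eq simp: A.M.a_ac)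
  have "module K Q"
    by (rule moduleI[OF A.R.cring_axioms ab])
      (auto intro!: eq simp: A.smult_l_distr A.smult_r_distr A.smult_assoc1)
  moreover have "monoid Q"
    by (rule monoidI) (auto intro!: eq simp: A.A.m_assoc)
  then have "ring Q"
    by (rule ringI[OF ab]) (auto intro!: eq simp: A.A.l_distr A.A.r_distr)
  moreover have "field K" ..
  ultimately show "assoc_algebra K Q"
    by (intro assoc_algebra.intro assoc_algebra_axioms.intro)
      (auto intro!: eq simp: A.smult_mult_left A.smult_mult_right)
  show "h \<in> algebra_hom K Q A"
    by (auto simp: algebra_hom_def ring_hom_def)
qed

text \<open>Clauses (2) and (3) of a left monomial ordering for an arbitrary operation
  \<open>m\<close>. The product and the opposite product give the left and the right version, so
  each argument is made once.\<close>

definition ordering_compatible ::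
    "('k, 'm) ring_scheme \<Rightarrow> ('k, 'a, 's) module_scheme \<Rightarrow> 'a set \<Rightarrow> 'a rel
      \<Rightarrow> ('a \<Rightarrow> 'a \<Rightarrow> 'a) \<Rightarrow> bool" where
  "ordering_compatible K A B r m \<longleftrightarrow>
    (\<forall>w\<in>B. \<forall>u\<in>B. \<forall>v\<in>B.
      (u, v) \<in> r - Id \<and> LM K A B r (m w u) \<notin> scalars K A \<and> LM K A B r (m w v) \<notin> scalars K A
      \<longrightarrow> (LM K A B r (m w u), LM K A B r (m w v)) \<in> r - Id) \<and>
    (\<forall>w\<in>B. \<forall>u\<in>B. \<forall>v\<in>B. v \<noteq> w \<and> w = LM K A B r (m u v) \<longrightarrow> (v, w) \<in> r - Id)"

lemma monomial_ordering_alt: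
  "monomial_ordering K A B r \<longleftrightarrow> well_order_on B r \<and>
    ordering_compatible K A B r (\<lambda>x y. x \<otimes>\<^bsub>A\<^esub> y) \<and> ordering_compatible K A B r (\<lambda>x y. y \<otimes>\<^bsub>A\<^esub> x)"
  unfolding monomial_ordering_def left_monomial_ordering_def right_monomial_ordering_def
    ordering_compatible_def by blast

section \<open>Transport of bases, leading monomials and orderings along an isomorphism\<close>

locale algebra_isomorphism = algebra_homomorphism +
  assumes bij: "bij_betw h (carrier A) (carrier B)"
begin

lemma hom_eq_iff: "x \<in> carrier A \<Longrightarrow> y \<in> carrier A \<Longrightarrow> h x = h y \<longleftrightarrow> x = y"
  using bij by (auto simp: bij_betw_def inj_on_def)

text \<open>Transport is needed both ways: the ordering of condition (b) moves from the quotient to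
  \<open>A\<close>, the ordering of a solvable algebra from \<open>A\<close> to the
  quotient.\<close>

lemma inverse_isomorphism: "algebra_isomorphism K B A (inv_into (carrier A) h)"
proof -
  let ?g = "inv_into (carrier A) h"
  have g: "?g y \<in> carrier A" "h (?g y) = y" if "y \<in> carrier B" for y
    using that bij by (auto simp: bij_betw_def inv_into_into f_inv_into_f)
  have eqI: "?g y = x" if "y = h x" "x \<in> carrier A" for x y
    using that bij by (simp add: bij_betw_def inv_into_f_f)
  have "?g \<in> algebra_hom K B A"
    unfolding algebra_hom_def ring_hom_def using g by (auto intro!: eqI)
  moreover have "bij_betw ?g (carrier B) (carrier A)"
    using bij by (rule bij_betw_inv_into)
  ultimately show ?thesis
    by unfold_locales
qed

context
  fixes S
  assumes S: "is_basis K A S"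
begin

interpretation AS: vector_space_basis K A S
  by (rule assoc_algebra_vector_space_basis[OF A.assoc_algebra_axioms S])

lemma inj_on_basis: "inj_on h S"
  using AS.basis_closed by (auto simp: inj_on_def hom_eq_iff)

lemma basis_image: "is_basis K B (h ` S)"
proof -
  have "S \<subseteq> carrier A" by auto
  moreover have "lin_indep K A S" "lin_span K A S = carrier A"
    using S by (auto simp: is_basis_def)
  ultimately show ?thesis
    unfolding is_basis_def using hom_lin_span[OF _ inj_on_basis] hom_lin_indep(2)[of S] bij
      hom_eq_iff[of _ "\<zero>\<^bsub>A\<^esub>"]
    by (auto simp: bij_betw_def)
qed

interpretation BS: vector_space_basis K B "h ` S"
  by (rule assoc_algebra_vector_space_basis[OF B.assoc_algebra_axioms basis_image])

text \<open>Both sides are linear in \<open>f\<close> and agree on basis elements.\<close>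

lemma coeff_image:
  assumes "f \<in> carrier A" "s \<in> S"
  shows "basis_coeff K B (h ` S) (h f) (h s) = basis_coeff K A S f s"
proof -
  let ?N = "{f \<in> carrier A. BS.coef (h f) (h s) = AS.coef f s}"
  have "f \<in> ?N"
  proof (rule AS.supp_induct[OF assms(1)])
    fix c b assume "c \<in> carrier K" "b \<in> S"
    moreover from this have "h s = h b \<longleftrightarrow> s = b" using assms by (simp add: hom_eq_iff)
    ultimately show "c \<odot>\<^bsub>A\<^esub> b \<in> ?N"
      using assms by (simp add: AS.coeff_smult BS.coeff_smult AS.coeff_basis BS.coeff_basis)
  qed (auto simp: AS.coeff_add BS.coeff_add)
  then show ?thesis by simp
qed

context
  fixes r
  assumes r: "well_order_on S r"
begin

interpretation AS: ordered_basis K A S r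
  by (rule assoc_algebra_ordered_basis[OF A.assoc_algebra_axioms S well_order_on_linear[OF r]])

lemma order_image: "well_order_on (h ` S) (dir_image r h)"
  using r inj_on_basis Well_order_dir_image[of r h] dir_image_Field[of r h] well_order_on_Field[OF r]
  by metis

interpretation BS: ordered_basis K B "h ` S" "dir_image r h"
  by (rule assoc_algebra_ordered_basis[OF B.assoc_algebra_axioms basis_image
        well_order_on_linear[OF order_image]])

lemma strict_order_image:
  assumes "x \<in> S" "y \<in> S"
  shows "(h x, h y) \<in> dir_image r h - Id \<longleftrightarrow> (x, y) \<in> r - Id"
proof -
  have "x' = x" if "h x = h x'" "x \<in> S" "x' \<in> S" for x x'
    using that by (simp add: hom_eq_iff)
  then show ?thesis
    using assms AS.order_field unfolding dir_image_def by blast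
qed

lemma LM_image:
  assumes "f \<in> carrier A" shows "LM K B (h ` S) (dir_image r h) (h f) = h (LM K A S r f)"
proof (cases "f = \<zero>\<^bsub>A\<^esub>")
  case False
  note p = AS.LM_props[OF assms False]
  show ?thesis
  proof (rule BS.LM_eqI)
    show "BS.coef (h f) (h (AS.LMA f)) \<noteq> \<zero>\<^bsub>K\<^esub>" using p assms by (simp add: coeff_image)
    fix x assume x: "BS.coef (h f) x \<noteq> \<zero>\<^bsub>K\<^esub>"
    then obtain s where "x = h s" "s \<in> S" using BS.coeff_outside assms by blast
    with x have "(s, AS.LMA f) \<in> r" using p assms by (simp add: coeff_image)
    with \<open>x = h s\<close> show "(x, h (AS.LMA f)) \<in> dir_image r h" by (auto simp: dir_image_def)
  qed (use assms in simp)
qed simp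

lemma LM_closed: "f \<in> carrier A \<Longrightarrow> AS.LMA f \<in> carrier A"
  using AS.LM_props(3) by (cases "f = \<zero>\<^bsub>A\<^esub>") auto

lemma scalars_image: "x \<in> carrier A \<Longrightarrow> h x \<in> scalars K B \<longleftrightarrow> x \<in> scalars K A"
proof -
  assume x: "x \<in> carrier A"
  have "h x = c \<odot>\<^bsub>B\<^esub> \<one>\<^bsub>B\<^esub> \<longleftrightarrow> x = c \<odot>\<^bsub>A\<^esub> \<one>\<^bsub>A\<^esub>" if "c \<in> carrier K" for c
    using hom_eq_iff[OF x, of "c \<odot>\<^bsub>A\<^esub> \<one>\<^bsub>A\<^esub>"] that by simp
  then show ?thesis by (auto simp: scalars_def)
qed

lemma ordering_compatible_image:
  assumes "ordering_compatible K A S r m"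
    and m: "\<And>x y. x \<in> S \<Longrightarrow> y \<in> S \<Longrightarrow> m x y \<in> carrier A"
    and m': "\<And>x y. x \<in> S \<Longrightarrow> y \<in> S \<Longrightarrow> h (m x y) = m' (h x) (h y)"
  shows "ordering_compatible K B (h ` S) (dir_image r h) m'"
proof -
  let ?L = "LM K B (h ` S) (dir_image r h)"
  have L: "?L (m' (h x) (h y)) = h (AS.LMA (m x y))" if "x \<in> S" "y \<in> S" for x y
    using LM_image[OF m[OF that]] m'[OF that] by simp
  have sc: "?L (m' (h x) (h y)) \<in> scalars K B \<longleftrightarrow> AS.LMA (m x y) \<in> scalars K A"
    if "x \<in> S" "y \<in> S" for x y
    unfolding L[OF that] using LM_closed[OF m[OF that]] by (rule scalars_image)
  \<comment> \<open>A vanishing product has \<open>LM\<close> equal to zero, which is a scalar; the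
    exclusion in clause (2) thus guarantees that the leading monomial is a basis element.\<close>
  have LM_S: "AS.LMA (m x y) \<in> S" if "AS.LMA (m x y) \<notin> scalars K A" "x \<in> S" "y \<in> S" for x y
  proof (rule AS.LM_props(3))
    have "\<zero>\<^bsub>A\<^esub> \<in> scalars K A"
      using A.smult_l_null[OF A.A.one_closed] A.R.zero_closed unfolding scalars_def by force
    then show "m x y \<noteq> \<zero>\<^bsub>A\<^esub>" using that(1) by force
  qed (rule m[OF that(2,3)])
  have mono: "(AS.LMA (m w u), AS.LMA (m w v)) \<in> r - Id"
    if "w \<in> S" "u \<in> S" "v \<in> S" "(u, v) \<in> r - Id"
      "AS.LMA (m w u) \<notin> scalars K A" "AS.LMA (m w v) \<notin> scalars K A" for w u v
    using assms(1) that unfolding ordering_compatible_def by blast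
  have greater: "(v, w) \<in> r - Id"
    if "w \<in> S" "u \<in> S" "v \<in> S" "v \<noteq> w" "w = AS.LMA (m u v)" for w u v
    using assms(1) that unfolding ordering_compatible_def by blast
  show ?thesis
    unfolding ordering_compatible_def
  proof (intro conjI ballI impI; elim imageE; hypsubst)
    fix w u v assume S: "w \<in> S" "u \<in> S" "v \<in> S"
    assume *: "(h u, h v) \<in> dir_image r h - Id \<and>
      ?L (m' (h w) (h u)) \<notin> scalars K B \<and> ?L (m' (h w) (h v)) \<notin> scalars K B"
    then have "(AS.LMA (m w u), AS.LMA (m w v)) \<in> r - Id"
      using S strict_order_image by (intro mono) (simp_all only: sc simp_thms)
    moreover have "AS.LMA (m w u) \<in> S" "AS.LMA (m w v) \<in> S"
      using * S LM_S by (simp_all only: sc simp_thms)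
    ultimately show "(?L (m' (h w) (h u)), ?L (m' (h w) (h v))) \<in> dir_image r h - Id"
      using S by (simp only: L strict_order_image)
  next
    fix w u v assume S: "w \<in> S" "u \<in> S" "v \<in> S"
    assume *: "h v \<noteq> h w \<and> h w = ?L (m' (h u) (h v))"
    then have "w = AS.LMA (m u v)"
      unfolding L[OF S(2,3)]
      using hom_eq_iff[OF AS.basis_closed[OF S(1)] LM_closed[OF m[OF S(2,3)]]] by blast
    then have "(v, w) \<in> r - Id" using * by (intro greater[OF S]) auto
    then show "(h v, h w) \<in> dir_image r h - Id"
      unfolding strict_order_image[OF S(3,1)] .
  qed
qed

lemma monomial_ordering_image:
  assumes "monomial_ordering K A S r"
  shows "monomial_ordering K B (h ` S) (dir_image r h)"
proof -
  show ?thesis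
    using assms unfolding monomial_ordering_alt
    by (intro conjI order_image; elim conjE)
      (rule ordering_compatible_image, assumption, (simp; fail)+)+
qed

end

end

lemma has_pbw_basis_image:
  assumes "has_pbw_basis K A n x" "x ` {1..n} \<subseteq> carrier A" "\<And>i. i \<in> {1..n} \<Longrightarrow> h (x i) = y i"
  shows "has_pbw_basis K B n y"
proof -
  have "is_basis K A (ordered_monomials A n x)" and inj: "inj_on (ordered_monomial A n x) (exponents n)"
    using assms(1) by (auto simp: has_pbw_basis_def)
  then have "is_basis K B (ordered_monomials B n y)"
    using basis_image hom_ordered_monomials[OF assms(2,3)] by metis
  moreover have "inj_on (ordered_monomial B n y) (exponents n)"
  proof (rule inj_onI)
    fix \<alpha> \<beta> assume *: "\<alpha> \<in> exponents n" "\<beta> \<in> exponents n"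
      "ordered_monomial B n y \<alpha> = ordered_monomial B n y \<beta>"
    then have "ordered_monomial A n x \<alpha> = ordered_monomial A n x \<beta>"
      using hom_ordered_monomial[OF assms(2,3)] hom_eq_iff by metis
    then show "\<alpha> = \<beta>" using inj * by (simp add: inj_on_eq_iff)
  qed
  ultimately show ?thesis by (simp add: has_pbw_basis_def)
qed

end

section \<open>Presentations and normal forms\<close>

locale algebra_presentation = free_algebra_field K n +
    P: algebra_homomorphism K "free_algebra K n" A \<pi>
  for K :: "('k, 'm) ring_scheme" (structure) and n :: nat
    and A :: "('k, 'a, 's) module_scheme" (structure) and \<pi> :: "(nat list \<Rightarrow> 'k) \<Rightarrow> 'a" +
  fixes a :: "nat \<Rightarrow> 'a"
  assumes surj: "\<pi> ` carrier (free_algebra K n) = carrier A"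
    and generators: "\<And>i. i \<in> {1..n} \<Longrightarrow> \<pi> (free_generator K i) = a i"
begin

definition "I = a_kernel F A \<pi>"

abbreviation "Q \<equiv> quotient_algebra F I"
abbreviation "x\<^sub>Q \<equiv> coset_generator K n I"

lemma kernel_iff: "f \<in> I \<longleftrightarrow> f \<in> carrier F \<and> \<pi> f = \<zero>\<^bsub>A\<^esub>"
  by (simp add: I_def a_kernel_def')

text \<open>The cosets of the kernel are the fibres of \<open>\<pi>\<close>, so every computation
  with cosets becomes an equation in \<open>A\<close>.\<close>

lemma coset_eq:
  assumes "x \<in> carrier F" shows "I +>\<^bsub>F\<^esub> x = {y \<in> carrier F. \<pi> y = \<pi> x}"
proof (intro equalityI subsetI)
  fix y assume "y \<in> I +>\<^bsub>F\<^esub> x"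
  then obtain z where "z \<in> I" "y = z \<oplus>\<^bsub>F\<^esub> x" by (auto simp: a_r_coset_def')
  then show "y \<in> {y \<in> carrier F. \<pi> y = \<pi> x}" using assms by (simp add: kernel_iff)
next
  fix y assume "y \<in> {y \<in> carrier F. \<pi> y = \<pi> x}"
  then have y: "y \<in> carrier F" "\<pi> y = \<pi> x" by auto
  then have "y \<ominus>\<^bsub>F\<^esub> x \<in> I"
    using assms by (simp add: kernel_iff P.B.M.minus_eq P.B.M.r_neg)
  moreover have "y = (y \<ominus>\<^bsub>F\<^esub> x) \<oplus>\<^bsub>F\<^esub> x"
    using assms y by (simp add: F.M.minus_eq F.M.a_assoc F.M.l_neg)
  ultimately show "y \<in> I +>\<^bsub>F\<^esub> x" by (auto simp: a_r_coset_def')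
qed

lemma coset_mem: "x \<in> carrier F \<Longrightarrow> x \<in> I +>\<^bsub>F\<^esub> x"
  by (simp add: coset_eq)

lemma coset_cong: "x \<in> carrier F \<Longrightarrow> y \<in> carrier F \<Longrightarrow> \<pi> x = \<pi> y \<Longrightarrow> I +>\<^bsub>F\<^esub> x = I +>\<^bsub>F\<^esub> y"
  by (simp add: coset_eq)

lemma quotient_carrier: "carrier Q = (\<lambda>x. I +>\<^bsub>F\<^esub> x) ` carrier F"
  by (auto simp: quotient_algebra_def FactRing_def A_RCOSETS_def')

lemma union_cosets:
  assumes "S \<noteq> {}" "\<And>x. x \<in> S \<Longrightarrow> f x = T" shows "(\<Union>x\<in>S. f x) = T"
  using assms by blast

text \<open>The product of cosets is a union over representatives; all members of the union coincide
  because \<open>\<pi>\<close> is multiplicative.\<close>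

lemma quotient_mult:
  assumes "x \<in> carrier F" "y \<in> carrier F"
  shows "(I +>\<^bsub>F\<^esub> x) \<otimes>\<^bsub>Q\<^esub> (I +>\<^bsub>F\<^esub> y) = I +>\<^bsub>F\<^esub> (x \<otimes>\<^bsub>F\<^esub> y)"
proof -
  have "(\<Union>x'\<in>I +>\<^bsub>F\<^esub> x. \<Union>y'\<in>I +>\<^bsub>F\<^esub> y. I +>\<^bsub>F\<^esub> (x' \<otimes>\<^bsub>F\<^esub> y')) = I +>\<^bsub>F\<^esub> (x \<otimes>\<^bsub>F\<^esub> y)"
  proof (intro union_cosets)
    fix x' y' assume "x' \<in> I +>\<^bsub>F\<^esub> x" "y' \<in> I +>\<^bsub>F\<^esub> y"
    then have "x' \<in> carrier F" "\<pi> x' = \<pi> x" "y' \<in> carrier F" "\<pi> y' = \<pi> y"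
      using assms by (auto simp: coset_eq)
    then show "I +>\<^bsub>F\<^esub> (x' \<otimes>\<^bsub>F\<^esub> y') = I +>\<^bsub>F\<^esub> (x \<otimes>\<^bsub>F\<^esub> y)"
      using assms by (intro coset_cong) auto
  qed (use coset_mem assms in blast)+
  then show ?thesis by (simp add: quotient_algebra_def FactRing_def rcoset_mult_def)
qed

lemma quotient_smult:
  assumes "c \<in> carrier K" "x \<in> carrier F"
  shows "c \<odot>\<^bsub>Q\<^esub> (I +>\<^bsub>F\<^esub> x) = I +>\<^bsub>F\<^esub> (c \<odot>\<^bsub>F\<^esub> x)"
proof -
  have "(\<Union>x'\<in>I +>\<^bsub>F\<^esub> x. I +>\<^bsub>F\<^esub> (c \<odot>\<^bsub>F\<^esub> x')) = I +>\<^bsub>F\<^esub> (c \<odot>\<^bsub>F\<^esub> x)"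
  proof (intro union_cosets)
    fix x' assume "x' \<in> I +>\<^bsub>F\<^esub> x"
    then have "x' \<in> carrier F" "\<pi> x' = \<pi> x" using assms by (auto simp: coset_eq)
    then show "I +>\<^bsub>F\<^esub> (c \<odot>\<^bsub>F\<^esub> x') = I +>\<^bsub>F\<^esub> (c \<odot>\<^bsub>F\<^esub> x)"
      using assms by (intro coset_cong) auto
  qed (use coset_mem assms in blast)
  then show ?thesis by (simp add: quotient_algebra_def)
qed

text \<open>A sum of cosets is the set of sums of elements rather than a union of cosets, so each
  element \<open>z\<close> of the right side has to be split, as \<open>(z - y) + y\<close>.\<close>

lemma quotient_add:
  assumes "x \<in> carrier F" "y \<in> carrier F"
  shows "(I +>\<^bsub>F\<^esub> x) \<oplus>\<^bsub>Q\<^esub> (I +>\<^bsub>F\<^esub> y) = I +>\<^bsub>F\<^esub> (x \<oplus>\<^bsub>F\<^esub> y)"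
proof -
  have "(\<Union>x'\<in>I +>\<^bsub>F\<^esub> x. \<Union>y'\<in>I +>\<^bsub>F\<^esub> y. {x' \<oplus>\<^bsub>F\<^esub> y'}) = I +>\<^bsub>F\<^esub> (x \<oplus>\<^bsub>F\<^esub> y)" (is "?L = _")
  proof (intro equalityI subsetI)
    fix z assume "z \<in> ?L"
    then obtain x' y' where "x' \<in> carrier F" "\<pi> x' = \<pi> x" "y' \<in> carrier F" "\<pi> y' = \<pi> y"
      "z = x' \<oplus>\<^bsub>F\<^esub> y'"
      using assms by (auto simp: coset_eq)
    then show "z \<in> I +>\<^bsub>F\<^esub> (x \<oplus>\<^bsub>F\<^esub> y)" using assms by (simp add: coset_eq)
  next
    fix z assume "z \<in> I +>\<^bsub>F\<^esub> (x \<oplus>\<^bsub>F\<^esub> y)"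
    then have z: "z \<in> carrier F" "\<pi> z = \<pi> x \<oplus>\<^bsub>A\<^esub> \<pi> y" using assms by (auto simp: coset_eq)
    then have "\<pi> (z \<ominus>\<^bsub>F\<^esub> y) = \<pi> x"
      using assms by (simp add: P.B.M.minus_eq P.B.M.a_assoc P.B.M.r_neg)
    then have "z \<ominus>\<^bsub>F\<^esub> y \<in> I +>\<^bsub>F\<^esub> x" using assms z by (simp add: coset_eq)
    moreover have "z = (z \<ominus>\<^bsub>F\<^esub> y) \<oplus>\<^bsub>F\<^esub> y"
      using assms z by (simp add: F.M.minus_eq F.M.a_assoc F.M.l_neg)
    ultimately show "z \<in> ?L" using coset_mem[OF assms(2)] by blast
  qed
  then show ?thesis
    by (simp add: quotient_algebra_def FactRing_def set_add_def set_mult_def)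
qed

lemma quotient_one: "\<one>\<^bsub>Q\<^esub> = I +>\<^bsub>F\<^esub> \<one>\<^bsub>F\<^esub>"
  by (simp add: quotient_algebra_def FactRing_def)

lemma quotient_zero: "\<zero>\<^bsub>Q\<^esub> = I +>\<^bsub>F\<^esub> \<zero>\<^bsub>F\<^esub>"
proof -
  have "\<zero>\<^bsub>Q\<^esub> = I" by (simp add: quotient_algebra_def FactRing_def)
  also have "\<dots> = I +>\<^bsub>F\<^esub> \<zero>\<^bsub>F\<^esub>" unfolding coset_eq[OF F.M.zero_closed] by (auto simp: kernel_iff)
  finally show ?thesis .
qed

text \<open>\<open>\<pi>\<close> is constant on a coset, so its image is a singleton and
  \<open>the_elem\<close> reads off the induced map.\<close>

definition \<phi> :: "(nat list \<Rightarrow> 'k) set \<Rightarrow> 'a" where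
  "\<phi> S = the_elem (\<pi> ` S)"

lemma phi_coset [simp]: "x \<in> carrier F \<Longrightarrow> \<phi> (I +>\<^bsub>F\<^esub> x) = \<pi> x"
proof -
  assume x: "x \<in> carrier F"
  have "\<pi> ` (I +>\<^bsub>F\<^esub> x) = {\<pi> x}" unfolding coset_eq[OF x] using x by blast
  then show ?thesis by (simp add: \<phi>_def)
qed

lemma phi_bij: "bij_betw \<phi> (carrier Q) (carrier A)"
proof (rule bij_betw_imageI)
  show "inj_on \<phi> (carrier Q)"
    unfolding quotient_carrier
  proof (rule inj_onI, elim imageE, hypsubst)
    fix x y assume "x \<in> carrier F" "y \<in> carrier F" "\<phi> (I +>\<^bsub>F\<^esub> x) = \<phi> (I +>\<^bsub>F\<^esub> y)"
    then show "I +>\<^bsub>F\<^esub> x = I +>\<^bsub>F\<^esub> y" by (intro coset_cong) auto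
  qed
  show "\<phi> ` carrier Q = carrier A"
    unfolding quotient_carrier image_image surj[symmetric] by (intro image_cong) auto
qed

lemma quotient_isomorphism: "algebra_isomorphism K Q A \<phi>"
proof -
  have "assoc_algebra K Q" "\<phi> \<in> algebra_hom K Q A"
    by (rule assoc_algebra_pullback[OF P.B.assoc_algebra_axioms phi_bij];
        force simp: quotient_carrier quotient_mult quotient_add quotient_smult quotient_one
          quotient_zero)+
  then show ?thesis
    by (simp add: algebra_isomorphism_def algebra_homomorphism_def P.B.assoc_algebra_axioms
        algebra_homomorphism_axioms_def algebra_isomorphism_axioms_def phi_bij)
qed

sublocale Q: algebra_isomorphism K Q A \<phi>
  by (rule quotient_isomorphism)

abbreviation "words \<equiv> lists {1..n}"
abbreviation "ev w \<equiv> \<pi> (XW w)"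

lemma generator_words: "i \<in> {1..n} \<Longrightarrow> [i] \<in> words"
  by simp

lemma free_generator_closed: "i \<in> {1..n} \<Longrightarrow> free_generator K i \<in> carrier F"
  unfolding free_generator_def by (intro word_closed generator_words)

lemma coset_generator_closed: "i \<in> {1..n} \<Longrightarrow> x\<^sub>Q i \<in> carrier Q"
  unfolding quotient_carrier coset_generator_def by (intro imageI free_generator_closed)

lemma phi_generator: "i \<in> {1..n} \<Longrightarrow> \<phi> (x\<^sub>Q i) = a i"
  using phi_coset[OF free_generator_closed] generators by (simp add: coset_generator_def)

lemma ev_closed [simp]: "w \<in> words \<Longrightarrow> ev w \<in> carrier A"
  using P.hom_closed word_closed by blast

lemma ev_append: "u \<in> words \<Longrightarrow> v \<in> words \<Longrightarrow> ev (u @ v) = ev u \<otimes>\<^bsub>A\<^esub> ev v"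
  unfolding word_mult[symmetric] by (rule P.hom_mult[OF word_closed word_closed])

lemma ev_Nil: "ev [] = \<one>\<^bsub>A\<^esub>"
  using P.hom_one by (simp add: free_selectors)

lemma ev_single: "i \<in> {1..n} \<Longrightarrow> ev [i] = a i"
  using generators by (simp add: free_generator_def)

lemma ordered_monomial_ev: "ordered_monomial A n a \<alpha> = ev (word_of n \<alpha>)"
proof -
  have "free_generator K ` {1..n} \<subseteq> carrier F" using free_generator_closed by blast
  from P.hom_ordered_monomial(2)[OF this generators, of \<alpha>] show ?thesis
    by (simp add: free_ordered_monomial)
qed

lemma sorted_words: "word_of n ` exponents n = {w \<in> words. sorted w}"
proof (intro equalityI subsetI)
  fix w assume "w \<in> {w \<in> words. sorted w}"
  then have "w = word_of n (count_list w)" "count_list w \<in> exponents n"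
    using word_of_count_list[of w n] count_list_exponents[of w n] by auto
  then show "w \<in> word_of n ` exponents n" by blast
next
  fix w assume "w \<in> word_of n ` exponents n"
  then show "w \<in> {w \<in> words. sorted w}" using word_of_lists sorted_word_of by blast
qed

abbreviation "pbw \<equiv> ordered_monomials A n a"

lemma pbw_eq: "pbw = ev ` {w \<in> words. sorted w}"
  unfolding ordered_monomials_def ordered_monomial_ev sorted_words[symmetric] image_image ..

lemma word_of_inj: "inj_on (word_of n) (exponents n)"
  by (rule inj_on_inverseI[of _ count_list]) (rule count_list_word_of)

lemma has_pbw_basis_iff:
  "has_pbw_basis K A n a \<longleftrightarrow> inj_on ev {w \<in> words. sorted w} \<and> is_basis K A pbw"
proof -
  have "ordered_monomial A n a = ev \<circ> word_of n" by (simp add: fun_eq_iff ordered_monomial_ev)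
  then show ?thesis
    unfolding has_pbw_basis_def sorted_words[symmetric]
    using comp_inj_on_iff[OF word_of_inj, of ev] by simp
qed

text \<open>The candidates for canonical representatives modulo \<open>I\<close>: the PBW property
  says that this space and \<open>I\<close> are complementary in the free algebra.\<close>

definition normal_forms :: "(nat list \<Rightarrow> 'k) set" where
  "normal_forms = {f \<in> carrier F. \<forall>w. f w \<noteq> \<zero>\<^bsub>K\<^esub> \<longrightarrow> sorted w}"

abbreviation "sorted_basis \<equiv> XW ` {w \<in> words. sorted w}"

lemma normal_forms_add:
  assumes "f \<in> normal_forms" "g \<in> normal_forms" shows "f \<oplus>\<^bsub>F\<^esub> g \<in> normal_forms"
proof -
  have "f w \<noteq> \<zero>\<^bsub>K\<^esub> \<or> g w \<noteq> \<zero>\<^bsub>K\<^esub>" if "f w \<oplus>\<^bsub>K\<^esub> g w \<noteq> \<zero>\<^bsub>K\<^esub>" for w using that by auto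
  then show ?thesis
    using assms F.M.a_closed[of f g] unfolding normal_forms_def free_selectors(4) by blast
qed

lemma normal_forms_smult:
  assumes "c \<in> carrier K" "f \<in> normal_forms" shows "c \<odot>\<^bsub>F\<^esub> f \<in> normal_forms"
proof -
  have "f w \<noteq> \<zero>\<^bsub>K\<^esub>" if "c \<otimes>\<^bsub>K\<^esub> f w \<noteq> \<zero>\<^bsub>K\<^esub>" for w using that assms by auto
  then show ?thesis
    using assms free_smult_closed[of c f] unfolding normal_forms_def free_selectors(5) by blast
qed

lemma normal_forms_zero: "\<zero>\<^bsub>F\<^esub> \<in> normal_forms"
  using F.M.zero_closed by (simp add: normal_forms_def free_selectors(3))

lemma normal_forms_word: "w \<in> words \<Longrightarrow> sorted w \<Longrightarrow> XW w \<in> normal_forms"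
  using word_closed unfolding normal_forms_def by (auto simp: word_monomial_def)

lemma sorted_basis_subset: "sorted_basis \<subseteq> free_basis K n"
  by (auto simp: free_basis_def)

lemma lin_span_sorted: "lin_span K F sorted_basis = normal_forms"
proof (intro equalityI subsetI)
  fix f assume "f \<in> lin_span K F sorted_basis"
  then obtain S c where S: "finite S" "S \<subseteq> sorted_basis" "c \<in> S \<rightarrow> carrier K"
    and f: "f = (\<Oplus>\<^bsub>F\<^esub>b\<in>S. c b \<odot>\<^bsub>F\<^esub> b)"
    unfolding lin_span_def by blast
  have SB: "S \<subseteq> free_basis K n" using S(2) sorted_basis_subset by blast
  have "f \<in> carrier F"
    unfolding f using SB FB.basis_closed S(3) by (intro F.M.finsum_closed Pi_I free_smult_closed) blast+
  moreover have "sorted w" if "f w \<noteq> \<zero>\<^bsub>K\<^esub>" for w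
  proof -
    have "XW w \<in> S" using that free_combination_apply[OF S(1) SB S(3)] f by metis
    with S(2) have "XW w \<in> sorted_basis" by (rule subsetD)
    then show ?thesis by (elim imageE) (simp add: word_inj)
  qed
  ultimately show "f \<in> normal_forms" by (simp add: normal_forms_def)
next
  fix f assume "f \<in> normal_forms"
  then have f: "f \<in> carrier F" "\<And>w. f w \<noteq> \<zero>\<^bsub>K\<^esub> \<Longrightarrow> sorted w" by (auto simp: normal_forms_def)
  let ?c = "basis_coeff K F (free_basis K n) f"
  note c = FB.representsD[OF FB.represents_coeff[OF f(1)]]
  have "{b. ?c b \<noteq> \<zero>\<^bsub>K\<^esub>} \<subseteq> sorted_basis"
  proof
    fix b assume b: "b \<in> {b. ?c b \<noteq> \<zero>\<^bsub>K\<^esub>}"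
    then obtain w where w: "w \<in> words" "b = XW w" using c(4) by (auto simp: free_basis_def)
    then have "f w \<noteq> \<zero>\<^bsub>K\<^esub>" using free_coeff[OF f(1) w(1)] b by simp
    then show "b \<in> sorted_basis" using w f(2) by blast
  qed
  then have "(\<Oplus>\<^bsub>F\<^esub>b\<in>{b. ?c b \<noteq> \<zero>\<^bsub>K\<^esub>}. ?c b \<odot>\<^bsub>F\<^esub> b) \<in> lin_span K F sorted_basis"
    by (intro lin_spanI c(3) Pi_I c(1))
  then show "f \<in> lin_span K F sorted_basis" using FB.coeff_sum[OF f(1)] by simp
qed

text \<open>The premises say that normal forms meet \<open>I\<close> trivially and that each word is
  congruent to one of them. Linearity extends the latter to the whole free algebra, so
  \<open>\<pi>\<close> carries the sorted words injectively onto a basis.\<close>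

lemma has_pbw_basis_if_normal_forms:
  assumes indep: "\<And>f. f \<in> normal_forms \<Longrightarrow> \<pi> f = \<zero>\<^bsub>A\<^esub> \<Longrightarrow> f = \<zero>\<^bsub>F\<^esub>"
    and span: "\<And>w. w \<in> words \<Longrightarrow> \<exists>f\<in>normal_forms. \<pi> f = ev w"
  shows "has_pbw_basis K A n a"
proof -
  have closed: "sorted_basis \<subseteq> carrier F"
    using sorted_basis_subset FB.basis_closed by blast
  have "lin_indep K F (free_basis K n)" using free_is_basis by (simp add: is_basis_def)
  then have li: "lin_indep K F sorted_basis"
    using sorted_basis_subset by (rule lin_indep_subset)
  have h: "inj_on \<pi> sorted_basis" "lin_indep K A (\<pi> ` sorted_basis)"
    by (rule P.hom_lin_indep[OF closed li]; simp only: lin_span_sorted indep)+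
  have "\<pi> ` normal_forms = carrier A"
  proof (intro equalityI subsetI)
    fix y assume "y \<in> \<pi> ` normal_forms"
    then show "y \<in> carrier A" using P.hom_closed by (auto simp: normal_forms_def)
  next
    fix y assume "y \<in> carrier A"
    then obtain g where g: "g \<in> carrier F" "y = \<pi> g" unfolding surj[symmetric] by blast
    let ?N = "{g \<in> carrier F. \<exists>f\<in>normal_forms. \<pi> f = \<pi> g}"
    have nf: "f \<in> carrier F" if "f \<in> normal_forms" for f using that by (simp add: normal_forms_def)
    have "g \<in> ?N"
    proof (rule FB.supp_induct[OF g(1)])
      show "\<zero>\<^bsub>F\<^esub> \<in> ?N" using normal_forms_zero F.M.zero_closed by blast
    next
      fix x y assume "x \<in> ?N" "y \<in> ?N"
      then obtain f f' where "f \<in> normal_forms" "\<pi> f = \<pi> x" "f' \<in> normal_forms" "\<pi> f' = \<pi> y"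
        "x \<in> carrier F" "y \<in> carrier F" by blast
      then have "\<pi> (f \<oplus>\<^bsub>F\<^esub> f') = \<pi> (x \<oplus>\<^bsub>F\<^esub> y)" "x \<oplus>\<^bsub>F\<^esub> y \<in> carrier F" "f \<oplus>\<^bsub>F\<^esub> f' \<in> normal_forms"
        using nf normal_forms_add by simp_all
      then show "x \<oplus>\<^bsub>F\<^esub> y \<in> ?N" by blast
    next
      fix c b assume c: "c \<in> carrier K" and b: "b \<in> free_basis K n"
      then obtain w where w: "w \<in> words" "b = XW w" by (auto simp: free_basis_def)
      obtain f where "f \<in> normal_forms" "\<pi> f = ev w" using span[OF w(1)] by blast
      then have "\<pi> (c \<odot>\<^bsub>F\<^esub> f) = \<pi> (c \<odot>\<^bsub>F\<^esub> b)" "c \<odot>\<^bsub>F\<^esub> f \<in> normal_forms" "c \<odot>\<^bsub>F\<^esub> b \<in> carrier F"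
        using c nf normal_forms_smult FB.basis_closed[OF b] w by simp_all
      then show "c \<odot>\<^bsub>F\<^esub> b \<in> ?N" by blast
    qed blast
    then obtain f where "f \<in> normal_forms" "\<pi> f = y" using g(2) by blast
    then show "y \<in> \<pi> ` normal_forms" by blast
  qed
  then have "lin_span K A (\<pi> ` sorted_basis) = carrier A"
    unfolding P.hom_lin_span[OF closed h(1)] lin_span_sorted .
  moreover have "\<pi> ` sorted_basis \<subseteq> carrier A" using P.hom_closed closed by blast
  ultimately have "is_basis K A (\<pi> ` sorted_basis)" using h(2) by (simp only: is_basis_def simp_thms)
  then have "is_basis K A pbw" by (simp only: pbw_eq image_image)
  moreover have "inj_on ev {w \<in> words. sorted w}"
  proof -
    have "inj_on XW {w \<in> words. sorted w}" by (simp add: inj_on_def word_inj)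
    from comp_inj_on[OF this h(1)] show ?thesis by (simp add: comp_def)
  qed
  ultimately show ?thesis by (simp add: has_pbw_basis_iff)
qed

lemma relator_generators:
  assumes "1 \<le> i" "i < j" "j \<le> n"
  shows "[i, j] \<in> words" "[j, i] \<in> words" "[i] \<in> words" "[j] \<in> words"
  using assms by auto

lemma free_generator_mult:
  "free_generator K j \<otimes>\<^bsub>F\<^esub> free_generator K i = XW [j, i]"
  by (simp add: free_generator_def word_mult)

section \<open>Condition (a): existence and uniqueness of normal forms\<close>

context
  fixes r l m
  assumes cond_a: "condition_a K n I r l m"
begin

lemma free_order: "well_order_on (free_basis K n) r"
  using cond_a by (simp add: condition_a_def free_monomial_ordering_def Let_def)

interpretation FO: ordered_basis K F "free_basis K n" r
  by (rule assoc_algebra_ordered_basis[OF free_assoc_algebra free_is_basis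
        well_order_on_linear[OF free_order]])

lemma word_in_basis: "w \<in> words \<Longrightarrow> XW w \<in> free_basis K n"
  unfolding free_basis_def by (rule imageI)

lemma free_order_mult:
  assumes "(XW u, XW v) \<in> r - Id" "u \<in> words" "v \<in> words" "x \<in> words" "y \<in> words"
  shows "(XW (x @ u @ y), XW (x @ v @ y)) \<in> r - Id"
proof -
  have fo: "\<forall>w\<in>free_basis K n. \<forall>u\<in>free_basis K n. \<forall>v\<in>free_basis K n. (u, v) \<in> r - Id \<longrightarrow>
        (w \<otimes>\<^bsub>F\<^esub> u, w \<otimes>\<^bsub>F\<^esub> v) \<in> r - Id \<and> (u \<otimes>\<^bsub>F\<^esub> w, v \<otimes>\<^bsub>F\<^esub> w) \<in> r - Id"
    using cond_a unfolding condition_a_def free_monomial_ordering_def Let_def by blast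
  note wb = assms(2-)[THEN word_in_basis]
  have uy: "(XW (u @ y), XW (v @ y)) \<in> r - Id"
    using fo[rule_format, OF wb(4) wb(1) wb(2) assms(1)] unfolding word_mult by blast
  have "u @ y \<in> words" "v @ y \<in> words" using assms by auto
  then show ?thesis
    using fo[rule_format, OF wb(3) _ _ uy] word_in_basis unfolding word_mult by blast
qed

lemma relators_groebner:
  "groebner_basis K n r I {relator K n l m j i | i j. 1 \<le> i \<and> i < j \<and> j \<le> n}"
  using cond_a unfolding condition_a_def reduced_groebner_basis_def by blast

lemma relator_props:
  assumes "1 \<le> i" "i < j" "j \<le> n"
  shows "relator K n l m j i \<in> I" "FO.LMA (relator K n l m j i) = XW [j, i]"
proof -
  have "{relator K n l m j i | i j. 1 \<le> i \<and> i < j \<and> j \<le> n} \<subseteq> I"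
    using relators_groebner unfolding groebner_basis_def Let_def by (rule conjunct1)
  then show "relator K n l m j i \<in> I" using assms by blast
  show "FO.LMA (relator K n l m j i) = XW [j, i]"
    using cond_a assms unfolding condition_a_def free_generator_mult by blast
qed

text \<open>The Groebner property forces the leading word of a nonzero element of \<open>I\<close>
  to contain some \<open>[j, i]\<close> with \<open>i < j\<close>, whereas the words of a normal
  form are sorted.\<close>

lemma kernel_normal_form:
  assumes "f \<in> normal_forms" "\<pi> f = \<zero>\<^bsub>A\<^esub>" shows "f = \<zero>\<^bsub>F\<^esub>"
proof (rule ccontr)
  assume nz: "f \<noteq> \<zero>\<^bsub>F\<^esub>"
  have f: "f \<in> carrier F" "f \<in> I" using assms by (auto simp: normal_forms_def kernel_iff)
  obtain g u' v' where "g \<in> {relator K n l m j i | i j. 1 \<le> i \<and> i < j \<and> j \<le> n}"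
    "u' \<in> free_basis K n" "v' \<in> free_basis K n" "FO.LMA f = u' \<otimes>\<^bsub>F\<^esub> FO.LMA g \<otimes>\<^bsub>F\<^esub> v'"
    using relators_groebner[unfolded groebner_basis_def Let_def, THEN conjunct2, rule_format, OF f(2) nz]
    by blast
  then obtain i j u v where ij: "1 \<le> i" "i < j" "j \<le> n" and uv: "u \<in> words" "v \<in> words"
    "FO.LMA f = XW u \<otimes>\<^bsub>F\<^esub> FO.LMA (relator K n l m j i) \<otimes>\<^bsub>F\<^esub> XW v"
    unfolding free_basis_def by blast
  then have LM: "FO.LMA f = XW (u @ [j, i] @ v)" by (simp add: relator_props(2) word_mult)
  have w: "u @ [j, i] @ v \<in> words" using relator_generators[OF ij] uv by auto
  have "f (u @ [j, i] @ v) \<noteq> \<zero>\<^bsub>K\<^esub>"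
    using FO.LM_props(1)[OF f(1) nz] unfolding LM free_coeff[OF f(1) w] .
  then have "sorted (u @ [j, i] @ v)" using assms(1) by (auto simp: normal_forms_def)
  then show False using ij(2) by (simp add: sorted_append)
qed

text \<open>Well-founded induction along \<open>r\<close>: at a descent of \<open>w\<close> the
  relator rewrites \<open>[j, i]\<close> by smaller words \<open>w'\<close>, and compatibility of
  \<open>r\<close> with multiplication keeps \<open>u @ w' @ v\<close> below
  \<open>w\<close>.\<close>

lemma normal_form_exists:
  assumes "w \<in> words" shows "\<exists>f\<in>normal_forms. \<pi> f = ev w"
proof -
  have "wf (r - Id)" using free_order by (simp add: well_order_on_def)
  then have "wf (inv_image (r - Id) XW)" by (rule wf_inv_image)
  then show ?thesis
    using assms
  proof (induction w rule: wf_induct_rule)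
    case (less w)
    show ?case
    proof (cases "sorted w")
      case True
      then show ?thesis using normal_forms_word[OF less.prems] by blast
    next
      case False
      then obtain u i j v where w: "w = u @ [j, i] @ v" and lt: "i < j" by (rule unsorted_descent)
      then have uv: "u \<in> words" "v \<in> words" and ij: "1 \<le> i" "i < j" "j \<le> n"
        using less.prems by auto
      note ji = relator_generators(2)[OF ij] and rel = relator_props[OF ij]
      \<comment> \<open>\<open>x\<close> belongs to \<open>?N\<close> if its product with
        \<open>u\<close> on the left and \<open>v\<close> on the right has a normal form. This set
        is a subspace, so the tail \<open>g\<close> of the relator can be treated one word at a
        time.\<close>
      let ?N = "{x \<in> carrier F. \<exists>f\<in>normal_forms. \<pi> f = ev u \<otimes>\<^bsub>A\<^esub> \<pi> x \<otimes>\<^bsub>A\<^esub> ev v}"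
      have nf: "f \<in> carrier F" if "f \<in> normal_forms" for f using that by (simp add: normal_forms_def)
      have "relator K n l m j i \<in> carrier F" "\<pi> (relator K n l m j i) = \<zero>\<^bsub>A\<^esub>"
        using rel(1) by (auto simp: kernel_iff)
      moreover have "relator K n l m j i \<noteq> \<zero>\<^bsub>F\<^esub>"
        using rel(2) FO.LM_zero FB.basis_nonzero[OF word_in_basis[OF ji]] by metis
      ultimately obtain c g where c: "c \<in> carrier K" "c \<noteq> \<zero>\<^bsub>K\<^esub>" and g: "g \<in> FO.below (XW [j, i])"
        and dec: "relator K n l m j i = c \<odot>\<^bsub>F\<^esub> XW [j, i] \<oplus>\<^bsub>F\<^esub> g"
        using FO.LM_decompose[of "relator K n l m j i"] rel(2) by metis
      have gF: "g \<in> carrier F" using g by (rule FO.below_carrier)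
      have "c \<odot>\<^bsub>A\<^esub> ev [j, i] \<oplus>\<^bsub>A\<^esub> \<pi> g = \<zero>\<^bsub>A\<^esub>"
        using \<open>\<pi> (relator K n l m j i) = \<zero>\<^bsub>A\<^esub>\<close> c(1) gF word_closed[OF ji] unfolding dec by simp
      then have pg: "\<pi> g = \<ominus>\<^bsub>A\<^esub> (c \<odot>\<^bsub>A\<^esub> ev [j, i])"
        using c(1) gF ev_closed[OF ji] P.B.M.minus_equality[of "\<pi> g" "c \<odot>\<^bsub>A\<^esub> ev [j, i]"]
        by (simp add: P.B.M.a_comm)
      have "g \<in> ?N"
      proof (rule FO.below_induct[OF g])
        show "\<zero>\<^bsub>F\<^esub> \<in> ?N"
          using normal_forms_zero F.M.zero_closed uv
          by (intro CollectI conjI bexI[of _ "\<zero>\<^bsub>F\<^esub>"]) auto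
      next
        fix x y assume "x \<in> ?N" "y \<in> ?N"
        then obtain f f' where "f \<in> normal_forms" "\<pi> f = ev u \<otimes>\<^bsub>A\<^esub> \<pi> x \<otimes>\<^bsub>A\<^esub> ev v"
          "f' \<in> normal_forms" "\<pi> f' = ev u \<otimes>\<^bsub>A\<^esub> \<pi> y \<otimes>\<^bsub>A\<^esub> ev v" "x \<in> carrier F" "y \<in> carrier F"
          by blast
        then have "\<pi> (f \<oplus>\<^bsub>F\<^esub> f') = ev u \<otimes>\<^bsub>A\<^esub> \<pi> (x \<oplus>\<^bsub>F\<^esub> y) \<otimes>\<^bsub>A\<^esub> ev v"
          "x \<oplus>\<^bsub>F\<^esub> y \<in> carrier F" "f \<oplus>\<^bsub>F\<^esub> f' \<in> normal_forms"
          using nf normal_forms_add ev_closed[OF uv(1)] ev_closed[OF uv(2)]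
          by (simp_all add: P.B.A.l_distr P.B.A.r_distr)
        then show "x \<oplus>\<^bsub>F\<^esub> y \<in> ?N" by blast
      next
        fix d b assume d: "d \<in> carrier K" and b: "(b, XW [j, i]) \<in> r - Id"
        then have "b \<in> free_basis K n" using FO.order_field by blast
        then obtain w' where w': "w' \<in> words" "b = XW w'" unfolding free_basis_def by blast
        have "(XW (u @ w' @ v), XW w) \<in> r - Id"
          unfolding w using b w' uv ji by (intro free_order_mult) auto
        moreover have "u @ w' @ v \<in> words" using uv w' by auto
        ultimately obtain f where f: "f \<in> normal_forms" "\<pi> f = ev (u @ w' @ v)"
          using less.IH[of "u @ w' @ v"] by auto
        have "ev (u @ w' @ v) = ev u \<otimes>\<^bsub>A\<^esub> ev w' \<otimes>\<^bsub>A\<^esub> ev v"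
          using uv w' by (simp add: ev_append P.B.A.m_assoc del: in_lists_conv_set)
        then have "\<pi> (d \<odot>\<^bsub>F\<^esub> f) = ev u \<otimes>\<^bsub>A\<^esub> \<pi> (d \<odot>\<^bsub>F\<^esub> b) \<otimes>\<^bsub>A\<^esub> ev v"
          "d \<odot>\<^bsub>F\<^esub> f \<in> normal_forms" "d \<odot>\<^bsub>F\<^esub> b \<in> carrier F"
          using d f nf normal_forms_smult uv w' word_closed[OF w'(1)] ev_closed
          by (simp_all add: P.B.smult_mult_left P.B.smult_mult_right del: in_lists_conv_set)
        then show "d \<odot>\<^bsub>F\<^esub> b \<in> ?N" by blast
      qed blast
      then obtain f where f: "f \<in> normal_forms" "\<pi> f = ev u \<otimes>\<^bsub>A\<^esub> \<pi> g \<otimes>\<^bsub>A\<^esub> ev v" by blast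
      \<comment> \<open>The relator vanishes in \<open>A\<close>, so \<open>\<pi> g\<close> is
        \<open>-c\<close> times \<open>ev [j, i]\<close>; multiplication by \<open>-1/c\<close>
        recovers \<open>ev w\<close>.\<close>
      let ?d = "\<ominus>\<^bsub>K\<^esub> (inv\<^bsub>K\<^esub> c)"
      have inv: "inv\<^bsub>K\<^esub> c \<in> carrier K" "inv\<^bsub>K\<^esub> c \<otimes>\<^bsub>K\<^esub> c = \<one>\<^bsub>K\<^esub>"
        using c field_Units by auto
      have evs: "ev u \<in> carrier A" "ev v \<in> carrier A" "ev [j, i] \<in> carrier A"
        using ev_closed[OF uv(1)] ev_closed[OF uv(2)] ev_closed[OF ji] .
      have "\<pi> f = (\<ominus>\<^bsub>K\<^esub> c) \<odot>\<^bsub>A\<^esub> (ev u \<otimes>\<^bsub>A\<^esub> ev [j, i] \<otimes>\<^bsub>A\<^esub> ev v)"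
        unfolding f(2) pg using evs c(1)
        by (simp add: P.B.smult_mult_left P.B.smult_mult_right P.B.smult_l_minus[symmetric])
      also have "ev u \<otimes>\<^bsub>A\<^esub> ev [j, i] \<otimes>\<^bsub>A\<^esub> ev v = ev w"
      proof -
        have "[j, i] @ v \<in> words" using ji uv(2) by simp
        from ev_append[OF uv(1) this] show ?thesis
          unfolding w ev_append[OF ji uv(2)] using evs by (simp add: P.B.A.m_assoc)
      qed
      finally have "\<pi> (?d \<odot>\<^bsub>F\<^esub> f) = (?d \<otimes>\<^bsub>K\<^esub> (\<ominus>\<^bsub>K\<^esub> c)) \<odot>\<^bsub>A\<^esub> ev w"
        using inv c(1) nf[OF f(1)] ev_closed[OF less.prems] by (simp add: P.B.smult_assoc1)
      also have "?d \<otimes>\<^bsub>K\<^esub> (\<ominus>\<^bsub>K\<^esub> c) = \<one>\<^bsub>K\<^esub>"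
        using inv c(1) by (simp add: K.l_minus K.r_minus)
      finally have "\<pi> (?d \<odot>\<^bsub>F\<^esub> f) = ev w" using ev_closed[OF less.prems] by simp
      moreover have "?d \<odot>\<^bsub>F\<^esub> f \<in> normal_forms" using inv f by (intro normal_forms_smult) auto
      ultimately show ?thesis by blast
    qed
  qed
qed

lemma condition_a_pbw: "has_pbw_basis K A n a"
  by (rule has_pbw_basis_if_normal_forms[OF kernel_normal_form normal_form_exists])

text \<open>Applying \<open>\<pi>\<close> to the relator turns its membership in \<open>I\<close>
  into the commutation relation of the generators.\<close>

lemma condition_a_relation:
  assumes "1 \<le> i" "i < j" "j \<le> n"
  shows "l j i \<in> carrier K - {\<zero>\<^bsub>K\<^esub>}" "m j i \<in> coeff_functions K n"
    "ev [j, i] = l j i \<odot>\<^bsub>A\<^esub> ev [i, j] \<oplus>\<^bsub>A\<^esub> ordered_sum K A n a (m j i)"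
proof -
  show l: "l j i \<in> carrier K - {\<zero>\<^bsub>K\<^esub>}" and m: "m j i \<in> coeff_functions K n"
    using cond_a assms unfolding condition_a_def by blast+
  have "free_generator K ` {1..n} \<subseteq> carrier F" using free_generator_closed by blast
  note os = P.hom_ordered_sum[OF this generators m]
  note cl = relator_generators(1,2)[OF assms, THEN word_closed]
    relator_generators(1,2)[OF assms, THEN ev_closed]
  have "\<pi> (relator K n l m j i) = \<zero>\<^bsub>A\<^esub>" using relator_props(1)[OF assms] by (simp add: kernel_iff)
  then have "ev [j, i] \<ominus>\<^bsub>A\<^esub> l j i \<odot>\<^bsub>A\<^esub> ev [i, j] \<ominus>\<^bsub>A\<^esub> ordered_sum K A n a (m j i) = \<zero>\<^bsub>A\<^esub>"
    using os l cl unfolding relator_def Let_def free_generator_mult by simp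
  moreover have "x = ((x \<ominus>\<^bsub>A\<^esub> y \<ominus>\<^bsub>A\<^esub> z) \<oplus>\<^bsub>A\<^esub> z) \<oplus>\<^bsub>A\<^esub> y"
    if "x \<in> carrier A" "y \<in> carrier A" "z \<in> carrier A" for x y z
    using that by (simp add: P.B.M.minus_eq P.B.M.a_assoc P.B.M.l_neg)
  moreover have "ordered_sum K A n a (m j i) \<in> carrier A" using os P.hom_closed by metis
  ultimately have "ev [j, i] = \<zero>\<^bsub>A\<^esub> \<oplus>\<^bsub>A\<^esub> ordered_sum K A n a (m j i) \<oplus>\<^bsub>A\<^esub> l j i \<odot>\<^bsub>A\<^esub> ev [i, j]"
    using cl l by (metis DiffD1 P.B.smult_closed)
  then show "ev [j, i] = l j i \<odot>\<^bsub>A\<^esub> ev [i, j] \<oplus>\<^bsub>A\<^esub> ordered_sum K A n a (m j i)"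
    using cl l \<open>ordered_sum K A n a (m j i) \<in> carrier A\<close> by (simp add: P.B.M.a_comm)
qed

end

end

section \<open>Leading monomials of products\<close>

context ordered_basis
begin

text \<open>The shape of the defining identity of a solvable polynomial algebra. For
  \<open>b\<close> in the basis it amounts to \<open>f\<close> being nonzero with leading monomial
  \<open>b\<close>, but the explicit decomposition passes through linear maps.\<close>

definition leads :: "'a \<Rightarrow> 'a \<Rightarrow> bool" where
  "leads f b \<longleftrightarrow> (\<exists>c\<in>carrier K - {\<zero>\<^bsub>K\<^esub>}. \<exists>g\<in>below b. f = c \<odot>\<^bsub>A\<^esub> b \<oplus>\<^bsub>A\<^esub> g)"

lemma leads_LM: "leads f b \<Longrightarrow> b \<in> B \<Longrightarrow> LMA f = b"
  unfolding leads_def using LM_leading by blast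

lemma leads_basis: "b \<in> B \<Longrightarrow> leads b b"
  unfolding leads_def using below_zero by (intro bexI[of _ "\<one>\<^bsub>K\<^esub>"] bexI[of _ "\<zero>\<^bsub>A\<^esub>"]) auto

lemma leads_below:
  assumes "leads f b" "b \<in> B" "(b, b') \<in> r - Id" shows "f \<in> below b'"
proof -
  obtain c g where "c \<in> carrier K" "g \<in> below b" "f = c \<odot>\<^bsub>A\<^esub> b \<oplus>\<^bsub>A\<^esub> g"
    using assms(1) by (auto simp: leads_def)
  then show ?thesis
    using assms below_basis[OF assms(3)] below_mono[of g b b'] below_add below_smult by auto
qed

lemma leads_smult_add:
  assumes "leads f b" "c \<in> carrier K" "c \<noteq> \<zero>\<^bsub>K\<^esub>" "g \<in> below b" "b \<in> B"
  shows "leads (c \<odot>\<^bsub>A\<^esub> f \<oplus>\<^bsub>A\<^esub> g) b"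
proof -
  obtain d h where d: "d \<in> carrier K" "d \<noteq> \<zero>\<^bsub>K\<^esub>" and h: "h \<in> below b" "f = d \<odot>\<^bsub>A\<^esub> b \<oplus>\<^bsub>A\<^esub> h"
    using assms(1) by (auto simp: leads_def)
  have "c \<odot>\<^bsub>A\<^esub> f \<oplus>\<^bsub>A\<^esub> g = (c \<otimes>\<^bsub>K\<^esub> d) \<odot>\<^bsub>A\<^esub> b \<oplus>\<^bsub>A\<^esub> (c \<odot>\<^bsub>A\<^esub> h \<oplus>\<^bsub>A\<^esub> g)"
    using h assms d below_carrier[OF h(1)] below_carrier[OF assms(4)]
    by (simp add: smult_r_distr smult_assoc1 M.a_assoc)
  moreover have "c \<otimes>\<^bsub>K\<^esub> d \<in> carrier K - {\<zero>\<^bsub>K\<^esub>}"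
    using assms d by (simp add: integral_iff)
  moreover have "c \<odot>\<^bsub>A\<^esub> h \<oplus>\<^bsub>A\<^esub> g \<in> below b"
    using assms h by (intro below_add below_smult)
  ultimately show ?thesis unfolding leads_def by blast
qed

end

locale monomial_ordered_algebra = A: assoc_algebra K A + ordered_basis K A B r
  for K :: "('k, 'm) ring_scheme" (structure) and A :: "('k, 'a, 's) module_scheme" (structure)
    and B :: "'a set" and r :: "'a rel" +
  assumes monomial_ordering: "monomial_ordering K A B r" and one_in_basis: "\<one>\<^bsub>A\<^esub> \<in> B"
begin

lemma LM_basis: "b \<in> B \<Longrightarrow> LMA b = b"
  using leads_LM[OF leads_basis] by blast

text \<open>Clause (3) applied to \<open>b\<close>, the leading monomial of the product of
  \<open>b\<close> and 1.\<close>

lemma one_least: "b \<in> B \<Longrightarrow> b \<noteq> \<one>\<^bsub>A\<^esub> \<Longrightarrow> (\<one>\<^bsub>A\<^esub>, b) \<in> r - Id"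
proof -
  assume b: "b \<in> B" "b \<noteq> \<one>\<^bsub>A\<^esub>"
  have *: "v \<noteq> w \<and> w = LMA (u \<otimes>\<^bsub>A\<^esub> v) \<longrightarrow> (v, w) \<in> r - Id" if "w \<in> B" "u \<in> B" "v \<in> B" for w u v
    using monomial_ordering that
    unfolding monomial_ordering_def left_monomial_ordering_def by blast
  show ?thesis using *[OF b(1) b(1) one_in_basis] b LM_basis[OF b(1)] by simp
qed

text \<open>Hence the leading monomial of a nonzero element is scalar only if it is 1, which makes
  the exceptions of clause (2) manageable.\<close>

lemma scalar_basis: "b \<in> B \<Longrightarrow> b \<in> scalars K A \<longleftrightarrow> b = \<one>\<^bsub>A\<^esub>"
proof
  assume b: "b \<in> B" "b \<in> scalars K A"
  then obtain c where c: "c \<in> carrier K" "b = c \<odot>\<^bsub>A\<^esub> \<one>\<^bsub>A\<^esub>" by (auto simp: scalars_def)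
  have "coef (c \<odot>\<^bsub>A\<^esub> \<one>\<^bsub>A\<^esub>) b \<noteq> \<zero>\<^bsub>K\<^esub>" using coeff_basis[OF b(1), of b] c(2) by simp
  then show "b = \<one>\<^bsub>A\<^esub>"
    using c(1) one_in_basis by (auto simp: coeff_smult coeff_basis split: if_splits)
next
  assume "b \<in> B" "b = \<one>\<^bsub>A\<^esub>"
  then show "b \<in> scalars K A"
    unfolding scalars_def using A.smult_one[of b] A.R.one_closed by force
qed

text \<open>As \<open>m w\<close> is linear, one monomial \<open>x\<close> below \<open>b\<close>
  may be treated at a time. Its image is zero, or has leading monomial 1, which lies below
  \<open>b'\<close> because \<open>b'\<close> is not 1, or else clause (2) applies.\<close>

lemma below_product:
  assumes "ordering_compatible K A B r m" "w \<in> B" "b \<in> B" "leads (m w b) b'" "b' \<in> B" "b' \<noteq> \<one>\<^bsub>A\<^esub>"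
    "g \<in> below b"
    and m: "\<And>x. x \<in> carrier A \<Longrightarrow> m w x \<in> carrier A"
      "\<And>x y. x \<in> carrier A \<Longrightarrow> y \<in> carrier A \<Longrightarrow> m w (x \<oplus>\<^bsub>A\<^esub> y) = m w x \<oplus>\<^bsub>A\<^esub> m w y"
      "\<And>c x. c \<in> carrier K \<Longrightarrow> x \<in> carrier A \<Longrightarrow> m w (c \<odot>\<^bsub>A\<^esub> x) = c \<odot>\<^bsub>A\<^esub> m w x"
  shows "m w g \<in> below b'"
proof -
  let ?N = "{g \<in> carrier A. m w g \<in> below b'}"
  have m0: "m w \<zero>\<^bsub>A\<^esub> = \<zero>\<^bsub>A\<^esub>"
    using m(3)[of "\<zero>\<^bsub>K\<^esub>" "\<zero>\<^bsub>A\<^esub>"] m(1)[of "\<zero>\<^bsub>A\<^esub>"] by simp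
  have "m w x \<in> below b'" if x: "(x, b) \<in> r - Id" for x
  proof (cases "m w x = \<zero>\<^bsub>A\<^esub>")
    case True then show ?thesis using below_zero by simp
  next
    case False
    have xB: "x \<in> B" using x order_field by blast
    have mx: "m w x \<in> carrier A" using m(1) xB by simp
    have L: "LMA (m w x) \<in> B" using LM_props(3)[OF mx False] .
    have "(LMA (m w x), b') \<in> r - Id"
    proof (cases "LMA (m w x) \<in> scalars K A")
      case True
      then show ?thesis using scalar_basis[OF L] one_least assms(5,6) by simp
    next
      case False
      have "LMA (m w b) = b'" using assms(4,5) by (rule leads_LM)
      moreover have "b' \<notin> scalars K A" using scalar_basis assms(5,6) by simp
      moreover have "\<forall>w\<in>B. \<forall>u\<in>B. \<forall>v\<in>B. (u, v) \<in> r - Id \<and> LMA (m w u) \<notin> scalars K A \<and>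
          LMA (m w v) \<notin> scalars K A \<longrightarrow> (LMA (m w u), LMA (m w v)) \<in> r - Id"
        using assms(1) unfolding ordering_compatible_def by (rule conjunct1)
      ultimately show ?thesis using assms(2,3) xB x False by metis
    qed
    then show ?thesis using mx by (simp add: below_iff)
  qed
  then have "g \<in> ?N"
    using order_field
    by (intro below_induct[OF assms(7)]) (auto simp: m m0 below_zero below_add below_smult)
  then show ?thesis by simp
qed

lemma leads_product:
  assumes "ordering_compatible K A B r m" "w \<in> B" "b \<in> B" "leads (m w b) b'" "b' \<in> B" "b' \<noteq> \<one>\<^bsub>A\<^esub>"
    "leads f b"
    and m: "\<And>x. x \<in> carrier A \<Longrightarrow> m w x \<in> carrier A"
      "\<And>x y. x \<in> carrier A \<Longrightarrow> y \<in> carrier A \<Longrightarrow> m w (x \<oplus>\<^bsub>A\<^esub> y) = m w x \<oplus>\<^bsub>A\<^esub> m w y"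
      "\<And>c x. c \<in> carrier K \<Longrightarrow> x \<in> carrier A \<Longrightarrow> m w (c \<odot>\<^bsub>A\<^esub> x) = c \<odot>\<^bsub>A\<^esub> m w x"
  shows "leads (m w f) b'"
proof -
  obtain c g where c: "c \<in> carrier K" "c \<noteq> \<zero>\<^bsub>K\<^esub>" and g: "g \<in> below b" "f = c \<odot>\<^bsub>A\<^esub> b \<oplus>\<^bsub>A\<^esub> g"
    using assms(7) by (auto simp: leads_def)
  have "m w g \<in> below b'" by (rule below_product[OF assms(1-6) g(1) m])
  moreover have "m w f = c \<odot>\<^bsub>A\<^esub> m w b \<oplus>\<^bsub>A\<^esub> m w g"
    unfolding g(2) using c assms(3) below_carrier[OF g(1)] by (simp add: m)
  ultimately show ?thesis using leads_smult_add[OF assms(4) c _ assms(5)] by simp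
qed

text \<open>Lets a factor \<open>f\<close> be replaced by its leading monomial \<open>b\<close>;
  nothing else about \<open>f\<close> is needed to straighten a product.\<close>

lemma leads_left_product:
  assumes "w \<in> B" "b \<in> B" "leads (w \<otimes>\<^bsub>A\<^esub> b) b'" "b' \<in> B" "b' \<noteq> \<one>\<^bsub>A\<^esub>" "leads f b"
  shows "leads (w \<otimes>\<^bsub>A\<^esub> f) b'"
proof (rule leads_product[where m = "\<lambda>x y. x \<otimes>\<^bsub>A\<^esub> y", OF _ assms])
  show "ordering_compatible K A B r (\<lambda>x y. x \<otimes>\<^bsub>A\<^esub> y)"
    using monomial_ordering unfolding monomial_ordering_alt by blast
qed (use assms(1) in \<open>auto simp: A.A.r_distr A.smult_mult_right\<close>)

lemma leads_right_product:
  assumes "w \<in> B" "b \<in> B" "leads (b \<otimes>\<^bsub>A\<^esub> w) b'" "b' \<in> B" "b' \<noteq> \<one>\<^bsub>A\<^esub>" "leads f b"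
  shows "leads (f \<otimes>\<^bsub>A\<^esub> w) b'"
proof (rule leads_product[where m = "\<lambda>x y. y \<otimes>\<^bsub>A\<^esub> x", OF _ assms])
  show "ordering_compatible K A B r (\<lambda>x y. y \<otimes>\<^bsub>A\<^esub> x)"
    using monomial_ordering unfolding monomial_ordering_alt by blast
qed (use assms(1) in \<open>auto simp: A.A.l_distr A.smult_mult_left\<close>)

end

lemma sort_lists [simp]: "sort w \<in> lists S \<longleftrightarrow> w \<in> lists S"
  by (simp add: in_lists_conv_set)

lemma sort_append_cong:
  "mset u = mset u' \<Longrightarrow> mset v = mset v' \<Longrightarrow> sort (u @ v) = sort (u' @ v')"
  by (metis mset_append mset_sort properties_for_sort sorted_sort)

section \<open>Straightening words in an algebra with an ordered PBW basis\<close>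

locale ordered_presentation = algebra_presentation K n A \<pi> a
  for K :: "('k, 'm) ring_scheme" (structure) and n :: nat
    and A :: "('k, 'a, 's) module_scheme" (structure) and \<pi> :: "(nat list \<Rightarrow> 'k) \<Rightarrow> 'a"
    and a :: "nat \<Rightarrow> 'a" +
  fixes r :: "'a rel"
  assumes pbw_basis: "has_pbw_basis K A n a" and ordering: "monomial_ordering K A pbw r"
begin

lemma ev_sort_pbw [simp]: "w \<in> words \<Longrightarrow> ev (sort w) \<in> pbw"
  unfolding pbw_eq by (intro imageI) (simp del: in_lists_conv_set)

lemma ev_sorted_pbw: "w \<in> words \<Longrightarrow> sorted w \<Longrightarrow> ev w \<in> pbw"
  using ev_sort_pbw[of w] by (simp only: sorted_sort_id)

lemma ev_sorted_inj:
  "u \<in> words \<Longrightarrow> v \<in> words \<Longrightarrow> ev (sort u) = ev (sort v) \<longleftrightarrow> mset u = mset v"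
proof -
  assume w: "u \<in> words" "v \<in> words"
  have "inj_on ev {w \<in> words. sorted w}" using pbw_basis by (simp only: has_pbw_basis_iff)
  then have "ev (sort u) = ev (sort v) \<longleftrightarrow> sort u = sort v"
    by (rule inj_on_eq_iff) (simp_all only: mem_Collect_eq sort_lists sorted_sort w simp_thms)
  also have "\<dots> \<longleftrightarrow> mset u = mset v"
    by (metis mset_sort properties_for_sort sorted_sort)
  finally show ?thesis .
qed

lemma pbw_well_order: "well_order_on pbw r"
  using ordering by (simp add: monomial_ordering_alt)

lemma pbw_is_basis: "is_basis K A pbw"
  using pbw_basis by (simp add: has_pbw_basis_def)

sublocale O: monomial_ordered_algebra K A pbw r
proof -
  interpret ordered_basis K A pbw r
    by (rule assoc_algebra_ordered_basis[OF P.B.assoc_algebra_axioms pbw_is_basis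
          well_order_on_linear[OF pbw_well_order]])
  show "monomial_ordered_algebra K A pbw r"
    using ordering ev_sorted_pbw[of "[]"] by unfold_locales (simp_all add: ev_Nil)
qed

lemma ev_sort_one: "w \<in> words \<Longrightarrow> ev (sort w) = \<one>\<^bsub>A\<^esub> \<longleftrightarrow> w = []"
  using ev_sorted_inj[of w "[]"] by (simp add: ev_Nil)

text \<open>By induction the tail may be replaced by its leading monomial
  \<open>ev (sort w)\<close>; \<open>step\<close> then inserts the front letter into a sorted
  word.\<close>

lemma ev_leads_sort:
  assumes step: "\<And>x s. x \<in> {1..n} \<Longrightarrow> s \<in> words \<Longrightarrow> sorted s \<Longrightarrow> O.leads (ev (x # s)) (ev (insort x s))"
    and "w \<in> words"
  shows "O.leads (ev w) (ev (sort w))"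
  using assms(2)
proof (induction w rule: list.induct)
  case Nil then show ?case using O.leads_basis[OF ev_sort_pbw[of "[]"]] by simp
next
  case (Cons x w)
  then have x: "x \<in> {1..n}" "[x] \<in> words" and w: "w \<in> words" "x # w \<in> words" by auto
  have sw: "sort w \<in> words" using w(1) by (simp only: sort_lists)
  have "O.leads (ev [x] \<otimes>\<^bsub>A\<^esub> ev w) (ev (sort (x # w)))"
  proof (rule O.leads_left_product)
    show "ev [x] \<in> pbw" using x(2) by (rule ev_sorted_pbw) simp
    show "ev (sort w) \<in> pbw" "ev (sort (x # w)) \<in> pbw" using w by (simp_all only: ev_sort_pbw)
    show "O.leads (ev [x] \<otimes>\<^bsub>A\<^esub> ev (sort w)) (ev (sort (x # w)))"
      using step[OF x(1) sw] ev_append[OF x(2) sw] by simp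
    show "ev (sort (x # w)) \<noteq> \<one>\<^bsub>A\<^esub>" using ev_sort_one[OF w(2)] by simp
    show "O.leads (ev w) (ev (sort w))" using Cons.IH w(1) by simp
  qed
  then show ?case using ev_append[OF x(2) w(1)] by simp
qed

lemma ev_leads_insort:
  assumes rel: "\<And>i j. 1 \<le> i \<Longrightarrow> i < j \<Longrightarrow> j \<le> n \<Longrightarrow> O.leads (ev [j, i]) (ev [i, j])"
    and "x \<in> {1..n}" "s \<in> words" "sorted s"
  shows "O.leads (ev (x # s)) (ev (insort x s))"
  using assms(3,4)
proof (induction s rule: list.induct)
  case Nil
  then show ?case
    using O.leads_basis[OF ev_sorted_pbw[of "[x]"]] assms(2) by simp
next
  case (Cons y s)
  then have y: "y \<in> {1..n}" and s: "s \<in> words" "sorted s" by auto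
  have xy: "[x] \<in> words" "[y] \<in> words" "[x, y] \<in> words" "[y, x] \<in> words" "x # s \<in> words"
    using y s assms(2) by auto
  have xys: "x # y # s \<in> words" using y s assms(2) by auto
  have ins: "insort x s \<in> words" "insort x s = sort (x # s)"
    using s assms(2) by (auto simp: set_insort_key sorted_sort_id)
  show ?case
  proof (cases "x \<le> y")
    case True
    then have "sorted (x # y # s)" using Cons.prems(2) by auto
    then show ?thesis
      using O.leads_basis[OF ev_sorted_pbw[OF xys]] True by simp
  next
    case False
    let ?b = "ev (y # insort x s)"
    \<comment> \<open>Here \<open>y < x\<close>, and \<open>y\<close> is a lower bound for the
      letters of \<open>s\<close>, so \<open>y\<close> may be put in front of
      \<open>insort x s\<close>.\<close>
    have srt: "sorted (y # insort x s)"
      using Cons.prems(2) False by (auto simp: set_insort_key sorted_insort)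
    have yins: "y # insort x s \<in> words" using y ins(1) by simp
    note b = ev_sorted_pbw[OF yins srt]
    have b1: "?b \<noteq> \<one>\<^bsub>A\<^esub>" using ev_sort_one[OF yins] sorted_sort_id[OF srt] by simp
    have "O.leads (ev [y] \<otimes>\<^bsub>A\<^esub> ev (x # s)) ?b"
    proof (rule O.leads_left_product[OF _ _ _ b b1])
      show "ev [y] \<in> pbw" using xy(2) by (rule ev_sorted_pbw) simp
      show "ev (insort x s) \<in> pbw" using ins(1) s(2) by (intro ev_sorted_pbw) (simp_all add: sorted_insort)
      show "O.leads (ev [y] \<otimes>\<^bsub>A\<^esub> ev (insort x s)) ?b"
        using O.leads_basis[OF b] ev_append[OF xy(2) ins(1)] by simp
      show "O.leads (ev (x # s)) (ev (insort x s))" using Cons.IH s by simp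
    qed
    \<comment> \<open>Regrouping makes the basis monomial \<open>ev [y, x]\<close> the left factor;
      \<open>leads_right_product\<close> then exchanges it for \<open>ev [x, y]\<close>, whose
      leading monomial it is.\<close>
    also have "ev [y] \<otimes>\<^bsub>A\<^esub> ev (x # s) = ev [y, x] \<otimes>\<^bsub>A\<^esub> ev s"
      using ev_append[OF xy(2) xy(5)] ev_append[OF xy(4) s(1)] by simp
    finally have yx: "O.leads (ev [y, x] \<otimes>\<^bsub>A\<^esub> ev s) ?b" .
    have "O.leads (ev [x, y] \<otimes>\<^bsub>A\<^esub> ev s) ?b"
    proof (rule O.leads_right_product[OF _ _ yx b b1])
      show "ev s \<in> pbw" using s by (rule ev_sorted_pbw)
      show "ev [y, x] \<in> pbw" using xy(4) False by (intro ev_sorted_pbw) simp_all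
      show "O.leads (ev [x, y]) (ev [y, x])" using rel[of y x] False y assms(2) by simp
    qed
    then show ?thesis using False ev_append[OF xy(3) s(1)] by simp
  qed
qed

text \<open>Sorted words are determined by their letter counts, and the counts of a concatenation
  add up.\<close>

lemma word_of_add:
  assumes "\<alpha> \<in> exponents n" "\<beta> \<in> exponents n"
  shows "word_of n (\<lambda>i. \<alpha> i + \<beta> i) = sort (word_of n \<alpha> @ word_of n \<beta>)"
proof -
  have "(\<lambda>i. \<alpha> i + \<beta> i) = count_list (sort (word_of n \<alpha> @ word_of n \<beta>))"
  proof -
    have "count_list (sort (word_of n \<alpha> @ word_of n \<beta>)) = count_list (word_of n \<alpha> @ word_of n \<beta>)"
      unfolding count_list_mset by simp
    then show ?thesis
      using count_list_word_of[OF assms(1)] count_list_word_of[OF assms(2)] by (simp add: fun_eq_iff)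
  qed
  moreover have "sort (word_of n \<alpha> @ word_of n \<beta>) \<in> words"
    unfolding sort_lists using word_of_lists[of n] by simp
  ultimately show ?thesis by (simp add: word_of_count_list)
qed

lemma leads_iff:
  assumes "b \<in> pbw"
  shows "O.leads f b \<longleftrightarrow> (\<exists>c\<in>carrier K - {\<zero>\<^bsub>K\<^esub>}. \<exists>g\<in>carrier A. f = c \<odot>\<^bsub>A\<^esub> b \<oplus>\<^bsub>A\<^esub> g \<and>
    (g = \<zero>\<^bsub>A\<^esub> \<or> (LM K A pbw r g, b) \<in> r - Id))"
  unfolding O.leads_def Bex_def O.below_iff by blast

text \<open>Solvability with the ordering \<open>r\<close> fixed and exponent vectors replaced by
  sorted words; \<open>solvable_iff\<close> translates back.\<close>

definition solvable :: bool where
  "solvable \<longleftrightarrow> (\<forall>u\<in>words. \<forall>v\<in>words. sorted u \<longrightarrow> sorted v \<longrightarrow> O.leads (ev (u @ v)) (ev (sort (u @ v))))"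

lemma solvable_iff:
  "solvable \<longleftrightarrow> (\<forall>\<alpha>\<in>exponents n. \<forall>\<beta>\<in>exponents n.
    \<exists>c \<in> carrier K - {\<zero>\<^bsub>K\<^esub>}. \<exists>f \<in> carrier A.
      ordered_monomial A n a \<alpha> \<otimes>\<^bsub>A\<^esub> ordered_monomial A n a \<beta> =
        c \<odot>\<^bsub>A\<^esub> ordered_monomial A n a (\<lambda>i. \<alpha> i + \<beta> i) \<oplus>\<^bsub>A\<^esub> f \<and>
      (f = \<zero>\<^bsub>A\<^esub> \<or>
        (LM K A pbw r f, ordered_monomial A n a (\<lambda>i. \<alpha> i + \<beta> i)) \<in> r - Id))"
    (is "_ \<longleftrightarrow> (\<forall>\<alpha>\<in>_. \<forall>\<beta>\<in>_. ?R \<alpha> \<beta>)")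
proof -
  have "solvable \<longleftrightarrow> (\<forall>u\<in>{w \<in> words. sorted w}. \<forall>v\<in>{w \<in> words. sorted w}.
      O.leads (ev (u @ v)) (ev (sort (u @ v))))"
    unfolding solvable_def by blast
  also have "\<dots> \<longleftrightarrow> (\<forall>\<alpha>\<in>exponents n. \<forall>\<beta>\<in>exponents n.
      O.leads (ev (word_of n \<alpha> @ word_of n \<beta>)) (ev (sort (word_of n \<alpha> @ word_of n \<beta>))))"
    unfolding sorted_words[symmetric] ball_simps(9) ..
  also have "\<dots> \<longleftrightarrow> (\<forall>\<alpha>\<in>exponents n. \<forall>\<beta>\<in>exponents n. ?R \<alpha> \<beta>)"
  proof (intro ball_cong refl)
    fix \<alpha> \<beta> assume e: "\<alpha> \<in> exponents n" "\<beta> \<in> exponents n"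
    have "word_of n \<alpha> @ word_of n \<beta> \<in> words" using word_of_lists[of n] by simp
    then show "O.leads (ev (word_of n \<alpha> @ word_of n \<beta>)) (ev (sort (word_of n \<alpha> @ word_of n \<beta>)))
        \<longleftrightarrow> ?R \<alpha> \<beta>"
      unfolding ordered_monomial_ev word_of_add[OF e] ev_append[OF word_of_lists word_of_lists]
      by (intro leads_iff ev_sort_pbw)
  qed
  finally show ?thesis .
qed

text \<open>Reduces solvability to the quadratic relations between generators, the form in which (a)
  and (b) supply the information.\<close>

lemma solvableI:
  assumes rel: "\<And>i j. 1 \<le> i \<Longrightarrow> i < j \<Longrightarrow> j \<le> n \<Longrightarrow> O.leads (ev [j, i]) (ev [i, j])"
  shows solvable
  unfolding solvable_def
proof (intro ballI impI)
  fix u v assume "u \<in> words" "v \<in> words"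
  then have "u @ v \<in> words" by simp
  then show "O.leads (ev (u @ v)) (ev (sort (u @ v)))"
    by (intro ev_leads_sort ev_leads_insort rel)
qed

end

section \<open>Presentations of solvable polynomial algebras\<close>

context algebra_presentation
begin

sublocale QI: algebra_isomorphism K A Q "inv_into (carrier Q) \<phi>"
  by (rule Q.inverse_isomorphism)

lemma generators_closed: "a ` {1..n} \<subseteq> carrier A"
  using ev_closed[OF generator_words] ev_single by force

lemma coset_generators_closed: "x\<^sub>Q ` {1..n} \<subseteq> carrier Q"
  using coset_generator_closed by blast

lemma inverse_generator: "i \<in> {1..n} \<Longrightarrow> inv_into (carrier Q) \<phi> (a i) = x\<^sub>Q i"
  using inv_into_f_f[OF bij_betw_imp_inj_on[OF phi_bij] coset_generator_closed] phi_generator by metis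

text \<open>For the addendum to (a): the PBW basis is established in \<open>A\<close> and carried
  over to the cosets.\<close>

lemma quotient_pbw:
  "has_pbw_basis K A n a \<Longrightarrow> has_pbw_basis K Q n x\<^sub>Q"
  using QI.has_pbw_basis_image[OF _ generators_closed inverse_generator] .

lemma ev_pair: "i \<in> {1..n} \<Longrightarrow> j \<in> {1..n} \<Longrightarrow> ev [i, j] = a i \<otimes>\<^bsub>A\<^esub> a j"
  using ev_append[OF generator_words generator_words, of i j] ev_single by simp

text \<open>Condition (a) provides the basis and the commutation relations with nonzero
  \<open>l j i\<close>. Condition (b), moved to \<open>A\<close> along \<open>\<phi>\<close>, puts
  the remaining ordered sum below \<open>ev [i, j]\<close>, which is what \<open>solvableI\<close>
  asks for.\<close>

lemma solvable_if_conditions: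
  assumes ca: "condition_a K n I r l m" and cb: "condition_b K n I m"
  shows "solvable_polynomial_algebra K A n a"
proof -
  have pbw: "has_pbw_basis K A n a" using ca by (rule condition_a_pbw)
  let ?B = "ordered_monomials Q n x\<^sub>Q"
  have qb: "is_basis K Q ?B" using quotient_pbw[OF pbw] by (simp add: has_pbw_basis_def)
  obtain s where s: "monomial_ordering K Q ?B s"
    and below: "\<And>i j. 1 \<le> i \<Longrightarrow> i < j \<Longrightarrow> j \<le> n \<Longrightarrow> ordered_sum K Q n x\<^sub>Q (m j i) \<noteq> \<zero>\<^bsub>Q\<^esub> \<Longrightarrow>
          (LM K Q ?B s (ordered_sum K Q n x\<^sub>Q (m j i)), x\<^sub>Q i \<otimes>\<^bsub>Q\<^esub> x\<^sub>Q j) \<in> s - Id"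
    using cb unfolding condition_b_def Let_def by blast
  have wo: "well_order_on ?B s" using s by (simp add: monomial_ordering_alt)
  have image: "\<phi> ` ?B = pbw"
    by (rule Q.hom_ordered_monomials[OF coset_generators_closed phi_generator])
  have mo: "monomial_ordering K A pbw (dir_image s \<phi>)"
    using Q.monomial_ordering_image[OF qb wo s] by (simp only: image)
  interpret ordered_presentation K n A \<pi> a "dir_image s \<phi>"
    using pbw mo by unfold_locales
  have solvable
  proof (rule solvableI)
    fix i j assume ij: "1 \<le> i" "i < j" "j \<le> n"
    then have ij': "i \<in> {1..n}" "j \<in> {1..n}" by auto
    note rel = condition_a_relation[OF ca ij]
    note os = Q.hom_ordered_sum[OF coset_generators_closed phi_generator rel(2)]
    let ?F = "ordered_sum K Q n x\<^sub>Q (m j i)"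
    have pair: "\<phi> (x\<^sub>Q i \<otimes>\<^bsub>Q\<^esub> x\<^sub>Q j) = ev [i, j]"
      using ij' by (simp only: Q.hom_mult coset_generator_closed phi_generator ev_pair)
    have "ordered_sum K A n a (m j i) \<in> O.below (ev [i, j])"
    proof (cases "?F = \<zero>\<^bsub>Q\<^esub>")
      case True
      then have "ordered_sum K A n a (m j i) = \<zero>\<^bsub>A\<^esub>" using os(2) by simp
      then show ?thesis by (simp add: O.below_zero)
    next
      case False
      interpret QB: ordered_basis K Q ?B s
        by (rule assoc_algebra_ordered_basis[OF Q.A.assoc_algebra_axioms qb well_order_on_linear[OF wo]])
      have lt: "(QB.LMA ?F, x\<^sub>Q i \<otimes>\<^bsub>Q\<^esub> x\<^sub>Q j) \<in> s - Id" using below[OF ij False] .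
      then have "(\<phi> (QB.LMA ?F), \<phi> (x\<^sub>Q i \<otimes>\<^bsub>Q\<^esub> x\<^sub>Q j)) \<in> dir_image s \<phi> - Id"
        using Q.strict_order_image[OF qb wo] QB.order_field by blast
      moreover have "\<phi> (QB.LMA ?F) = O.LMA (ordered_sum K A n a (m j i))"
        using Q.LM_image[OF qb wo os(1)] by (simp only: image os(2))
      ultimately have "(O.LMA (ordered_sum K A n a (m j i)), ev [i, j]) \<in> dir_image s \<phi> - Id"
        by (simp only: pair)
      moreover have "ordered_sum K A n a (m j i) \<in> carrier A"
        using Q.hom_closed[OF os(1)] by (simp only: os(2))
      ultimately show ?thesis unfolding O.below_iff by blast
    qed
    then show "O.leads (ev [j, i]) (ev [i, j])"
      unfolding O.leads_def using rel(1,3) by blast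
  qed
  then show ?thesis
    unfolding solvable_polynomial_algebra_def solvable_iff using pbw mo by blast
qed

text \<open>\<open>word_of n\<close> is injective on exponent vectors, so at most one summand
  contributes at a given word \<open>w\<close>, namely the one with exponents
  \<open>count_list w\<close>.\<close>

lemma free_ordered_sum:
  assumes "m \<in> coeff_functions K n"
  shows "ordered_sum K F n (free_generator K) m \<in> carrier F"
    "ordered_sum K F n (free_generator K) m w =
      (if w \<in> words \<and> sorted w then m (count_list w) else \<zero>\<^bsub>K\<^esub>)"
proof -
  let ?S = "{\<alpha> \<in> exponents n. m \<alpha> \<noteq> \<zero>\<^bsub>K\<^esub>}"
  have S: "finite ?S" "\<And>\<alpha>. \<alpha> \<in> exponents n \<Longrightarrow> m \<alpha> \<in> carrier K"
    using assms by (auto simp: coeff_functions_def)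
  have closed: "(\<lambda>\<alpha>. m \<alpha> \<odot>\<^bsub>F\<^esub> XW (word_of n \<alpha>)) \<in> ?S \<rightarrow> carrier F"
    using S(2) by (intro Pi_I free_smult_closed word_closed word_of_lists) blast
  show "ordered_sum K F n (free_generator K) m \<in> carrier F"
    unfolding ordered_sum_def free_ordered_monomial using closed by (rule F.M.finsum_closed)
  have val: "ordered_sum K F n (free_generator K) m w =
      (\<Oplus>\<^bsub>K\<^esub>\<alpha>\<in>?S. if word_of n \<alpha> = w then m \<alpha> else \<zero>\<^bsub>K\<^esub>)"
    unfolding ordered_sum_def free_ordered_monomial free_finsum_apply[OF S(1) closed]
    using S(2) by (intro K.finsum_cong') (auto simp: free_selectors(5) word_monomial_def)
  show "ordered_sum K F n (free_generator K) m w =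
      (if w \<in> words \<and> sorted w then m (count_list w) else \<zero>\<^bsub>K\<^esub>)"
  proof (cases "w \<in> words \<and> sorted w")
    case True
    have "word_of n \<alpha> = w \<longleftrightarrow> \<alpha> = count_list w" if "\<alpha> \<in> ?S" for \<alpha>
    proof
      assume "word_of n \<alpha> = w" then show "\<alpha> = count_list w"
        using that count_list_word_of[of \<alpha> n] by simp
    next
      assume "\<alpha> = count_list w" then show "word_of n \<alpha> = w"
        using True by (simp only: word_of_count_list simp_thms)
    qed
    then have "ordered_sum K F n (free_generator K) m w =
        (\<Oplus>\<^bsub>K\<^esub>\<alpha>\<in>?S. if \<alpha> = count_list w then m \<alpha> else \<zero>\<^bsub>K\<^esub>)"
      unfolding val using S(2) by (intro K.finsum_cong') auto
    also have "\<dots> = m (count_list w)"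
    proof (cases "count_list w \<in> ?S")
      case True
      then show ?thesis using K.add.finprod_singleton_swap[OF _ S(1), of "count_list w" m] S(2) by simp
    next
      case False
      then have "(\<Oplus>\<^bsub>K\<^esub>\<alpha>\<in>?S. if \<alpha> = count_list w then m \<alpha> else \<zero>\<^bsub>K\<^esub>) = (\<Oplus>\<^bsub>K\<^esub>\<alpha>\<in>?S. \<zero>\<^bsub>K\<^esub>)"
        by (intro K.finsum_cong') auto
      moreover have "m (count_list w) = \<zero>\<^bsub>K\<^esub>"
        using False count_list_exponents[of w n] True by blast
      ultimately show ?thesis by simp
    qed
    finally show ?thesis using True by simp
  next
    case False
    have "word_of n \<alpha> \<noteq> w" for \<alpha> using False word_of_lists sorted_word_of by blast
    then show ?thesis unfolding val if_not_P[OF False] by simp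
  qed
qed

end

context ordered_presentation
begin

text \<open>Origin of the coefficients in the tails of the relators: they are those of the
  correction terms in the PBW basis, so that the ordered sum in \<open>A\<close> gives the
  correction term back.\<close>

lemma ordered_sum_coeff:
  assumes "f \<in> carrier A"
  defines "m \<equiv> \<lambda>\<alpha>. O.coef f (ev (word_of n \<alpha>))"
  shows "m \<in> coeff_functions K n" "ordered_sum K A n a m = f"
proof -
  let ?S = "{\<alpha> \<in> exponents n. m \<alpha> \<noteq> \<zero>\<^bsub>K\<^esub>}" and ?h = "ordered_monomial A n a"
  have inj: "inj_on ?h ?S"
    using pbw_basis unfolding has_pbw_basis_def by (blast intro: inj_on_subset)
  have h: "m \<alpha> = O.coef f (?h \<alpha>)" for \<alpha> by (simp add: m_def ordered_monomial_ev)
  have image: "?h ` ?S = {b. O.coef f b \<noteq> \<zero>\<^bsub>K\<^esub>}"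
  proof (intro equalityI subsetI)
    fix b assume b: "b \<in> {b. O.coef f b \<noteq> \<zero>\<^bsub>K\<^esub>}"
    then have "b \<in> ordered_monomials A n a" using O.coeff_outside[OF assms(1)] by blast
    then obtain \<alpha> where "\<alpha> \<in> exponents n" "b = ?h \<alpha>" unfolding ordered_monomials_def by blast
    then show "b \<in> ?h ` ?S" using b by (simp add: h)
  qed (auto simp: h)
  have "finite (?h ` ?S)" unfolding image by (rule O.coeff_finite[OF assms(1)])
  then have "finite ?S" using inj by (rule finite_imageD)
  then show "m \<in> coeff_functions K n"
    using O.coeff_closed[OF assms(1)] by (simp add: coeff_functions_def h)
  have "f = (\<Oplus>\<^bsub>A\<^esub>b\<in>?h ` ?S. O.coef f b \<odot>\<^bsub>A\<^esub> b)"
    unfolding image by (rule O.coeff_sum[OF assms(1)])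
  also have "\<dots> = (\<Oplus>\<^bsub>A\<^esub>\<alpha>\<in>?S. O.coef f (?h \<alpha>) \<odot>\<^bsub>A\<^esub> ?h \<alpha>)"
  proof (rule P.B.M.add.finprod_reindex[OF _ inj, simplified])
    show "(\<lambda>b. O.coef f b \<odot>\<^bsub>A\<^esub> b) \<in> ?h ` ?S \<rightarrow> carrier A"
      unfolding image using O.coeff_closed[OF assms(1)] O.coeff_outside[OF assms(1)] O.basis_closed
      by (intro Pi_I P.B.smult_closed) blast+
  qed
  finally show "ordered_sum K A n a m = f" by (simp add: ordered_sum_def h)
qed

section \<open>A monomial ordering on words obtained from a solvable algebra\<close>

context
  assumes solv: solvable
begin

text \<open>Solvability is used with a single letter as left factor, which is the insertion step of
  \<open>ev_leads_sort\<close>.\<close>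

lemma ev_leads:
  assumes "w \<in> words" shows "O.leads (ev w) (ev (sort w))"
proof (rule ev_leads_sort[OF _ assms])
  fix x s assume x: "x \<in> {1..n}" "s \<in> words" "sorted s"
  then have "O.leads (ev ([x] @ s)) (ev (sort ([x] @ s)))"
    using solv generator_words[OF x(1)] sorted1 unfolding solvable_def by blast
  then show "O.leads (ev (x # s)) (ev (insort x s))"
    using x(3) by (simp add: sorted_sort_id)
qed

text \<open>On leading monomials the product is addition of exponents, as in a commutative
  polynomial ring; this lets the ordering of \<open>A\<close> be pulled back to words.\<close>

lemma LM_product:
  assumes "u \<in> words" "v \<in> words"
  shows "O.LMA (ev (sort u) \<otimes>\<^bsub>A\<^esub> ev (sort v)) = ev (sort (u @ v))"
proof -
  have uv: "sort u \<in> words" "sort v \<in> words" "u @ v \<in> words" "sort u @ sort v \<in> words"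
    using assms by auto
  have "sort (sort u @ sort v) = sort (u @ v)" by (rule sort_append_cong) simp_all
  then have "O.leads (ev (sort u @ sort v)) (ev (sort (u @ v)))" using ev_leads[OF uv(4)] by simp
  then show ?thesis
    unfolding ev_append[OF uv(1,2)] using ev_sort_pbw[OF uv(3)] by (rule O.leads_LM)
qed

text \<open>Sees only exponent vectors: words with the same letters are incomparable.\<close>

abbreviation less_exp (infix \<open>\<lessdot>\<close> 50) where
  "u \<lessdot> v \<equiv> (ev (sort u), ev (sort v)) \<in> r - Id"

lemma less_exp_append:
  assumes "u \<lessdot> v" "u \<in> words" "v \<in> words" "x \<in> words"
  shows "x @ u \<lessdot> x @ v" "u @ x \<lessdot> v @ x"
proof -
  have "x @ u \<lessdot> x @ v \<and> u @ x \<lessdot> v @ x"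
  \<comment> \<open>For nonempty \<open>x\<close> all four concatenations are nonempty and their
    leading monomials differ from 1. The exceptions of clause (2) are thereby excluded, even if
    \<open>u\<close> is empty.\<close>
  proof (cases "x = []")
    case False
    have w: "x @ u \<in> words" "x @ v \<in> words" "u @ x \<in> words" "v @ x \<in> words" using assms by auto
    have ns: "ev (sort y) \<notin> scalars K A" if "y \<in> words" "y \<noteq> []" for y
      using that O.scalar_basis[OF ev_sort_pbw] ev_sort_one by simp
    note b = ev_sort_pbw[OF assms(2)] ev_sort_pbw[OF assms(3)] ev_sort_pbw[OF assms(4)]
    have "\<forall>w\<in>pbw. \<forall>u\<in>pbw. \<forall>v\<in>pbw. (u, v) \<in> r - Id \<and>
        O.LMA (w \<otimes>\<^bsub>A\<^esub> u) \<notin> scalars K A \<and> O.LMA (w \<otimes>\<^bsub>A\<^esub> v) \<notin> scalars K A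
        \<longrightarrow> (O.LMA (w \<otimes>\<^bsub>A\<^esub> u), O.LMA (w \<otimes>\<^bsub>A\<^esub> v)) \<in> r - Id"
      "\<forall>w\<in>pbw. \<forall>u\<in>pbw. \<forall>v\<in>pbw. (u, v) \<in> r - Id \<and>
        O.LMA (u \<otimes>\<^bsub>A\<^esub> w) \<notin> scalars K A \<and> O.LMA (v \<otimes>\<^bsub>A\<^esub> w) \<notin> scalars K A
        \<longrightarrow> (O.LMA (u \<otimes>\<^bsub>A\<^esub> w), O.LMA (v \<otimes>\<^bsub>A\<^esub> w)) \<in> r - Id"
      using ordering
      unfolding monomial_ordering_def left_monomial_ordering_def right_monomial_ordering_def
      by blast+
    from this(1)[rule_format, OF b(3,1,2)] this(2)[rule_format, OF b(3,1,2)]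
    show ?thesis
      using assms ns[OF w(1)] ns[OF w(2)] ns[OF w(3)] ns[OF w(4)] False LM_product by simp
  qed (use assms in simp)
  then show "x @ u \<lessdot> x @ v" "u @ x \<lessdot> v @ x" by blast+
qed

text \<open>On words with the same letters \<open>lenlex\<close> is the lexicographic order; its
  comparison of lengths keeps it well-founded and total on all words.\<close>

definition word_less :: "nat list rel" where
  "word_less = {(u, v). u \<in> words \<and> v \<in> words \<and>
    (u \<lessdot> v \<or> mset u = mset v \<and> (u, v) \<in> lenlex less_than)}"

lemma mset_sort_eq: "mset u = mset v \<Longrightarrow> sort u = sort v"
  by (metis mset_sort properties_for_sort sorted_sort)

text \<open>The relation is contained in the pullback of a lexicographic product of well-founded
  relations, since words with the same letters have equal first components.\<close>

lemma wf_word_less: "wf word_less"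
proof -
  have "wf (r - Id)" using pbw_well_order by (simp add: well_order_on_def)
  then have "wf (inv_image ((r - Id) <*lex*> lenlex less_than) (\<lambda>w. (ev (sort w), w)))"
    by (intro wf_inv_image wf_lex_prod) auto
  then show ?thesis
    by (rule wf_subset) (auto simp: word_less_def dest: mset_sort_eq)
qed

lemma word_less_irrefl: "(w, w) \<notin> word_less"
  using wf_word_less by simp

lemma word_less_trans: "(u, v) \<in> word_less \<Longrightarrow> (v, w) \<in> word_less \<Longrightarrow> (u, w) \<in> word_less"
proof -
  assume uv: "(u, v) \<in> word_less" and vw: "(v, w) \<in> word_less"
  have "u \<lessdot> w \<or> mset u = mset w \<and> (u, w) \<in> lenlex less_than"
  proof (cases "u \<lessdot> v"; cases "v \<lessdot> w")
    assume "u \<lessdot> v" "v \<lessdot> w" then show ?thesis using O.strict_trans by blast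
  next
    assume "u \<lessdot> v" "\<not> v \<lessdot> w"
    then have "sort v = sort w" using vw by (auto simp: word_less_def dest: mset_sort_eq)
    then show ?thesis using \<open>u \<lessdot> v\<close> by simp
  next
    assume "\<not> u \<lessdot> v" "v \<lessdot> w"
    then have "sort u = sort v" using uv by (auto simp: word_less_def dest: mset_sort_eq)
    then show ?thesis using \<open>v \<lessdot> w\<close> by simp
  next
    assume n: "\<not> u \<lessdot> v" "\<not> v \<lessdot> w"
    have "mset u = mset v" "(u, v) \<in> lenlex less_than" using n(1) uv unfolding word_less_def by blast+
    moreover have "mset v = mset w" "(v, w) \<in> lenlex less_than"
      using n(2) vw unfolding word_less_def by blast+
    ultimately show ?thesis using lenlex_trans[OF _ _ trans_less_than] by metis
  qed
  then show ?thesis using uv vw unfolding word_less_def by blast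
qed

lemma word_less_append:
  assumes "(u, v) \<in> word_less" "x \<in> words"
  shows "(x @ u, x @ v) \<in> word_less" "(u @ x, v @ x) \<in> word_less"
proof -
  have w: "u \<in> words" "v \<in> words" using assms(1) by (auto simp: word_less_def)
  have ww: "x @ u \<in> words" "x @ v \<in> words" "u @ x \<in> words" "v @ x \<in> words" using w assms(2) by auto
  have "(x @ u, x @ v) \<in> word_less \<and> (u @ x, v @ x) \<in> word_less"
  proof (cases "u \<lessdot> v")
    case True
    then show ?thesis using less_exp_append[OF True w assms(2)] ww unfolding word_less_def by blast
  next
    case False
    then have m: "mset u = mset v" "(u, v) \<in> lenlex less_than"
      using assms(1) unfolding word_less_def by blast+
    have "(x @ u, x @ v) \<in> lenlex less_than" using m(2) by (simp add: irrefl_def)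
    moreover have "(u @ x, v @ x) \<in> lenlex less_than" by (rule lenlex_append1[OF m(2) refl])
    ultimately show ?thesis using ww m(1) by (simp add: word_less_def del: in_lists_conv_set)
  qed
  then show "(x @ u, x @ v) \<in> word_less" "(u @ x, v @ x) \<in> word_less" by blast+
qed

lemma word_less_total:
  assumes "u \<in> words" "v \<in> words" "u \<noteq> v" shows "(u, v) \<in> word_less \<or> (v, u) \<in> word_less"
proof (cases "mset u = mset v")
  case True
  have "total (lenlex less_than)" by (rule total_lenlex) simp
  then have "(u, v) \<in> lenlex less_than \<or> (v, u) \<in> lenlex less_than"
    using assms(3) by (simp add: total_on_def)
  then show ?thesis using assms(1,2) True unfolding word_less_def by auto
next
  case False
  then have "ev (sort u) \<noteq> ev (sort v)" using ev_sorted_inj assms by simp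
  then have "u \<lessdot> v \<or> v \<lessdot> u"
    using O.order_total[OF ev_sort_pbw[OF assms(1)] ev_sort_pbw[OF assms(2)]] by auto
  then show ?thesis using assms(1,2) unfolding word_less_def by blast
qed

text \<open>The empty word lies below the nonempty \<open>u @ s\<close> because 1 is the least
  monomial. Concatenation puts \<open>v\<close> below \<open>v @ u @ s\<close>, which has the same
  exponents as \<open>u @ v @ s\<close>.\<close>

lemma word_less_factor:
  assumes "u \<in> words" "v \<in> words" "s \<in> words" "u @ v @ s \<noteq> v"
  shows "(v, u @ v @ s) \<in> word_less"
proof -
  have us: "u @ s \<in> words" "u @ s \<noteq> []" "u @ v @ s \<in> words" using assms by auto
  have "[] \<lessdot> u @ s"
    using O.one_least[OF ev_sort_pbw[OF us(1)]] ev_sort_one[OF us(1)] us(2) by (simp add: ev_Nil)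
  then have "v @ [] \<lessdot> v @ (u @ s)"
    using assms(2) us(1) by (intro less_exp_append(1)) auto
  moreover have "sort (v @ (u @ s)) = sort (u @ v @ s)" by (rule mset_sort_eq) simp
  ultimately show ?thesis using assms(2) us(3) unfolding word_less_def by simp
qed

definition "free_order = dir_image (word_less \<union> Id_on words) XW"

lemma free_order_strict:
  "(XW u, XW v) \<in> free_order - Id \<longleftrightarrow> (u, v) \<in> word_less"
  using word_less_irrefl by (auto simp: free_order_def dir_image_def word_inj)

lemma free_order_well: "well_order_on (free_basis K n) free_order"
proof -
  let ?R = "word_less \<union> Id_on words"
  have sub: "word_less \<subseteq> words \<times> words" unfolding word_less_def by blast
  have "refl_on words ?R" "?R \<subseteq> words \<times> words" using sub by (auto simp: refl_on_def)
  moreover have "trans ?R" using word_less_trans by (auto simp: trans_def)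
  moreover have "antisym ?R"
    using word_less_trans word_less_irrefl by (auto simp: antisym_def)
  moreover have "total_on words ?R" using word_less_total by (auto simp: total_on_def)
  moreover have "wf (?R - Id)" by (rule wf_subset[OF wf_word_less]) auto
  ultimately have wo: "well_order_on words ?R"
    by (simp add: well_order_on_def linear_order_on_def partial_order_on_def preorder_on_def)
  then have F: "Field ?R = words" "Well_order ?R" using well_order_on_Well_order[OF wo] by auto
  have "Well_order (dir_image ?R XW)"
    by (rule Well_order_dir_image[OF F(2)]) (simp add: inj_on_def word_inj)
  moreover have "Field (dir_image ?R XW) = free_basis K n"
    unfolding dir_image_Field F(1) free_basis_def ..
  ultimately show ?thesis by (simp add: free_order_def)
qed

lemma free_order_monomial: "free_monomial_ordering K n free_order"
proof -
  have "(w \<otimes>\<^bsub>F\<^esub> u, w \<otimes>\<^bsub>F\<^esub> v) \<in> free_order - Id \<and> (u \<otimes>\<^bsub>F\<^esub> w, v \<otimes>\<^bsub>F\<^esub> w) \<in> free_order - Id"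
    if b: "w \<in> free_basis K n" "u \<in> free_basis K n" "v \<in> free_basis K n" "(u, v) \<in> free_order - Id" for w u v
  proof -
    obtain w' u' v' where w: "w' \<in> words" "w = XW w'" "u = XW u'" "v = XW v'"
      using b(1-3) unfolding free_basis_def by blast
    show ?thesis
      using b(4) word_less_append[OF _ w(1)] unfolding w(2-) word_mult free_order_strict by blast
  qed
  moreover have "(v, w) \<in> free_order - Id"
    if b: "w \<in> free_basis K n" "u \<in> free_basis K n" "v \<in> free_basis K n" "s \<in> free_basis K n"
      "w \<noteq> v" "w = u \<otimes>\<^bsub>F\<^esub> v \<otimes>\<^bsub>F\<^esub> s" for w u v s
  proof -
    obtain u' v' s' where w: "u' \<in> words" "v' \<in> words" "s' \<in> words" "u = XW u'" "v = XW v'" "s = XW s'"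
      using b(2-4) unfolding free_basis_def by blast
    have "w = XW (u' @ v' @ s')" using b(6) w by (simp add: word_mult)
    then show ?thesis
      using b(5) word_less_factor[OF w(1-3)] unfolding w(5) by (simp only: free_order_strict word_inj) auto
  qed
  ultimately show ?thesis
    unfolding free_monomial_ordering_def Let_def using free_order_well by blast
qed

section \<open>Leading words of elements of the kernel\<close>

interpretation FO: ordered_basis K F "free_basis K n" free_order
  by (rule assoc_algebra_ordered_basis[OF free_assoc_algebra free_is_basis
        well_order_on_linear[OF free_order_well]])

text \<open>A word below the sorted word \<open>w\<close> is not a rearrangement of
  \<open>w\<close>, by \<open>sorted_lenlex_least\<close>. Its exponents are therefore strictly
  smaller, and so is its leading monomial in \<open>A\<close>.\<close>

lemma sorted_below:
  assumes "sorted w" "w \<in> words" "g \<in> FO.below (XW w)" shows "\<pi> g \<in> O.below (ev w)"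
proof -
  have "g \<in> {g \<in> carrier F. \<pi> g \<in> O.below (ev w)}"
  proof (rule FO.below_induct[OF assms(3)])
    fix c x assume c: "c \<in> carrier K" and x: "(x, XW w) \<in> free_order - Id"
    then have "x \<in> free_basis K n" using FO.order_field by blast
    then obtain v where v: "v \<in> words" "x = XW v" unfolding free_basis_def by blast
    have "(v, w) \<in> word_less" using x unfolding v(2) free_order_strict .
    moreover have "\<not> (mset v = mset w \<and> (v, w) \<in> lenlex less_than)"
      using sorted_lenlex_least[OF assms(1)] by blast
    ultimately have "v \<lessdot> w" unfolding word_less_def by blast
    then have "ev v \<in> O.below (ev w)"
      using O.leads_below[OF ev_leads[OF v(1)] ev_sort_pbw[OF v(1)]] sorted_sort_id[OF assms(1)] by simp
    then show "c \<odot>\<^bsub>F\<^esub> x \<in> {g \<in> carrier F. \<pi> g \<in> O.below (ev w)}"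
      unfolding v(2) using c word_closed[OF v(1)] by (simp add: O.below_smult)
  qed (auto simp: O.below_zero O.below_add)
  then show ?thesis by simp
qed

lemma kernel_LM_unsorted:
  assumes "f \<in> I" "f \<noteq> \<zero>\<^bsub>F\<^esub>"
  obtains w where "w \<in> words" "FO.LMA f = XW w" "\<not> sorted w"
proof -
  have f: "f \<in> carrier F" "\<pi> f = \<zero>\<^bsub>A\<^esub>" using assms(1) by (auto simp: kernel_iff)
  obtain w where w: "w \<in> words" "FO.LMA f = XW w"
    using FO.LM_props(3)[OF f(1) assms(2)] unfolding free_basis_def by blast
  have "\<not> sorted w"
  proof
    assume srt: "sorted w"
    obtain c g where c: "c \<in> carrier K" "c \<noteq> \<zero>\<^bsub>K\<^esub>" and g: "g \<in> FO.below (XW w)"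
      and dec: "f = c \<odot>\<^bsub>F\<^esub> XW w \<oplus>\<^bsub>F\<^esub> g"
      using FO.LM_decompose[OF f(1) assms(2)] w(2) by metis
    have "\<pi> f = c \<odot>\<^bsub>A\<^esub> ev w \<oplus>\<^bsub>A\<^esub> \<pi> g"
      unfolding dec using c(1) word_closed[OF w(1)] FO.below_carrier[OF g] by simp
    then have "O.LMA \<zero>\<^bsub>A\<^esub> = ev w"
      using O.LM_leading[OF ev_sorted_pbw[OF w(1) srt] c sorted_below[OF srt w(1) g]] f(2) by simp
    then show False using O.basis_nonzero[OF ev_sorted_pbw[OF w(1) srt]] by simp
  qed
  then show thesis using that w by blast
qed

section \<open>The relators given by the commutation relations of a solvable algebra\<close>

context
  fixes l :: "nat \<Rightarrow> nat \<Rightarrow> 'k" and f :: "nat \<Rightarrow> nat \<Rightarrow> 'a"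
  assumes relation: "\<And>i j. 1 \<le> i \<Longrightarrow> i < j \<Longrightarrow> j \<le> n \<Longrightarrow>
    l j i \<in> carrier K - {\<zero>\<^bsub>K\<^esub>} \<and> f j i \<in> O.below (ev [i, j]) \<and>
    ev [j, i] = l j i \<odot>\<^bsub>A\<^esub> ev [i, j] \<oplus>\<^bsub>A\<^esub> f j i"
begin

definition lower_coeffs :: "nat \<Rightarrow> nat \<Rightarrow> (nat \<Rightarrow> nat) \<Rightarrow> 'k" where
  "lower_coeffs j i = (\<lambda>\<alpha>. O.coef (f j i) (ev (word_of n \<alpha>)))"

abbreviation "rel j i \<equiv> relator K n l lower_coeffs j i"
abbreviation "relators \<equiv> {rel j i | i j. 1 \<le> i \<and> i < j \<and> j \<le> n}"

lemma lower_coeffs_props: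
  assumes "1 \<le> i" "i < j" "j \<le> n"
  shows "lower_coeffs j i \<in> coeff_functions K n" "ordered_sum K A n a (lower_coeffs j i) = f j i"
  using ordered_sum_coeff[of "f j i"] relation[OF assms] O.below_carrier unfolding lower_coeffs_def by blast+

text \<open>Both parts of \<open>word_less\<close> are needed: \<open>[i, j]\<close> lies below
  \<open>[j, i]\<close> by the tie-break, and the words of the tail have smaller exponents because
  \<open>f j i\<close> lies below \<open>ev [i, j]\<close>.\<close>

lemma relator_decompose:
  assumes "1 \<le> i" "i < j" "j \<le> n"
  obtains g where "rel j i = \<one>\<^bsub>K\<^esub> \<odot>\<^bsub>F\<^esub> XW [j, i] \<oplus>\<^bsub>F\<^esub> g" "g \<in> normal_forms" "g \<in> FO.below (XW [j, i])"
proof -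
  note w = relator_generators[OF assms] and rl = relation[OF assms] and lc = lower_coeffs_props[OF assms]
  let ?S = "ordered_sum K F n (free_generator K) (lower_coeffs j i)"
  \<comment> \<open>Signs are absorbed into scalars so that the closure lemmas for
    \<open>normal_forms\<close> and \<open>below\<close> apply.\<close>
  let ?g = "(\<ominus>\<^bsub>K\<^esub> l j i) \<odot>\<^bsub>F\<^esub> XW [i, j] \<oplus>\<^bsub>F\<^esub> (\<ominus>\<^bsub>K\<^esub> \<one>\<^bsub>K\<^esub>) \<odot>\<^bsub>F\<^esub> ?S"
  note S = free_ordered_sum[OF lc(1)]
  have cl: "XW [i, j] \<in> carrier F" "XW [j, i] \<in> carrier F" using w(1,2)[THEN word_closed] .
  have "rel j i = \<one>\<^bsub>K\<^esub> \<odot>\<^bsub>F\<^esub> XW [j, i] \<oplus>\<^bsub>F\<^esub> ?g"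
    unfolding relator_def Let_def free_generator_mult
    using rl cl S(1) by (simp add: F.smult_l_minus F.M.minus_eq F.M.a_assoc)
  moreover have "?S \<in> normal_forms"
    using S unfolding normal_forms_def by (simp del: in_lists_conv_set)
  then have "?g \<in> normal_forms"
    using rl w(1) assms(2) by (intro normal_forms_add normal_forms_smult normal_forms_word) auto
  moreover have "?g \<in> FO.below (XW [j, i])"
  proof (intro FO.below_add FO.below_smult)
    have "([i, j], [j, i]) \<in> word_less"
      using w(1,2) assms(2) unfolding word_less_def by (simp add: Cons_lenlex_iff)
    then show "XW [i, j] \<in> FO.below (XW [j, i])"
      by (intro FO.below_basis) (simp only: free_order_strict)
    show "?S \<in> FO.below (XW [j, i])"
      unfolding FO.below_def
    proof (intro CollectI conjI allI impI)
      fix x assume x: "FB.coef ?S x \<noteq> \<zero>\<^bsub>K\<^esub>"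
      then have "x \<in> free_basis K n" using FB.coeff_outside[OF S(1)] by blast
      then obtain v where v: "v \<in> words" "x = XW v" unfolding free_basis_def by blast
      have nz: "?S v \<noteq> \<zero>\<^bsub>K\<^esub>" using x free_coeff[OF S(1) v(1)] v(2) by simp
      then have srt: "sorted v" and "lower_coeffs j i (count_list v) \<noteq> \<zero>\<^bsub>K\<^esub>"
        unfolding S(2) by (auto split: if_splits)
      then have "O.coef (f j i) (ev v) \<noteq> \<zero>\<^bsub>K\<^esub>"
        using word_of_count_list[OF srt v(1)] by (simp add: lower_coeffs_def)
      then have "(ev v, ev [i, j]) \<in> r - Id" using rl unfolding O.below_def by blast
      moreover have "sort [j, i] = [i, j]" using assms(2) by simp
      ultimately have "v \<lessdot> [j, i]" using sorted_sort_id[OF srt] by simp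
      then have "(v, [j, i]) \<in> word_less" using v(1) w(2) unfolding word_less_def by blast
      then show "(x, XW [j, i]) \<in> free_order - Id" unfolding v(2) free_order_strict .
    qed (rule S(1))
  qed (use rl in auto)
  ultimately show thesis by (rule that)
qed

lemma relator_carrier:
  assumes "1 \<le> i" "i < j" "j \<le> n" shows "rel j i \<in> carrier F"
proof (rule relator_decompose[OF assms])
  fix g assume "rel j i = \<one>\<^bsub>K\<^esub> \<odot>\<^bsub>F\<^esub> XW [j, i] \<oplus>\<^bsub>F\<^esub> g" "g \<in> normal_forms"
  then show ?thesis
    using word_closed[OF relator_generators(2)[OF assms]] by (simp add: normal_forms_def)
qed

text \<open>The last claim is for reducedness: apart from \<open>[j, i]\<close> only sorted words
  occur in the relator.\<close>

lemma relator_LM: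
  assumes "1 \<le> i" "i < j" "j \<le> n"
  shows "FO.LMA (rel j i) = XW [j, i]" "FB.coef (rel j i) (XW [j, i]) = \<one>\<^bsub>K\<^esub>" "rel j i \<noteq> \<zero>\<^bsub>F\<^esub>"
    and "FB.coef (rel j i) x \<noteq> \<zero>\<^bsub>K\<^esub> \<Longrightarrow> \<exists>w\<in>words. x = XW w \<and> (w = [j, i] \<or> sorted w)"
proof -
  obtain g where g: "rel j i = \<one>\<^bsub>K\<^esub> \<odot>\<^bsub>F\<^esub> XW [j, i] \<oplus>\<^bsub>F\<^esub> g" "g \<in> normal_forms" "g \<in> FO.below (XW [j, i])"
    by (rule relator_decompose[OF assms])
  note ji = relator_generators(2)[OF assms]
  have b: "XW [j, i] \<in> free_basis K n" using ji unfolding free_basis_def by (rule imageI)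
  have gF: "g \<in> carrier F" using g(2) by (simp add: normal_forms_def)
  show "FO.LMA (rel j i) = XW [j, i]"
    unfolding g(1) using b g(3) by (intro FO.LM_leading) auto
  have co: "FB.coef (rel j i) x = (if x = XW [j, i] then \<one>\<^bsub>K\<^esub> else \<zero>\<^bsub>K\<^esub>) \<oplus>\<^bsub>K\<^esub> FB.coef g x" for x
    unfolding g(1) using b gF FB.basis_closed[OF b] by (simp add: FB.coeff_add FB.coeff_basis)
  have "FB.coef g (XW [j, i]) = \<zero>\<^bsub>K\<^esub>" using g(3) unfolding FO.below_def by blast
  then show one: "FB.coef (rel j i) (XW [j, i]) = \<one>\<^bsub>K\<^esub>" unfolding co by simp
  then show "rel j i \<noteq> \<zero>\<^bsub>F\<^esub>" using FB.coeff_zero one_not_zero by metis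
  assume x: "FB.coef (rel j i) x \<noteq> \<zero>\<^bsub>K\<^esub>"
  then have "x \<in> free_basis K n" using FB.coeff_outside[OF relator_carrier[OF assms]] by blast
  then obtain w where w: "w \<in> words" "x = XW w" unfolding free_basis_def by blast
  have "sorted w" if "w \<noteq> [j, i]"
  proof -
    have "FB.coef g x \<noteq> \<zero>\<^bsub>K\<^esub>" using x that unfolding co w(2) word_inj by auto
    then have "g w \<noteq> \<zero>\<^bsub>K\<^esub>" using free_coeff[OF gF w(1)] w(2) by simp
    then show ?thesis using g(2) by (simp add: normal_forms_def)
  qed
  then show "\<exists>w\<in>words. x = XW w \<and> (w = [j, i] \<or> sorted w)" using w by blast
qed

lemma relator_kernel:
  assumes "1 \<le> i" "i < j" "j \<le> n" shows "rel j i \<in> I"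
proof -
  note w = relator_generators[OF assms] and rl = relation[OF assms] and lc = lower_coeffs_props[OF assms]
  note cl = w(1,2)[THEN word_closed] w(1,2)[THEN ev_closed]
  have "free_generator K ` {1..n} \<subseteq> carrier F" using free_generator_closed by blast
  note os = P.hom_ordered_sum[OF this generators lc(1), unfolded lc(2)]
  have fA: "f j i \<in> carrier A" using rl O.below_carrier by blast
  have "\<pi> (rel j i) = ev [j, i] \<ominus>\<^bsub>A\<^esub> l j i \<odot>\<^bsub>A\<^esub> ev [i, j] \<ominus>\<^bsub>A\<^esub> f j i"
    using os rl cl unfolding relator_def Let_def free_generator_mult by simp
  also have "\<dots> = \<zero>\<^bsub>A\<^esub>"
    using rl[THEN conjunct2, THEN conjunct2] rl cl fA
    by (simp add: P.B.M.minus_eq P.B.M.a_assoc P.B.M.a_comm[of "l j i \<odot>\<^bsub>A\<^esub> ev [i, j]"]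
        P.B.M.r_neg P.B.M.r_neg2)
  finally show ?thesis using relator_carrier[OF assms] by (simp add: kernel_iff)
qed

lemma relators_groebner: "groebner_basis K n free_order I relators"
  unfolding groebner_basis_def Let_def
proof (intro conjI ballI impI)
  show "relators \<subseteq> I" using relator_kernel by blast
  fix p assume p: "p \<in> I" "p \<noteq> \<zero>\<^bsub>F\<^esub>"
  obtain w where w: "w \<in> words" "FO.LMA p = XW w" "\<not> sorted w"
    by (rule kernel_LM_unsorted[OF p])
  obtain u i j v where uv: "w = u @ [j, i] @ v" "i < j" by (rule unsorted_descent[OF w(3)])
  have ij: "1 \<le> i" "i < j" "j \<le> n" and "u \<in> words" "v \<in> words" using w(1) uv by auto
  then have b: "XW u \<in> free_basis K n" "XW v \<in> free_basis K n" unfolding free_basis_def by blast+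
  have "FO.LMA p = XW u \<otimes>\<^bsub>F\<^esub> FO.LMA (rel j i) \<otimes>\<^bsub>F\<^esub> XW v"
    unfolding w(2) uv(1) relator_LM(1)[OF ij] by (simp add: word_mult)
  then show "\<exists>g\<in>relators. g \<noteq> \<zero>\<^bsub>F\<^esub> \<and> (\<exists>u\<in>free_basis K n. \<exists>v\<in>free_basis K n.
      FO.LMA p = u \<otimes>\<^bsub>F\<^esub> FO.LMA g \<otimes>\<^bsub>F\<^esub> v)"
    using b ij relator_LM(3)[OF ij] by blast
qed

text \<open>A word containing \<open>[j', i']\<close> is unsorted, so if it occurs in the relator of
  \<open>j\<close> and \<open>i\<close> it is \<open>[j, i]\<close>; equal lengths then force the
  two pairs to agree.\<close>

lemma relators_reduced: "reduced_groebner_basis K n free_order I relators"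
  unfolding reduced_groebner_basis_def Let_def
proof (intro conjI ballI impI relators_groebner)
  fix g assume "g \<in> relators"
  then obtain i j where ij: "1 \<le> i" "i < j" "j \<le> n" and g: "g = rel j i" by blast
  show "g \<noteq> \<zero>\<^bsub>F\<^esub>" using relator_LM(3)[OF ij] g by simp
  show "LC K F (free_basis K n) free_order g = \<one>\<^bsub>K\<^esub>"
    unfolding LC_def g relator_LM(1)[OF ij] by (rule relator_LM(2)[OF ij])
  fix x g' assume x: "x \<in> basis_supp K F (free_basis K n) g" and "g' \<in> relators" and ne: "g' \<noteq> g"
  then obtain i' j' where ij': "1 \<le> i'" "i' < j'" "j' \<le> n" and g': "g' = rel j' i'" by blast
  have "FB.coef (rel j i) x \<noteq> \<zero>\<^bsub>K\<^esub>" using x g by (simp add: basis_supp_def)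
  then obtain w where w: "x = XW w" "w = [j, i] \<or> sorted w" using relator_LM(4)[OF ij] by blast
  show "\<not> (\<exists>u\<in>free_basis K n. \<exists>v\<in>free_basis K n. x = u \<otimes>\<^bsub>F\<^esub> FO.LMA g' \<otimes>\<^bsub>F\<^esub> v)"
  proof (rule notI, elim bexE)
    fix u v assume "u \<in> free_basis K n" "v \<in> free_basis K n" and eq: "x = u \<otimes>\<^bsub>F\<^esub> FO.LMA g' \<otimes>\<^bsub>F\<^esub> v"
    then obtain u' v' where "u = XW u'" "v = XW v'" unfolding free_basis_def by blast
    then have "w = u' @ [j', i'] @ v'"
      using eq w(1) unfolding g' relator_LM(1)[OF ij'] by (simp add: word_mult word_inj)
    moreover from this have "\<not> sorted w" using ij'(2) by (simp add: sorted_append)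
    ultimately have "[j, i] = u' @ [j', i'] @ v'" using w(2) by simp
    then have "j = j' \<and> i = i'" by (cases u') (auto simp: append_eq_Cons_conv)
    then show False using ne g g' by simp
  qed
qed

lemma condition_a_holds: "condition_a K n I free_order l lower_coeffs"
  unfolding condition_a_def
proof (intro conjI allI impI relators_reduced free_order_monomial)
  fix i j assume "1 \<le> i \<and> i < j \<and> j \<le> n"
  then have ij: "1 \<le> i" "i < j" "j \<le> n" by auto
  show "l j i \<in> carrier K - {\<zero>\<^bsub>K\<^esub>}" using relation[OF ij] by blast
  show "lower_coeffs j i \<in> coeff_functions K n" by (rule lower_coeffs_props(1)[OF ij])
  show "FO.LMA (rel j i) = free_generator K j \<otimes>\<^bsub>F\<^esub> free_generator K i"
    unfolding free_generator_mult by (rule relator_LM(1)[OF ij])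
next
  have "relators \<subseteq> (\<lambda>(j, i). rel j i) ` ({..n} \<times> {..n})" by force
  then have "finite relators" by (rule finite_subset) simp
  then show "\<exists>G. finite G \<and> groebner_basis K n free_order I G" using relators_groebner by blast
qed

text \<open>The ordering of \<open>A\<close> is carried to the quotient by the inverse of
  \<open>\<phi>\<close>, which maps \<open>f j i\<close> to the ordered sum with the same
  coefficients in the coset generators.\<close>

lemma condition_b_holds: "condition_b K n I lower_coeffs"
proof -
  let ?\<psi> = "inv_into (carrier Q) \<phi>" and ?B = "ordered_monomials Q n x\<^sub>Q"
  have image: "?\<psi> ` pbw = ?B"
    by (rule QI.hom_ordered_monomials[OF generators_closed inverse_generator])
  have mo: "monomial_ordering K Q ?B (dir_image r ?\<psi>)"
    using QI.monomial_ordering_image[OF pbw_is_basis pbw_well_order ordering] by (simp only: image)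
  have "(LM K Q ?B (dir_image r ?\<psi>) (ordered_sum K Q n x\<^sub>Q (lower_coeffs j i)), x\<^sub>Q i \<otimes>\<^bsub>Q\<^esub> x\<^sub>Q j)
      \<in> dir_image r ?\<psi> - Id"
    if ij: "1 \<le> i" "i < j" "j \<le> n" and nz: "ordered_sum K Q n x\<^sub>Q (lower_coeffs j i) \<noteq> \<zero>\<^bsub>Q\<^esub>" for i j
  proof -
    note lc = lower_coeffs_props[OF ij]
    have os: "ordered_sum K Q n x\<^sub>Q (lower_coeffs j i) = ?\<psi> (f j i)"
      using QI.hom_ordered_sum(2)[OF generators_closed inverse_generator lc(1)] by (simp only: lc(2))
    have ij': "i \<in> {1..n}" "j \<in> {1..n}" using ij by auto
    have "x\<^sub>Q i \<otimes>\<^bsub>Q\<^esub> x\<^sub>Q j = ?\<psi> (ev [i, j])"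
      using generators_closed ij' inverse_generator QI.hom_mult[of "a i" "a j"] by (simp only: ev_pair) blast
    moreover have f: "f j i \<in> O.below (ev [i, j])" using relation[OF ij] by blast
    moreover have "f j i \<noteq> \<zero>\<^bsub>A\<^esub>" using nz os QI.hom_zero by metis
    ultimately have lt: "(O.LMA (f j i), ev [i, j]) \<in> r - Id" unfolding O.below_iff by blast
    then have "(?\<psi> (O.LMA (f j i)), ?\<psi> (ev [i, j])) \<in> dir_image r ?\<psi> - Id"
      using QI.strict_order_image[OF pbw_is_basis pbw_well_order] O.order_field by blast
    moreover have "LM K Q ?B (dir_image r ?\<psi>) (?\<psi> (f j i)) = ?\<psi> (O.LMA (f j i))"
      using QI.LM_image[OF pbw_is_basis pbw_well_order O.below_carrier[OF f]] by (simp only: image)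
    ultimately show ?thesis using \<open>x\<^sub>Q i \<otimes>\<^bsub>Q\<^esub> x\<^sub>Q j = ?\<psi> (ev [i, j])\<close> os by simp
  qed
  then show ?thesis unfolding condition_b_def Let_def using mo by blast
qed

end

lemma conditions_hold: "\<exists>r l m. condition_a K n I r l m \<and> condition_b K n I m"
proof -
  \<comment> \<open>Quantifying over pairs \<open>p = (j, i)\<close> lets the constants and the
    correction terms be chosen together; nothing is asserted for pairs outside the range.\<close>
  have "\<forall>p. \<exists>c g. 1 \<le> snd p \<and> snd p < fst p \<and> fst p \<le> n \<longrightarrow>
      c \<in> carrier K - {\<zero>\<^bsub>K\<^esub>} \<and> g \<in> O.below (ev [snd p, fst p]) \<and>
      ev [fst p, snd p] = c \<odot>\<^bsub>A\<^esub> ev [snd p, fst p] \<oplus>\<^bsub>A\<^esub> g"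
  proof
    fix p :: "nat \<times> nat"
    obtain j i where p: "p = (j, i)" by (cases p)
    show "\<exists>c g. 1 \<le> snd p \<and> snd p < fst p \<and> fst p \<le> n \<longrightarrow>
      c \<in> carrier K - {\<zero>\<^bsub>K\<^esub>} \<and> g \<in> O.below (ev [snd p, fst p]) \<and>
      ev [fst p, snd p] = c \<odot>\<^bsub>A\<^esub> ev [snd p, fst p] \<oplus>\<^bsub>A\<^esub> g"
    proof (cases "1 \<le> i \<and> i < j \<and> j \<le> n")
      case True
      then have "O.leads (ev [j, i]) (ev (sort [j, i]))"
        using ev_leads[OF relator_generators(2)] by blast
      moreover have "sort [j, i] = [i, j]" using True by simp
      ultimately show ?thesis unfolding O.leads_def p fst_conv snd_conv by metis
    next
      case False
      then show ?thesis unfolding p fst_conv snd_conv by blast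
    qed
  qed
  then obtain c g where "\<And>p. 1 \<le> snd p \<and> snd p < fst p \<and> fst p \<le> n \<Longrightarrow>
      c p \<in> carrier K - {\<zero>\<^bsub>K\<^esub>} \<and> g p \<in> O.below (ev [snd p, fst p]) \<and>
      ev [fst p, snd p] = c p \<odot>\<^bsub>A\<^esub> ev [snd p, fst p] \<oplus>\<^bsub>A\<^esub> g p"
    by metis
  then have "\<And>i j. 1 \<le> i \<Longrightarrow> i < j \<Longrightarrow> j \<le> n \<Longrightarrow>
      c (j, i) \<in> carrier K - {\<zero>\<^bsub>K\<^esub>} \<and> g (j, i) \<in> O.below (ev [i, j]) \<and>
      ev [j, i] = c (j, i) \<odot>\<^bsub>A\<^esub> ev [i, j] \<oplus>\<^bsub>A\<^esub> g (j, i)"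
    by fastforce
  from condition_a_holds[of "\<lambda>j i. c (j, i)" "\<lambda>j i. g (j, i)", OF this]
    condition_b_holds[of "\<lambda>j i. c (j, i)" "\<lambda>j i. g (j, i)", OF this]
  show ?thesis by blast
qed

end

end

context algebra_presentation
begin

lemma conditions_if_solvable:
  assumes "solvable_polynomial_algebra K A n a"
  shows "\<exists>r l m. condition_a K n I r l m \<and> condition_b K n I m"
proof -
  obtain r where r: "has_pbw_basis K A n a" "monomial_ordering K A pbw r"
    and solv: "\<forall>\<alpha>\<in>exponents n. \<forall>\<beta>\<in>exponents n.
    \<exists>c \<in> carrier K - {\<zero>\<^bsub>K\<^esub>}. \<exists>f \<in> carrier A.
      ordered_monomial A n a \<alpha> \<otimes>\<^bsub>A\<^esub> ordered_monomial A n a \<beta> =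
        c \<odot>\<^bsub>A\<^esub> ordered_monomial A n a (\<lambda>i. \<alpha> i + \<beta> i) \<oplus>\<^bsub>A\<^esub> f \<and>
      (f = \<zero>\<^bsub>A\<^esub> \<or>
        (LM K A pbw r f, ordered_monomial A n a (\<lambda>i. \<alpha> i + \<beta> i)) \<in> r - Id)"
    using assms unfolding solvable_polynomial_algebra_def by blast
  interpret ordered_presentation K n A \<pi> a r
    using r by unfold_locales
  show ?thesis
    using conditions_hold[unfolded solvable_iff, OF solv] .
qed

end

text \<open>What has to be proved is surjectivity: the image of \<open>\<pi>\<close> contains the
  generators and is closed under the operations that build the generated subalgebra.\<close>

lemma algebra_presentationI:
  fixes K :: "('k, 'm) ring_scheme" and A :: "('k, 'a, 's) module_scheme"
  assumes alg: "assoc_algebra K A"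
    and gen: "generated_subalgebra K A (a ` {1..n}) = carrier A"
    and hom: "\<pi> \<in> algebra_hom K (free_algebra K n) A"
    and on_gen: "\<forall>i\<in>{1..n}. \<pi> (free_generator K i) = a i"
  shows "algebra_presentation K n A \<pi> a"
proof -
  interpret alg: assoc_algebra K A by (rule alg)
  interpret free_algebra_field K n by unfold_locales
  interpret P: algebra_homomorphism K "free_algebra K n" A \<pi>
    using hom by unfold_locales
  have "x \<in> \<pi> ` carrier F" if "x \<in> generated_subalgebra K A (a ` {1..n})" for x
    using that
  proof (induction rule: generated_subalgebra.induct)
    case one
    show ?case using P.hom_one F.A.one_closed by (metis imageI)
  next
    case (incl x)
    then obtain i where i: "i \<in> {1..n}" "x = a i" by blast
    have "free_generator K i \<in> carrier F"
      unfolding free_generator_def using i(1) by (intro word_closed) simp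
    then show ?case using on_gen i by (metis imageI)
  next
    case (add x y)
    then obtain f g where "f \<in> carrier F" "g \<in> carrier F" "x = \<pi> f" "y = \<pi> g" by blast
    then show ?case by (metis P.hom_add F.M.a_closed imageI)
  next
    case (smult c x)
    then obtain f where "f \<in> carrier F" "x = \<pi> f" by blast
    then show ?case using smult(1) by (metis P.hom_smult free_smult_closed imageI)
  next
    case (mult x y)
    then obtain f g where "f \<in> carrier F" "g \<in> carrier F" "x = \<pi> f" "y = \<pi> g" by blast
    then show ?case by (metis P.hom_mult F.A.m_closed imageI)
  qed
  then have "\<pi> ` carrier F = carrier A" using gen P.hom_closed by blast
  then show ?thesis using on_gen by unfold_locales auto
qed

theorem theorem2p5:
  fixes K :: "('k, 'm) ring_scheme" and A :: "('k, 'a, 's) module_scheme"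
    and n :: nat and a :: "nat \<Rightarrow> 'a"
    and \<pi> :: "(nat list \<Rightarrow> 'k) \<Rightarrow> 'a" and I :: "(nat list \<Rightarrow> 'k) set"
  assumes "assoc_algebra K A"
    and "a ` {1..n} \<subseteq> carrier A"
    and "generated_subalgebra K A (a ` {1..n}) = carrier A"
    and "\<pi> \<in> algebra_hom K (free_algebra K n) A"
    and "\<forall>i\<in>{1..n}. \<pi> (free_generator K i) = a i"
    and "I = a_kernel (free_algebra K n) A \<pi>"
  shows "(solvable_polynomial_algebra K A n a \<longleftrightarrow>
      (\<exists>r l m. condition_a K n I r l m \<and> condition_b K n I m)) \<and>
    (\<forall>r l m. condition_a K n I r l m \<longrightarrow>
      has_pbw_basis K (quotient_algebra (free_algebra K n) I) n (coset_generator K n I))"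
proof -
  interpret AP: algebra_presentation K n A \<pi> a
    by (rule algebra_presentationI[OF assms(1,3-5)])
  have I: "I = AP.I" unfolding assms(6) AP.I_def ..
  show ?thesis
    unfolding I
    using AP.solvable_if_conditions AP.conditions_if_solvable AP.quotient_pbw[OF AP.condition_a_pbw]
    by blast
qed

end
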